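(* Let $A$ be a C*-algebra which is the direct limit of a (directed) system of simple tracially $\mathcal{Z}$-absorbing C*-algebras. Then $A$ is also simple and tracially $\mathcal{Z}$-absorbing.
   Context: C*-algebras are not assumed unital. Simple means having no closed two-sided ideals other than $0$ and the whole algebra (the zero algebra is allowed). For positive elements $a,b$ of a C*-algebra $A$, $a \precsim b$ (Cuntz subequivalence) means there is a sequence $(v_n)$ in $A$ with $\|a - v_n b v_n^*\| \to 0$. For self-adjoint $c$ and $\varepsilon>0$, $(c-\varepsilon)_+$ is obtained by applying $t \mapsto \max(t-\varepsilon,0)$. $M_n=M_n(\mathbb{C})$, $[y,z]=yz-zy$. A completely positive contractive (c.p.c.) map $\varphi$ has order zero if $\varphi(y)\varphi(z)=0$ whenever $y,z$ are positive with $yz=0$. A simple C*-algebra $A$ is tracially $\mathcal{Z}$-absorbing if $A \not\cong \mathbb{C}$ and for every $x,a \in A_+$ with $a \neq 0$, every finite set $F \subseteq A$, every $\varepsilon>0$, and every $n \in \mathbb{N}$, there is a c.p.c. order zero map $\varphi\colon M_n \to A$ such that (i) $(x^2 - x\varphi(1)x - \varepsilon)_+ \precsim a$, and (ii) $\|[\varphi(z),b]\| < \varepsilon$ for all $z \in M_n$ with $\|z\| \le 1$ and all $b \in F$. *)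

theory Defs
  imports
    "HOL-Algebra.Module"
    "HOL-Analysis.Abstract_Metric_Spaces"
    "HOL-Analysis.L2_Norm"
    "HOL-Analysis.Uniform_Limit"
    "HOL-Computational_Algebra.Polynomial"
    "Jordan_Normal_Form.Schur_Decomposition"
begin

section \<open>C*-algebras on carrier sets\<close>

text \<open>
  The record extends the ring record of HOL-Algebra, whose field \<open>one\<close> is never constrained below:
  C*-algebras need not be unital.
\<close>

record 'a cstar_alg = "(complex, 'a) module" +
  star :: "'a \<Rightarrow> 'a"
  cnorm :: "'a \<Rightarrow> real"

text \<open>The value off the carrier only serves the total axioms of the locale \<open>Metric_space\<close>.\<close>

definition cdist :: "'a cstar_alg \<Rightarrow> 'a \<Rightarrow> 'a \<Rightarrow> real" where
  "cdist A x y = (if x \<in> carrier A \<and> y \<in> carrier A then cnorm A (x \<ominus>\<^bsub>A\<^esub> y) else 0)"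

locale pre_cstar_algebra = abelian_group A for A :: "'a cstar_alg" (structure) +
  assumes mult_closed: "\<lbrakk>x \<in> carrier A; y \<in> carrier A\<rbrakk> \<Longrightarrow> x \<otimes> y \<in> carrier A"
    and mult_assoc: "\<lbrakk>x \<in> carrier A; y \<in> carrier A; z \<in> carrier A\<rbrakk>
      \<Longrightarrow> (x \<otimes> y) \<otimes> z = x \<otimes> (y \<otimes> z)"
    and distrib_right: "\<lbrakk>x \<in> carrier A; y \<in> carrier A; z \<in> carrier A\<rbrakk>
      \<Longrightarrow> (x \<oplus> y) \<otimes> z = x \<otimes> z \<oplus> y \<otimes> z"
    and distrib_left: "\<lbrakk>x \<in> carrier A; y \<in> carrier A; z \<in> carrier A\<rbrakk>
      \<Longrightarrow> x \<otimes> (y \<oplus> z) = x \<otimes> y \<oplus> x \<otimes> z"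
    and scale_closed: "x \<in> carrier A \<Longrightarrow> c \<odot> x \<in> carrier A"
    and scale_add_left: "x \<in> carrier A \<Longrightarrow> (c + d) \<odot> x = c \<odot> x \<oplus> d \<odot> x"
    and scale_add_right: "\<lbrakk>x \<in> carrier A; y \<in> carrier A\<rbrakk> \<Longrightarrow> c \<odot> (x \<oplus> y) = c \<odot> x \<oplus> c \<odot> y"
    and scale_scale: "x \<in> carrier A \<Longrightarrow> c \<odot> (d \<odot> x) = (c * d) \<odot> x"
    and scale_1: "x \<in> carrier A \<Longrightarrow> 1 \<odot> x = x"
    and scale_mult_left: "\<lbrakk>x \<in> carrier A; y \<in> carrier A\<rbrakk> \<Longrightarrow> (c \<odot> x) \<otimes> y = c \<odot> (x \<otimes> y)"
    and scale_mult_right: "\<lbrakk>x \<in> carrier A; y \<in> carrier A\<rbrakk> \<Longrightarrow> x \<otimes> (c \<odot> y) = c \<odot> (x \<otimes> y)"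
    and star_closed: "x \<in> carrier A \<Longrightarrow> star A x \<in> carrier A"
    and star_star: "x \<in> carrier A \<Longrightarrow> star A (star A x) = x"
    and star_add: "\<lbrakk>x \<in> carrier A; y \<in> carrier A\<rbrakk> \<Longrightarrow> star A (x \<oplus> y) = star A x \<oplus> star A y"
    and star_scale: "x \<in> carrier A \<Longrightarrow> star A (c \<odot> x) = cnj c \<odot> star A x"
    and star_mult: "\<lbrakk>x \<in> carrier A; y \<in> carrier A\<rbrakk> \<Longrightarrow> star A (x \<otimes> y) = star A y \<otimes> star A x"
    and cnorm_nonneg: "x \<in> carrier A \<Longrightarrow> 0 \<le> cnorm A x"
    and cnorm_eq_zero: "x \<in> carrier A \<Longrightarrow> cnorm A x = 0 \<longleftrightarrow> x = \<zero>"
    and cnorm_triangle: "\<lbrakk>x \<in> carrier A; y \<in> carrier A\<rbrakk>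
      \<Longrightarrow> cnorm A (x \<oplus> y) \<le> cnorm A x + cnorm A y"
    and cnorm_scale: "x \<in> carrier A \<Longrightarrow> cnorm A (c \<odot> x) = cmod c * cnorm A x"
    and cnorm_mult: "\<lbrakk>x \<in> carrier A; y \<in> carrier A\<rbrakk>
      \<Longrightarrow> cnorm A (x \<otimes> y) \<le> cnorm A x * cnorm A y"
    and cstar_identity: "x \<in> carrier A \<Longrightarrow> cnorm A (star A x \<otimes> x) = (cnorm A x)\<^sup>2"
begin

lemma scale_minus_1:
  assumes x: "x \<in> carrier A"
  shows "(- 1) \<odot> x = \<ominus> x"
proof -
  have "0 \<odot> x \<oplus> 0 \<odot> x = 0 \<odot> x"
    using scale_add_left[OF x, of 0 0] by simp
  then have z: "0 \<odot> x = \<zero>"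
    using scale_closed[OF x] by (simp add: add.l_cancel_one)
  have "(- 1) \<odot> x \<oplus> x = \<zero>"
    using scale_add_left[OF x, of "-1" 1] scale_1[OF x] z by simp
  then show ?thesis
    using x scale_closed[OF x] minus_equality by metis
qed

lemma cdist_metric: "Metric_space (carrier A) (cdist A)"
proof
  have minus: "cnorm A (\<ominus> x) = cnorm A x" if "x \<in> carrier A" for x
    using cnorm_scale[OF that, of "-1"] scale_minus_1[OF that] by simp
  fix x y
  show "0 \<le> cdist A x y"
    by (simp add: cdist_def cnorm_nonneg)
  show "cdist A x y = cdist A y x"
  proof (cases "x \<in> carrier A \<and> y \<in> carrier A")
    case True
    then have "y \<ominus> x = \<ominus> (x \<ominus> y)"
      by (simp add: a_minus_def minus_add a_comm)
    with True minus[of "x \<ominus> y"] show ?thesis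
      by (simp add: cdist_def)
  qed (auto simp: cdist_def)
next
  fix x y assume "x \<in> carrier A" "y \<in> carrier A"
  then show "cdist A x y = 0 \<longleftrightarrow> x = y"
    by (simp add: cdist_def cnorm_eq_zero)
next
  fix x y z assume xyz: "x \<in> carrier A" "y \<in> carrier A" "z \<in> carrier A"
  have "x \<ominus> z = (x \<ominus> y) \<oplus> (y \<ominus> z)"
    using xyz by (simp add: a_minus_def a_assoc) (simp add: a_assoc[symmetric] l_neg)
  then show "cdist A x z \<le> cdist A x y + cdist A y z"
    using xyz cnorm_triangle[of "x \<ominus> y" "y \<ominus> z"] by (simp add: cdist_def)
qed

end

sublocale pre_cstar_algebra \<subseteq> Metric_space "carrier A" "cdist A"
  by (rule cdist_metric)

locale cstar_algebra = pre_cstar_algebra +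
  assumes complete: "mcomplete"

abbreviation cstar_topology :: "'a cstar_alg \<Rightarrow> 'a topology" where
  "cstar_topology A \<equiv> Metric_space.mtopology (carrier A) (cdist A)"

definition closed_ideal :: "'a cstar_alg \<Rightarrow> 'a set \<Rightarrow> bool" where
  "closed_ideal A J \<longleftrightarrow>
     J \<subseteq> carrier A \<and> \<zero>\<^bsub>A\<^esub> \<in> J \<and>
     (\<forall>x\<in>J. \<forall>y\<in>J. x \<oplus>\<^bsub>A\<^esub> y \<in> J) \<and>
     (\<forall>c. \<forall>x\<in>J. c \<odot>\<^bsub>A\<^esub> x \<in> J) \<and>
     (\<forall>y\<in>carrier A. \<forall>x\<in>J. y \<otimes>\<^bsub>A\<^esub> x \<in> J \<and> x \<otimes>\<^bsub>A\<^esub> y \<in> J) \<and>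
     closedin (cstar_topology A) J"

definition simple_cstar :: "'a cstar_alg \<Rightarrow> bool" where
  "simple_cstar A \<longleftrightarrow> (\<forall>J. closed_ideal A J \<longrightarrow> J = {\<zero>\<^bsub>A\<^esub>} \<or> J = carrier A)"


section \<open>Linear maps, *-homomorphisms, direct limits\<close>

definition linear_map :: "'a cstar_alg \<Rightarrow> 'b cstar_alg \<Rightarrow> ('a \<Rightarrow> 'b) \<Rightarrow> bool" where
  "linear_map A B f \<longleftrightarrow>
     (\<forall>x\<in>carrier A. f x \<in> carrier B) \<and>
     (\<forall>x\<in>carrier A. \<forall>y\<in>carrier A. f (x \<oplus>\<^bsub>A\<^esub> y) = f x \<oplus>\<^bsub>B\<^esub> f y) \<and>
     (\<forall>c. \<forall>x\<in>carrier A. f (c \<odot>\<^bsub>A\<^esub> x) = c \<odot>\<^bsub>B\<^esub> f x)"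

definition star_hom :: "'a cstar_alg \<Rightarrow> 'b cstar_alg \<Rightarrow> ('a \<Rightarrow> 'b) \<Rightarrow> bool" where
  "star_hom A B f \<longleftrightarrow>
     linear_map A B f \<and>
     (\<forall>x\<in>carrier A. \<forall>y\<in>carrier A. f (x \<otimes>\<^bsub>A\<^esub> y) = f x \<otimes>\<^bsub>B\<^esub> f y) \<and>
     (\<forall>x\<in>carrier A. f (star A x) = star B (f x))"

definition star_isomorphic :: "'a cstar_alg \<Rightarrow> 'b cstar_alg \<Rightarrow> bool" where
  "star_isomorphic A B \<longleftrightarrow> (\<exists>f. star_hom A B f \<and> bij_betw f (carrier A) (carrier B))"

text \<open>\<open>\<phi> i j\<close> is the connecting map from \<open>A i\<close> to \<open>A j\<close>, for \<open>leq i j\<close>.\<close>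

definition cstar_directed_system ::
    "'i set \<Rightarrow> ('i \<Rightarrow> 'i \<Rightarrow> bool) \<Rightarrow> ('i \<Rightarrow> 'a cstar_alg) \<Rightarrow> ('i \<Rightarrow> 'i \<Rightarrow> 'a \<Rightarrow> 'a) \<Rightarrow> bool" where
  "cstar_directed_system I leq A \<phi> \<longleftrightarrow>
     I \<noteq> {} \<and>
     (\<forall>i\<in>I. leq i i) \<and>
     (\<forall>i\<in>I. \<forall>j\<in>I. \<forall>k\<in>I. leq i j \<longrightarrow> leq j k \<longrightarrow> leq i k) \<and>
     (\<forall>i\<in>I. \<forall>j\<in>I. \<exists>k\<in>I. leq i k \<and> leq j k) \<and>
     (\<forall>i\<in>I. cstar_algebra (A i)) \<and>
     (\<forall>i\<in>I. \<forall>j\<in>I. leq i j \<longrightarrow> star_hom (A i) (A j) (\<phi> i j)) \<and>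
     (\<forall>i\<in>I. \<forall>x\<in>carrier (A i). \<phi> i i x = x) \<and>
     (\<forall>i\<in>I. \<forall>j\<in>I. \<forall>k\<in>I. leq i j \<longrightarrow> leq j k \<longrightarrow>
        (\<forall>x\<in>carrier (A i). \<phi> j k (\<phi> i j x) = \<phi> i k x))"

text \<open>
  The C*-algebraic direct limit is the Hausdorff completion of the algebraic direct limit in the
  C*-seminorm sending the class of \<open>x \<in> A i\<close> to \<open>lim\<^sub>j \<parallel>\<phi> i j x\<parallel>\<close>; the net is decreasing, so its limit
  is its infimum.  Being such a completion means: \<open>B\<close> is complete, carries a compatible family of
  *-homomorphisms \<open>\<psi> i\<close> that realise this seminorm, and their images together are dense.  All this
  determines \<open>B\<close> with \<open>\<psi>\<close> up to a unique isomorphism, so no universal property (which would have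
  to quantify over the carrier types of the targets) is needed.
\<close>

definition cstar_direct_limit ::
    "'i set \<Rightarrow> ('i \<Rightarrow> 'i \<Rightarrow> bool) \<Rightarrow> ('i \<Rightarrow> 'a cstar_alg) \<Rightarrow> ('i \<Rightarrow> 'i \<Rightarrow> 'a \<Rightarrow> 'a)
      \<Rightarrow> 'b cstar_alg \<Rightarrow> ('i \<Rightarrow> 'a \<Rightarrow> 'b) \<Rightarrow> bool" where
  "cstar_direct_limit I leq A \<phi> B \<psi> \<longleftrightarrow>
     cstar_directed_system I leq A \<phi> \<and>
     cstar_algebra B \<and>
     (\<forall>i\<in>I. star_hom (A i) B (\<psi> i)) \<and>
     (\<forall>i\<in>I. \<forall>j\<in>I. leq i j \<longrightarrow> (\<forall>x\<in>carrier (A i). \<psi> j (\<phi> i j x) = \<psi> i x)) \<and>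
     (\<forall>i\<in>I. \<forall>x\<in>carrier (A i).
        cnorm B (\<psi> i x) = (INF j\<in>{j\<in>I. leq i j}. cnorm (A j) (\<phi> i j x))) \<and>
     cstar_topology B closure_of (\<Union>i\<in>I. \<psi> i ` carrier (A i)) = carrier B"


section \<open>Positive elements, functional calculus, Cuntz subequivalence\<close>

definition positive_elem :: "'a cstar_alg \<Rightarrow> 'a \<Rightarrow> bool" where
  "positive_elem A a \<longleftrightarrow> (\<exists>b\<in>carrier A. a = star A b \<otimes>\<^bsub>A\<^esub> b)"

text \<open>
  The spectrum in the unitization: \<open>z \<noteq> 0\<close> lies outside it iff \<open>1 - z\<inverse> x\<close> has an inverse, necessarily
  of the form \<open>1 - y\<close> with \<open>y\<close> in the algebra.
\<close>

definition cstar_spectrum :: "'a cstar_alg \<Rightarrow> 'a \<Rightarrow> complex set" where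
  "cstar_spectrum A x = insert 0 {z. z \<noteq> 0 \<and>
     \<not> (\<exists>y\<in>carrier A.
          (inverse z \<odot>\<^bsub>A\<^esub> x \<oplus>\<^bsub>A\<^esub> y) \<ominus>\<^bsub>A\<^esub> (inverse z \<odot>\<^bsub>A\<^esub> x) \<otimes>\<^bsub>A\<^esub> y = \<zero>\<^bsub>A\<^esub> \<and>
          (inverse z \<odot>\<^bsub>A\<^esub> x \<oplus>\<^bsub>A\<^esub> y) \<ominus>\<^bsub>A\<^esub> y \<otimes>\<^bsub>A\<^esub> (inverse z \<odot>\<^bsub>A\<^esub> x) = \<zero>\<^bsub>A\<^esub>)}"

text \<open>\<open>cstar_power_Suc A x n\<close> is the power of \<open>x\<close> with exponent \<open>n + 1\<close>; there is no zeroth power.\<close>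

primrec cstar_power_Suc :: "'a cstar_alg \<Rightarrow> 'a \<Rightarrow> nat \<Rightarrow> 'a" where
  "cstar_power_Suc A x 0 = x"
| "cstar_power_Suc A x (Suc n) = cstar_power_Suc A x n \<otimes>\<^bsub>A\<^esub> x"

text \<open>Evaluation of a real polynomial at \<open>x\<close>, meant for polynomials without constant term.\<close>

definition cstar_poly :: "'a cstar_alg \<Rightarrow> real poly \<Rightarrow> 'a \<Rightarrow> 'a" where
  "cstar_poly A p x =
     (\<Oplus>\<^bsub>A\<^esub>i\<in>{..<degree p}. complex_of_real (coeff p (Suc i)) \<odot>\<^bsub>A\<^esub> cstar_power_Suc A x i)"

text \<open>
  Continuous functional calculus, for self-adjoint \<open>x\<close> and continuous \<open>f\<close> with \<open>f 0 = 0\<close>: \<open>f(x)\<close> is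
  the limit of \<open>p\<^sub>k(x)\<close> for polynomials \<open>p\<^sub>k\<close> without constant term that converge to \<open>f\<close> uniformly on
  the spectrum of \<open>x\<close> (a set of reals).
\<close>

definition cstar_fun_calc :: "'a cstar_alg \<Rightarrow> (real \<Rightarrow> real) \<Rightarrow> 'a \<Rightarrow> 'a" where
  "cstar_fun_calc A f x = (THE y. y \<in> carrier A \<and>
     (\<exists>p :: nat \<Rightarrow> real poly.
        (\<forall>k. coeff (p k) 0 = 0) \<and>
        uniform_limit {t. complex_of_real t \<in> cstar_spectrum A x} (\<lambda>k. poly (p k)) f sequentially \<and>
        (\<lambda>k. cnorm A (cstar_poly A (p k) x \<ominus>\<^bsub>A\<^esub> y)) \<longlonglongrightarrow> 0))"

definition cut_down :: "'a cstar_alg \<Rightarrow> 'a \<Rightarrow> real \<Rightarrow> 'a" where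
  "cut_down A c \<epsilon> = cstar_fun_calc A (\<lambda>t. max (t - \<epsilon>) 0) c"

definition cuntz_subequiv :: "'a cstar_alg \<Rightarrow> 'a \<Rightarrow> 'a \<Rightarrow> bool" where
  "cuntz_subequiv A a b \<longleftrightarrow>
     (\<exists>v :: nat \<Rightarrow> 'a. (\<forall>n. v n \<in> carrier A) \<and>
        (\<lambda>n. cnorm A (a \<ominus>\<^bsub>A\<^esub> (v n \<otimes>\<^bsub>A\<^esub> b) \<otimes>\<^bsub>A\<^esub> star A (v n))) \<longlonglongrightarrow> 0)"


section \<open>Order zero maps\<close>

text \<open>
  A \<open>k \<times> k\<close> matrix over \<open>A\<close> is a function of two indices, of which only the values at indices below
  \<open>k\<close> matter; \<open>positive_matrix\<close> says that it is of the form \<open>Y\<^sup>* Y\<close>, i.e. positive in \<open>M\<^sub>k(A)\<close>.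
\<close>

definition positive_matrix :: "'a cstar_alg \<Rightarrow> nat \<Rightarrow> (nat \<Rightarrow> nat \<Rightarrow> 'a) \<Rightarrow> bool" where
  "positive_matrix A k X \<longleftrightarrow>
     (\<exists>Y. (\<forall>i<k. \<forall>j<k. Y i j \<in> carrier A) \<and>
        (\<forall>i<k. \<forall>j<k. X i j = (\<Oplus>\<^bsub>A\<^esub>l\<in>{..<k}. star A (Y l i) \<otimes>\<^bsub>A\<^esub> Y l j)))"

definition completely_positive :: "'a cstar_alg \<Rightarrow> 'b cstar_alg \<Rightarrow> ('a \<Rightarrow> 'b) \<Rightarrow> bool" where
  "completely_positive A B f \<longleftrightarrow>
     linear_map A B f \<and>
     (\<forall>k X. positive_matrix A k X \<longrightarrow> positive_matrix B k (\<lambda>i j. f (X i j)))"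

definition cpc_map :: "'a cstar_alg \<Rightarrow> 'b cstar_alg \<Rightarrow> ('a \<Rightarrow> 'b) \<Rightarrow> bool" where
  "cpc_map A B f \<longleftrightarrow>
     completely_positive A B f \<and> (\<forall>x\<in>carrier A. cnorm B (f x) \<le> cnorm A x)"

definition order_zero :: "'a cstar_alg \<Rightarrow> 'b cstar_alg \<Rightarrow> ('a \<Rightarrow> 'b) \<Rightarrow> bool" where
  "order_zero A B f \<longleftrightarrow>
     (\<forall>y z. positive_elem A y \<longrightarrow> positive_elem A z \<longrightarrow> y \<otimes>\<^bsub>A\<^esub> z = \<zero>\<^bsub>A\<^esub> \<longrightarrow>
        f y \<otimes>\<^bsub>B\<^esub> f z = \<zero>\<^bsub>B\<^esub>)"


section \<open>The C*-algebra of complex matrices\<close>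

definition vec_l2 :: "complex vec \<Rightarrow> real" where
  "vec_l2 v = L2_set (\<lambda>i. cmod (vec_index v i)) {..<dim_vec v}"

definition mat_op_norm :: "nat \<Rightarrow> complex mat \<Rightarrow> real" where
  "mat_op_norm n z = (SUP v\<in>{v \<in> carrier_vec n. vec_l2 v \<le> 1}. vec_l2 (z *\<^sub>v v))"

definition mat_cstar :: "nat \<Rightarrow> complex mat cstar_alg" where
  "mat_cstar n =
     \<lparr>carrier = carrier_mat n n, mult = (*), one = 1\<^sub>m n, zero = 0\<^sub>m n n, add = (+),
      module.smult = (\<cdot>\<^sub>m), star = mat_adjoint, cnorm = mat_op_norm n\<rparr>"

definition complex_cstar :: "complex cstar_alg" where
  "complex_cstar =
     \<lparr>carrier = UNIV, mult = (*), one = 1, zero = 0, add = (+),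
      module.smult = (*), star = cnj, cnorm = cmod\<rparr>"


section \<open>Tracial Z-absorption\<close>

text \<open>
  Only meant for simple \<open>A\<close>; simplicity is stated separately.  \<open>n\<close> ranges over the positive
  integers, since \<open>n = 0\<close> would force \<open>\<phi> = 0\<close>.
\<close>

definition tracially_Z_absorbing :: "'a cstar_alg \<Rightarrow> bool" where
  "tracially_Z_absorbing A \<longleftrightarrow>
     \<not> star_isomorphic A complex_cstar \<and>
     (\<forall>x a F (\<epsilon>::real) (n::nat).
        positive_elem A x \<longrightarrow> positive_elem A a \<longrightarrow> a \<noteq> \<zero>\<^bsub>A\<^esub> \<longrightarrow>
        finite F \<longrightarrow> F \<subseteq> carrier A \<longrightarrow> \<epsilon> > 0 \<longrightarrow> n \<ge> 1 \<longrightarrow>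
        (\<exists>\<phi>. cpc_map (mat_cstar n) A \<phi> \<and> order_zero (mat_cstar n) A \<phi> \<and>
           cuntz_subequiv A
             (cut_down A (x \<otimes>\<^bsub>A\<^esub> x \<ominus>\<^bsub>A\<^esub> (x \<otimes>\<^bsub>A\<^esub> \<phi> (1\<^sub>m n)) \<otimes>\<^bsub>A\<^esub> x) \<epsilon>) a \<and>
           (\<forall>z\<in>carrier_mat n n. mat_op_norm n z \<le> 1 \<longrightarrow>
              (\<forall>b\<in>F. cnorm A (\<phi> z \<otimes>\<^bsub>A\<^esub> b \<ominus>\<^bsub>A\<^esub> b \<otimes>\<^bsub>A\<^esub> \<phi> z) < \<epsilon>))))"

end

(*
  The spectral theory used here is built from norm identities alone.  For self-adjoint x, the real
  polynomials in x act on the algebra by left multiplication, and p(x) is bounded by the supremum of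
  |p| over the real t for which x - t is not bounded below.  This yields the continuous functional
  calculus, the square root of b* b, and the lemma that (c - eps)_+ is Cuntz below d whenever d is
  positive and |c - d| < eps.

  A closed ideal of the limit containing b contains (c - eps)_+ for every c close to b* b; taking c
  in the image of some A i shows that a nonzero ideal meets, hence contains, the image of every
  sufficiently late A j.  For tracial Z-absorption, approximate x, a and F in one A i, take the order
  zero map given there for (c - eps')_+ in place of a, and compare the cut-downs by the same lemma.
*)
theory Submission
  imports Defs "HOL-Analysis.Weierstrass_Theorems"
begin

section \<open>Elementary norm estimates and limits\<close>

text \<open>Without a unit, \<open>p(x)\<close> need not be an element and invertibility has no
  direct meaning; left multiplication and bounds from below stand in for both. Order is also handled
  through norms: \<open>||M v - x v|| \<le> M ||v||\<close> for all \<open>v\<close> expresses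
  positivity in a form that survives sums.

  A positive element of the limit is never approximated directly. What is approximated is some
  \<open>b\<close> with \<open>b\<^sup>* b\<close> equal to it, so that the approximant from
  \<open>A i\<close> is again positive. Neither membership in an ideal nor Cuntz subequivalence
  tolerates an error in norm, but cutting down by more than the error absorbs it.

  The maps \<open>\<psi> i\<close> may have kernels, and simplicity of \<open>A i\<close> even
  permits \<open>\<psi> i = 0\<close>. The cut-downs that replace a given nonzero element therefore
  have to stay nonzero in the limit, so the size of a cut is squeezed: it must exceed the error, yet
  cut and error together must remain below the norm.\<close>

context pre_cstar_algebra
begin

declare mult_closed [simp] scale_closed [simp] star_closed [simp] star_star [simp] scale_1 [simp]
  cnorm_nonneg [simp]

lemma scale_0 [simp]: "x \<in> carrier A \<Longrightarrow> 0 \<odot> x = \<zero>"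
  using scale_add_left[of x 0 0] by (simp add: add.l_cancel_one)

lemma scale_zero [simp]: "c \<odot> \<zero> = \<zero>"
  using scale_add_right[of \<zero> \<zero> c] by (simp add: add.l_cancel_one)

lemma mult_zero [simp]:
  assumes "x \<in> carrier A"
  shows "x \<otimes> \<zero> = \<zero>" "\<zero> \<otimes> x = \<zero>"
  using distrib_left[of x \<zero> \<zero>] distrib_right[of \<zero> \<zero> x] assms by (simp_all add: add.l_cancel_one)

lemma star_zero [simp]: "star A \<zero> = \<zero>"
  using star_add[of \<zero> \<zero>] by (simp add: add.l_cancel_one)

lemma cnorm_zero [simp]: "cnorm A \<zero> = 0"
  by (simp add: cnorm_eq_zero)

lemma uminus_eq_scale: "x \<in> carrier A \<Longrightarrow> \<ominus> x = (-1) \<odot> x"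
  by (simp add: scale_minus_1)

lemma minus_eq_scale: "y \<in> carrier A \<Longrightarrow> x \<ominus> y = x \<oplus> (-1) \<odot> y"
  by (simp add: a_minus_def scale_minus_1)

lemma scale_collect:
  assumes "x \<in> carrier A"
  shows "c \<odot> x \<oplus> d \<odot> x = (c + d) \<odot> x" "x \<oplus> d \<odot> x = (1 + d) \<odot> x"
    "c \<odot> x \<oplus> x = (c + 1) \<odot> x" "x \<oplus> x = 2 \<odot> x"
  using scale_add_left[OF assms, of c d] scale_add_left[OF assms, of 1 d]
    scale_add_left[OF assms, of c 1] scale_add_left[OF assms, of 1 1] assms by simp_all

text \<open>\<open>a_ac\<close> nests sums to the right, so two multiples of one element often stand
  in front of a further summand. With this, \<open>cstar_simps\<close> becomes a normaliser for
  polynomial identities in noncommuting elements.\<close>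

lemma scale_collect2:
  assumes "x \<in> carrier A" "y \<in> carrier A"
  shows "c \<odot> x \<oplus> (d \<odot> x \<oplus> y) = (c + d) \<odot> x \<oplus> y" "x \<oplus> (d \<odot> x \<oplus> y) = (1 + d) \<odot> x \<oplus> y"
    "c \<odot> x \<oplus> (x \<oplus> y) = (c + 1) \<odot> x \<oplus> y" "x \<oplus> (x \<oplus> y) = 2 \<odot> x \<oplus> y"
  using assms by (simp_all add: a_assoc[symmetric] scale_collect)

lemmas vector_simps = minus_eq_scale uminus_eq_scale scale_add_right scale_scale scale_collect
  scale_collect2 a_ac

lemmas cstar_simps = vector_simps distrib_left distrib_right mult_assoc scale_mult_left
  scale_mult_right star_add star_scale star_mult

lemma minus_self [simp]: "x \<in> carrier A \<Longrightarrow> x \<ominus> x = \<zero>"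
  by simp

lemma cnorm_minus_commute: "x \<in> carrier A \<Longrightarrow> y \<in> carrier A \<Longrightarrow> cnorm A (x \<ominus> y) = cnorm A (y \<ominus> x)"
  using commute[of x y] by (simp add: cdist_def)

lemma cnorm_diff_triangle:
  assumes "x \<in> carrier A" "y \<in> carrier A" "z \<in> carrier A"
  shows "cnorm A (x \<ominus> z) \<le> cnorm A (x \<ominus> y) + cnorm A (y \<ominus> z)"
  using triangle[of x y z] assms by (simp add: cdist_def)

lemma cnorm_minus_le:
  assumes "x \<in> carrier A" "y \<in> carrier A"
  shows "cnorm A (x \<ominus> y) \<le> cnorm A x + cnorm A y"
  using cnorm_triangle[of x "\<ominus> y"] cnorm_scale[of y "-1"] assms by (simp add: a_minus_def uminus_eq_scale)

lemma cnorm_le_diff: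
  assumes "x \<in> carrier A" "y \<in> carrier A"
  shows "cnorm A x \<le> cnorm A y + cnorm A (x \<ominus> y)"
proof -
  have "x = y \<oplus> (x \<ominus> y)"
    using assms by (simp add: vector_simps)
  then show ?thesis
    using cnorm_triangle[of y "x \<ominus> y"] assms by simp
qed

lemma abs_cnorm_diff:
  assumes "x \<in> carrier A" "y \<in> carrier A"
  shows "\<bar>cnorm A x - cnorm A y\<bar> \<le> cnorm A (x \<ominus> y)"
  using cnorm_le_diff[of x y] cnorm_le_diff[of y x] cnorm_minus_commute[of x y] assms by simp

lemma cnorm_star [simp]:
  assumes "x \<in> carrier A"
  shows "cnorm A (star A x) = cnorm A x"
proof -
  have *: "cnorm A x \<le> cnorm A (star A x)" if "x \<in> carrier A" for x
  proof (cases "cnorm A x = 0")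
    case False
    have "cnorm A x * cnorm A x \<le> cnorm A (star A x) * cnorm A x"
      using cstar_identity[OF that] cnorm_mult[of "star A x" x] that by (simp add: power2_eq_square)
    then show ?thesis
      using False cnorm_nonneg[OF that] by simp
  qed (use that in simp)
  from *[OF assms] *[of "star A x"] assms show ?thesis
    by simp
qed

lemma cstar_identity': "x \<in> carrier A \<Longrightarrow> cnorm A (x \<otimes> star A x) = (cnorm A x)\<^sup>2"
  using cstar_identity[of "star A x"] by simp

lemma cnorm_diff_add:
  assumes "x \<in> carrier A" "y \<in> carrier A" "x' \<in> carrier A" "y' \<in> carrier A"
  shows "cnorm A ((x \<oplus> y) \<ominus> (x' \<oplus> y')) \<le> cnorm A (x \<ominus> x') + cnorm A (y \<ominus> y')"
proof -
  have "(x \<oplus> y) \<ominus> (x' \<oplus> y') = (x \<ominus> x') \<oplus> (y \<ominus> y')"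
    using assms by (simp add: vector_simps)
  then show ?thesis
    using cnorm_triangle[of "x \<ominus> x'" "y \<ominus> y'"] assms by simp
qed

lemma cnorm_diff_mult:
  assumes "x \<in> carrier A" "y \<in> carrier A" "x' \<in> carrier A" "y' \<in> carrier A"
  shows "cnorm A (x \<otimes> y \<ominus> x' \<otimes> y') \<le> cnorm A x * cnorm A (y \<ominus> y') + cnorm A (x \<ominus> x') * cnorm A y'"
proof -
  have "x \<otimes> y \<ominus> x' \<otimes> y' = x \<otimes> (y \<ominus> y') \<oplus> (x \<ominus> x') \<otimes> y'"
    using assms by (simp add: cstar_simps)
  then show ?thesis
    using cnorm_triangle[of "x \<otimes> (y \<ominus> y')" "(x \<ominus> x') \<otimes> y'"] cnorm_mult[of x "y \<ominus> y'"]
      cnorm_mult[of "x \<ominus> x'" y'] assms by simp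
qed

lemma minus_distribs:
  assumes "x \<in> carrier A" "y \<in> carrier A" "z \<in> carrier A"
  shows "z \<otimes> (x \<ominus> y) = z \<otimes> x \<ominus> z \<otimes> y" "(x \<ominus> y) \<otimes> z = x \<otimes> z \<ominus> y \<otimes> z"
    "star A (x \<ominus> y) = star A x \<ominus> star A y"
  using assms by (simp_all add: cstar_simps)

lemma cnorm_diff_star:
  assumes "x \<in> carrier A" "y \<in> carrier A"
  shows "cnorm A (star A x \<ominus> star A y) = cnorm A (x \<ominus> y)"
  using cnorm_star[of "x \<ominus> y"] assms by (simp add: minus_distribs)

text \<open>Testing with \<open>b = star A (x \<ominus> y)\<close> and the C*-identity separates
  elements. This replaces evaluation at a unit and lets identities about \<open>act\<close> descend
  to elements.\<close>

lemma eq_if_mult_eq: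
  assumes "x \<in> carrier A" "y \<in> carrier A" "\<And>b. b \<in> carrier A \<Longrightarrow> x \<otimes> b = y \<otimes> b"
  shows "x = y"
proof -
  have "(x \<ominus> y) \<otimes> star A (x \<ominus> y) = \<zero>"
    using assms(1,2) assms(3)[of "star A (x \<ominus> y)"] by (simp add: minus_distribs(2))
  then have "cnorm A (x \<ominus> y) = 0"
    using cstar_identity'[of "x \<ominus> y"] assms by simp
  then show ?thesis
    using assms by (simp add: cnorm_eq_zero)
qed

text \<open>Membership of the limit and of all terms is part of the notion, so the limit laws below
  carry no closure conditions.\<close>

definition tends :: "(nat \<Rightarrow> 'a) \<Rightarrow> 'a \<Rightarrow> bool" where
  "tends s y \<longleftrightarrow> y \<in> carrier A \<and> (\<forall>n. s n \<in> carrier A) \<and> (\<lambda>n. cnorm A (s n \<ominus> y)) \<longlonglongrightarrow> 0"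

lemma tends_closed: "tends s y \<Longrightarrow> y \<in> carrier A" "tends s y \<Longrightarrow> s n \<in> carrier A"
  by (auto simp: tends_def)

lemma tends_const: "y \<in> carrier A \<Longrightarrow> tends (\<lambda>n. y) y"
  by (simp add: tends_def)

lemma tendsI_bound:
  assumes "y \<in> carrier A" "\<And>n. s n \<in> carrier A" "\<And>n. cnorm A (s n \<ominus> y) \<le> r n" "r \<longlonglongrightarrow> 0"
  shows "tends s y"
  unfolding tends_def using assms
  by (auto intro!: tendsto_sandwich[OF _ _ tendsto_const assms(4)] always_eventually)

lemma tends_cnorm:
  assumes "tends s y"
  shows "(\<lambda>n. cnorm A (s n)) \<longlonglongrightarrow> cnorm A y"
proof (rule LIM_zero_cancel, rule Lim_null_comparison)
  show "\<forall>\<^sub>F n in sequentially. norm (cnorm A (s n) - cnorm A y) \<le> cnorm A (s n \<ominus> y)"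
    using assms by (auto simp: tends_def abs_cnorm_diff)
qed (use assms in \<open>simp add: tends_def\<close>)

lemma tends_unique:
  assumes "tends s y" "tends s z"
  shows "y = z"
proof -
  have "(\<lambda>n. cnorm A (s n \<ominus> y) + cnorm A (s n \<ominus> z)) \<longlonglongrightarrow> 0 + 0"
    using assms unfolding tends_def by (intro tendsto_add) auto
  moreover have "cnorm A (y \<ominus> z) \<le> cnorm A (s n \<ominus> y) + cnorm A (s n \<ominus> z)" for n
    using cnorm_diff_triangle[of y "s n" z] cnorm_minus_commute[of y "s n"] assms
    by (simp add: tends_def)
  ultimately have "cnorm A (y \<ominus> z) \<le> 0"
    by (intro tendsto_lowerbound[where F=sequentially]) auto
  then have "cnorm A (y \<ominus> z) = 0"
    using assms by (intro antisym) (auto simp: tends_def)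
  then show ?thesis
    using assms by (simp add: cnorm_eq_zero tends_def)
qed

lemma tends_add:
  assumes "tends s y" "tends t z"
  shows "tends (\<lambda>n. s n \<oplus> t n) (y \<oplus> z)"
proof (rule tendsI_bound)
  show "(\<lambda>n. cnorm A (s n \<ominus> y) + cnorm A (t n \<ominus> z)) \<longlonglongrightarrow> 0"
    using tendsto_add[of _ 0 sequentially _ 0] assms unfolding tends_def by auto
qed (use assms in \<open>auto simp: tends_def cnorm_diff_add\<close>)

lemma tends_scale:
  assumes "tends s y"
  shows "tends (\<lambda>n. c \<odot> s n) (c \<odot> y)"
proof (rule tendsI_bound)
  show "(\<lambda>n. cmod c * cnorm A (s n \<ominus> y)) \<longlonglongrightarrow> 0"
    using tendsto_mult_left[of _ 0 sequentially "cmod c"] assms unfolding tends_def by auto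
  show "cnorm A (c \<odot> s n \<ominus> c \<odot> y) \<le> cmod c * cnorm A (s n \<ominus> y)" for n
    using cnorm_scale[of "s n \<ominus> y" c] assms by (simp add: tends_def vector_simps mult.commute)
qed (use assms in \<open>auto simp: tends_def\<close>)

lemma tends_minus:
  assumes "tends s y" "tends t z"
  shows "tends (\<lambda>n. s n \<ominus> t n) (y \<ominus> z)"
  using tends_add[OF assms(1) tends_scale[OF assms(2), of "-1"]] assms
  by (simp add: minus_eq_scale tends_def)

lemma tends_star: "tends s y \<Longrightarrow> tends (\<lambda>n. star A (s n)) (star A y)"
  by (simp add: tends_def cnorm_diff_star)

lemma tends_mult:
  assumes "tends s y" "tends t z"
  shows "tends (\<lambda>n. s n \<otimes> t n) (y \<otimes> z)"
proof (rule tendsI_bound)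
  have "(\<lambda>n. cnorm A (s n) * cnorm A (t n \<ominus> z) + cnorm A (s n \<ominus> y) * cnorm A z)
      \<longlonglongrightarrow> cnorm A y * 0 + 0 * cnorm A z"
    using assms tends_cnorm[OF assms(1)] unfolding tends_def by (intro tendsto_intros) auto
  then show "(\<lambda>n. cnorm A (s n) * cnorm A (t n \<ominus> z) + cnorm A (s n \<ominus> y) * cnorm A z) \<longlonglongrightarrow> 0"
    by simp
qed (use assms in \<open>auto simp: tends_def cnorm_diff_mult\<close>)

end

context cstar_algebra
begin

text \<open>Completeness enters the development only here, for the limits on which the functional
  calculus rests.\<close>

lemma tends_Cauchy:
  assumes "\<And>n. s n \<in> carrier A"
    and "\<And>e. e > 0 \<Longrightarrow> \<exists>N. \<forall>m\<ge>N. \<forall>n\<ge>N. cnorm A (s m \<ominus> s n) < e"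
  shows "\<exists>y. tends s y"
proof -
  have "MCauchy s"
    unfolding MCauchy_def using assms by (fastforce simp: cdist_def)
  then obtain y where "limitin mtopology s y sequentially"
    using complete unfolding mcomplete_def by blast
  then have y: "y \<in> carrier A" and lim: "\<forall>e>0. \<exists>N. \<forall>n\<ge>N. cdist A (s n) y < e"
    unfolding limit_metric_sequentially by blast+
  then have "tends s y"
    unfolding tends_def LIMSEQ_def using assms(1) by (simp add: cdist_def)
  then show ?thesis ..
qed

end


section \<open>Polynomials in a self-adjoint element\<close>

lemma map_poly_mult_hom:
  fixes f :: "'a::comm_semiring_0 \<Rightarrow> 'b::comm_semiring_0"
  assumes "f 0 = 0" "\<And>a b. f (a + b) = f a + f b" "\<And>a b. f (a * b) = f a * f b"
  shows "map_poly f (p * q) = map_poly f p * map_poly f q"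
proof -
  have "f (sum g S) = (\<Sum>i\<in>S. f (g i))" if "finite S" for g and S :: "nat set"
    using that by (induction S) (simp_all add: assms)
  then show ?thesis
    by (intro poly_eqI) (simp add: coeff_map_poly coeff_mult assms)
qed

abbreviation cnj_poly :: "complex poly \<Rightarrow> complex poly" where
  "cnj_poly \<equiv> map_poly cnj"

abbreviation cpoly :: "real poly \<Rightarrow> complex poly" where
  "cpoly \<equiv> map_poly complex_of_real"

lemma cnj_poly_mult: "cnj_poly (p * q) = cnj_poly p * cnj_poly q"
  by (rule map_poly_mult_hom) simp_all

lemma cnj_poly_add: "cnj_poly (p + q) = cnj_poly p + cnj_poly q"
  by (intro poly_eqI) (simp add: coeff_map_poly)

lemma cnj_poly_diff: "cnj_poly (p - q) = cnj_poly p - cnj_poly q"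
  by (intro poly_eqI) (simp add: coeff_map_poly)

lemma cnj_poly_minus: "cnj_poly (- p) = - cnj_poly p"
  by (intro poly_eqI) (simp add: coeff_map_poly)

lemma cnj_poly_smult: "cnj_poly (smult c p) = smult (cnj c) (cnj_poly p)"
  by (intro poly_eqI) (simp add: coeff_map_poly)

lemma cnj_poly_pCons: "cnj_poly (pCons c p) = pCons (cnj c) (cnj_poly p)"
  by (intro poly_eqI) (simp add: coeff_map_poly coeff_pCons split: nat.split)

lemma cnj_poly_1 [simp]: "cnj_poly 1 = 1"
  by (simp add: one_pCons cnj_poly_pCons)

lemma cnj_poly_power: "cnj_poly (p ^ n) = cnj_poly p ^ n"
  by (induction n) (simp_all add: cnj_poly_mult)

lemma cnj_cpoly [simp]: "cnj_poly (cpoly p) = cpoly p"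
  by (intro poly_eqI) (simp add: coeff_map_poly)

lemma cpoly_mult: "cpoly (p * q) = cpoly p * cpoly q"
  by (rule map_poly_mult_hom) simp_all

lemma cpoly_diff: "cpoly (p - q) = cpoly p - cpoly q"
  by (intro poly_eqI) (simp add: coeff_map_poly)

lemma poly_cpoly [simp]: "poly (cpoly p) (complex_of_real t) = complex_of_real (poly p t)"
  by (induction p) (simp_all add: map_poly_pCons)

context pre_cstar_algebra
begin

text \<open>\<open>act x p b\<close> is \<open>p(x) b\<close>; a constant term of \<open>p\<close> is allowed because only products with \<open>b\<close> are
  formed, and this is what replaces the unitization.\<close>

definition act :: "'a \<Rightarrow> complex poly \<Rightarrow> 'a \<Rightarrow> 'a" where
  "act x p b = fold_coeffs (\<lambda>c v. c \<odot> b \<oplus> x \<otimes> v) p \<zero>"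

lemma act_0 [simp]: "act x 0 b = \<zero>"
  by (simp add: act_def)

lemma act_pCons [simp]:
  assumes "x \<in> carrier A" "b \<in> carrier A"
  shows "act x (pCons c p) b = c \<odot> b \<oplus> x \<otimes> act x p b"
proof (cases "c = 0 \<and> p = 0")
  case True
  then show ?thesis
    using assms by simp
next
  case False
  then show ?thesis
    by (cases "p = 0") (auto simp: act_def)
qed

lemma act_closed [simp]:
  assumes "x \<in> carrier A" "b \<in> carrier A"
  shows "act x p b \<in> carrier A"
  by (induction p) (use assms in simp_all)

lemma act_1 [simp]: "x \<in> carrier A \<Longrightarrow> b \<in> carrier A \<Longrightarrow> act x 1 b = b"
  by (simp add: one_pCons)

lemma act_add:
  assumes "x \<in> carrier A" "b \<in> carrier A"
  shows "act x (p + q) b = act x p b \<oplus> act x q b"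
proof (induction p arbitrary: q)
  case (pCons c p)
  obtain d r where q: "q = pCons d r"
    by (cases q)
  show ?case
    using assms pCons.IH[of r] by (simp add: q cstar_simps)
qed (use assms in simp)

lemma act_smult:
  assumes "x \<in> carrier A" "b \<in> carrier A"
  shows "act x (smult c p) b = c \<odot> act x p b"
  by (induction p) (use assms in \<open>simp_all add: cstar_simps\<close>)

lemma act_diff:
  assumes "x \<in> carrier A" "b \<in> carrier A"
  shows "act x (p - q) b = act x p b \<ominus> act x q b"
  using act_add[OF assms, of p "smult (-1) q"] act_smult[OF assms, of "-1" q] assms
  by (simp add: minus_eq_scale)

lemma act_linear:
  assumes "x \<in> carrier A" "b \<in> carrier A" "d \<in> carrier A"
  shows "act x p (b \<oplus> d) = act x p b \<oplus> act x p d" "act x p (c \<odot> b) = c \<odot> act x p b"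
    "act x p (b \<otimes> d) = act x p b \<otimes> d" "act x p (b \<ominus> d) = act x p b \<ominus> act x p d"
proof -
  have 1: "act x p (b \<oplus> e) = act x p b \<oplus> act x p e" if "e \<in> carrier A" for e
    by (induction p) (use assms that in \<open>simp_all add: cstar_simps\<close>)
  have 2: "act x p (k \<odot> e) = k \<odot> act x p e" if "e \<in> carrier A" for e k
    by (induction p) (use assms that in \<open>simp_all add: cstar_simps mult.commute\<close>)
  have 3: "act x p (b \<otimes> d) = act x p b \<otimes> d"
    by (induction p) (use assms in \<open>simp_all add: cstar_simps\<close>)
  have 4: "act x p (b \<ominus> d) = act x p b \<ominus> act x p d"
    using 1[of "(-1) \<odot> d"] 2[of d "-1"] assms by (simp add: minus_eq_scale)
  show "act x p (b \<oplus> d) = act x p b \<oplus> act x p d" "act x p (c \<odot> b) = c \<odot> act x p b"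
    "act x p (b \<otimes> d) = act x p b \<otimes> d" "act x p (b \<ominus> d) = act x p b \<ominus> act x p d"
    using 1[OF assms(3)] 2[OF assms(2)] 3 4 by blast+
qed

lemma act_mult:
  assumes "x \<in> carrier A" "b \<in> carrier A"
  shows "act x (p * q) b = act x p (act x q b)"
  by (induction p) (use assms in \<open>simp_all add: act_add act_smult\<close>)

lemma act_commute: "x \<in> carrier A \<Longrightarrow> b \<in> carrier A \<Longrightarrow> act x p (act x q b) = act x q (act x p b)"
  by (metis act_mult mult.commute)

lemma act_left_mult: "x \<in> carrier A \<Longrightarrow> b \<in> carrier A \<Longrightarrow> act x p (x \<otimes> b) = x \<otimes> act x p b"
  using act_commute[of x b p "[:0, 1:]"] by simp

text \<open>\<open>star A b \<otimes> d\<close> serves as an algebra-valued inner product of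
  \<open>b\<close> and \<open>d\<close>. Left multiplication by a self-adjoint \<open>x\<close> is
  symmetric for it, so the conjugate polynomial gives the adjoint of \<open>p(x)\<close>, which
  itself need not be an element.\<close>

lemma star_act:
  assumes "x \<in> carrier A" "star A x = x" "b \<in> carrier A" "d \<in> carrier A"
  shows "star A (act x p b) \<otimes> d = star A b \<otimes> act x (cnj_poly p) d"
  using assms(4)
proof (induction p arbitrary: d)
  case (pCons c p)
  then have d: "d \<in> carrier A"
    by simp
  have "star A (act x p b) \<otimes> (x \<otimes> d) = star A b \<otimes> act x (cnj_poly p) (x \<otimes> d)"
    using pCons.IH[of "x \<otimes> d"] assms(1) d by simp
  also have "act x (cnj_poly p) (x \<otimes> d) = x \<otimes> act x (cnj_poly p) d"
    using assms(1) d by (rule act_left_mult)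
  finally show ?case
    using assms(1-3) d
    by (simp add: cnj_poly_pCons distrib_right distrib_left star_add star_scale star_mult
        scale_mult_left scale_mult_right mult_assoc)
qed (use assms in simp)

text \<open>The squared norm is the norm of
  \<open>star A b \<otimes> act x (cnj_poly p * p) b\<close>, so polynomials of equal modulus on the
  real line can be exchanged in norm estimates.\<close>

lemma cnorm_act_eq:
  assumes "x \<in> carrier A" "star A x = x" "b \<in> carrier A" "cnj_poly p * p = cnj_poly q * q"
  shows "cnorm A (act x p b) = cnorm A (act x q b)"
proof -
  have "(cnorm A (act x p b))\<^sup>2 = cnorm A (star A b \<otimes> act x (cnj_poly p * p) b)" for p
    using cstar_identity[of "act x p b"] assms by (simp add: star_act act_mult)
  then have "(cnorm A (act x p b))\<^sup>2 = (cnorm A (act x q b))\<^sup>2"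
    by (simp only: assms)
  then show ?thesis
    using assms by simp
qed

lemma cnorm_half:
  assumes "u \<in> carrier A" "v \<in> carrier A" "w \<in> carrier A" "c \<odot> w = u \<ominus> v" "cnorm A u \<le> r" "cnorm A v \<le> r"
  shows "cmod c * cnorm A w \<le> 2 * r"
  using cnorm_scale[of w c] cnorm_minus_le[of u v] assms by simp

text \<open>\<open>x - z\<close> and \<open>x - cnj z\<close> have equal norms on \<open>b\<close>
  and differ by the scalar \<open>2 i Im z\<close>. Hence nonreal roots never obstruct boundedness
  below.\<close>

lemma cnorm_act_nonreal:
  assumes "x \<in> carrier A" "star A x = x" "b \<in> carrier A"
  shows "\<bar>Im z\<bar> * cnorm A b \<le> cnorm A (act x [:-z, 1:] b)"
proof -
  have eq: "cnorm A (act x [:- cnj z, 1:] b) = cnorm A (act x [:-z, 1:] b)"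
    by (rule cnorm_act_eq) (use assms in \<open>simp_all add: cnj_poly_pCons mult.commute\<close>)
  have "(2 * Im z * \<i>) \<odot> b = act x [:- cnj z, 1:] b \<ominus> act x [:-z, 1:] b"
  proof -
    have "[:- cnj z, 1:] - [:-z, 1:] = [:2 * Im z * \<i>:]"
      by (simp add: complex_eq_iff)
    then have "act x [:- cnj z, 1:] b \<ominus> act x [:-z, 1:] b = act x [:2 * Im z * \<i>:] b"
      using assms by (simp only: act_diff[symmetric])
    then show ?thesis
      using assms by simp
  qed
  from cnorm_half[OF _ _ _ this, of "cnorm A (act x [:-z, 1:] b)"] assms eq show ?thesis
    by (simp add: norm_mult)
qed

text \<open>Both bounds come from \<open>\<parallel>(\<mu> + i W) v\<parallel> = \<parallel>(\<mu> - i W) v\<parallel>\<close> by averaging.\<close>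

lemma cnorm_act_one_plus_square:
  assumes "x \<in> carrier A" "star A x = x" "b \<in> carrier A" "cnj_poly W = W"
  shows "\<mu>\<^sup>2 * cnorm A b \<le> cnorm A (act x ([:complex_of_real \<mu>:]\<^sup>2 + W\<^sup>2) b)"
    and "2 * \<bar>\<mu>\<bar> * cnorm A (act x W b) \<le> cnorm A (act x ([:complex_of_real \<mu>:]\<^sup>2 + W\<^sup>2) b)"
proof -
  \<comment> \<open>The product of the two conjugate factors is the polynomial of the statement.
    Since \<open>- N\<close> has the modulus of \<open>P\<close> too, the scalar
    \<open>P + N\<close> is also a difference of two terms of equal norm.\<close>
  define M P N where "M = [:complex_of_real \<mu>:]" and "P = M + smult \<i> W" and "N = M - smult \<i> W"
  have cnj: "cnj_poly P = N" "cnj_poly N = P" "cnj_poly M = M"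
    by (simp_all add: P_def N_def M_def cnj_poly_add cnj_poly_diff cnj_poly_smult assms(4) cnj_poly_pCons)
  have prod: "M\<^sup>2 + W\<^sup>2 = N * P"
    by (simp add: P_def N_def power2_eq_square algebra_simps)
  have PN: "cnorm A (act x N d) = cnorm A (act x P d)" if "d \<in> carrier A" for d
    by (rule cnorm_act_eq) (use assms that cnj in \<open>simp_all add: mult.commute\<close>)
  have *: "\<bar>\<mu>\<bar> * cnorm A d \<le> cnorm A (act x P d)" if "d \<in> carrier A" for d
  proof -
    have "(2 * \<mu>) \<odot> d = act x P d \<ominus> act x (- N) d"
    proof -
      have "P - (- N) = [:2 * complex_of_real \<mu>:]"
        by (simp add: P_def N_def M_def)
      then have "act x P d \<ominus> act x (- N) d = act x [:2 * complex_of_real \<mu>:] d"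
        using assms(1) that by (simp only: act_diff[symmetric])
      then show ?thesis
        using assms(1) that by simp
    qed
    moreover have "cnorm A (act x (- N) d) = cnorm A (act x P d)"
      by (rule cnorm_act_eq) (use assms that cnj in \<open>simp_all add: mult.commute cnj_poly_minus\<close>)
    ultimately show ?thesis
      using cnorm_half[of "act x P d" "act x (- N) d" d "2 * \<mu>" "cnorm A (act x P d)"] assms(1) that
      by (simp add: norm_mult)
  qed
  have "\<mu>\<^sup>2 * cnorm A b = \<bar>\<mu>\<bar> * (\<bar>\<mu>\<bar> * cnorm A b)"
    by (simp add: power2_eq_square flip: mult.assoc)
  also have "\<dots> \<le> \<bar>\<mu>\<bar> * cnorm A (act x P b)"
    using *[of b] assms by (intro mult_left_mono) auto
  also have "\<dots> \<le> cnorm A (act x P (act x P b))"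
    using *[of "act x P b"] assms by simp
  also have "\<dots> = cnorm A (act x (N * P) b)"
    using PN[of "act x P b"] assms by (simp add: act_mult)
  finally show "\<mu>\<^sup>2 * cnorm A b \<le> cnorm A (act x ([:complex_of_real \<mu>:]\<^sup>2 + W\<^sup>2) b)"
    by (simp add: prod M_def[symmetric])
  \<comment> \<open>For the second bound: \<open>P\<^sup>2\<close> and \<open>N\<^sup>2\<close> have
    the modulus of \<open>N P\<close>, and their difference is a multiple of
    \<open>W\<close>.\<close>
  have "(4 * \<i> * \<mu>) \<odot> act x W b = act x (P * P) b \<ominus> act x (N * N) b"
  proof -
    have "P * P - N * N = smult (4 * \<i> * \<mu>) W"
      by (rule poly_eqI) (simp add: P_def N_def M_def algebra_simps numeral_poly)
    then show ?thesis
      using assms(1,3) by (simp only: act_diff[symmetric] act_smult[symmetric])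
  qed
  moreover have "cnorm A (act x (P * P) b) = cnorm A (act x (N * P) b)"
    by (rule cnorm_act_eq) (use assms cnj in \<open>simp_all add: mult_ac cnj_poly_mult\<close>)
  moreover have "cnorm A (act x (N * N) b) = cnorm A (act x (N * P) b)"
    by (rule cnorm_act_eq) (use assms cnj in \<open>simp_all add: mult_ac cnj_poly_mult\<close>)
  ultimately show "2 * \<bar>\<mu>\<bar> * cnorm A (act x W b) \<le> cnorm A (act x ([:complex_of_real \<mu>:]\<^sup>2 + W\<^sup>2) b)"
    using cnorm_half[of "act x (P * P) b" "act x (N * N) b" "act x W b" "4 * \<i> * \<mu>"
        "cnorm A (act x (N * P) b)"] assms(1,3)
    by (simp add: norm_mult prod M_def[symmetric])
qed

end


section \<open>The approximate point spectrum\<close>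

lemma cpoly_pCons: "cpoly (pCons a p) = pCons (complex_of_real a) (cpoly p)"
  by (intro poly_eqI) (simp add: coeff_map_poly coeff_pCons split: nat.split)

context pre_cstar_algebra
begin

definition bounded_below :: "'a \<Rightarrow> complex poly \<Rightarrow> bool" where
  "bounded_below x p \<longleftrightarrow> (\<exists>c>0. \<forall>b\<in>carrier A. c * cnorm A b \<le> cnorm A (act x p b))"

lemma bounded_belowI:
  assumes "c > 0" "\<And>b. b \<in> carrier A \<Longrightarrow> c * cnorm A b \<le> cnorm A (act x p b)"
  shows "bounded_below x p"
  using assms unfolding bounded_below_def by blast

lemma bounded_below_mult:
  assumes "x \<in> carrier A" "bounded_below x p" "bounded_below x q"
  shows "bounded_below x (p * q)"
proof -
  obtain c d where c: "c > 0" "\<And>b. b \<in> carrier A \<Longrightarrow> c * cnorm A b \<le> cnorm A (act x p b)"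
    and d: "d > 0" "\<And>b. b \<in> carrier A \<Longrightarrow> d * cnorm A b \<le> cnorm A (act x q b)"
    using assms(2,3) unfolding bounded_below_def by blast
  show ?thesis
  proof (rule bounded_belowI)
    show "c * d > 0"
      using c d by simp
    fix b assume b: "b \<in> carrier A"
    have "c * (d * cnorm A b) \<le> c * cnorm A (act x q b)"
      using c d(2)[OF b] by simp
    also have "\<dots> \<le> cnorm A (act x p (act x q b))"
      using c(2) assms(1) b by simp
    finally show "c * d * cnorm A b \<le> cnorm A (act x (p * q) b)"
      using assms(1) b by (simp add: act_mult mult.assoc)
  qed
qed

text \<open>The fundamental theorem of algebra splits off linear factors, and bounds from below
  multiply. This takes the place of the spectral mapping theorem.\<close>

lemma bounded_below_if_roots:
  assumes "x \<in> carrier A" "p \<noteq> 0" "\<And>z. poly p z = 0 \<Longrightarrow> bounded_below x [:-z, 1:]"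
  shows "bounded_below x p"
  using assms(2,3)
proof (induction "degree p" arbitrary: p)
  case 0
  then obtain c where c: "p = [:c:]" "c \<noteq> 0"
    by (metis degree_eq_zeroE pCons_0_0)
  show ?case
    by (rule bounded_belowI[of "cmod c"]) (use c assms(1) in \<open>simp_all add: cnorm_scale\<close>)
next
  case (Suc n)
  have "\<not> constant (poly p)"
    using Suc.hyps(2) by (simp add: constant_degree)
  then obtain z where z: "poly p z = 0"
    using fundamental_theorem_of_algebra by blast
  then obtain q where q: "p = [:-z, 1:] * q"
    by (auto simp: poly_eq_0_iff_dvd)
  have "q \<noteq> 0"
    using Suc.prems(1) q by auto
  then have "degree p = Suc (degree q)"
    unfolding q by (subst degree_mult_eq) auto
  then have "bounded_below x q"
    using Suc.hyps(1)[of q] Suc.hyps(2) Suc.prems(2) \<open>q \<noteq> 0\<close> q by simp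
  then show ?case
    unfolding q using Suc.prems(2)[OF z] assms(1) by (intro bounded_below_mult)
qed

text \<open>Only a subset of the real spectrum, but it suffices for the norms of self-adjoint elements.\<close>

definition ap_spectrum :: "'a \<Rightarrow> real set" where
  "ap_spectrum x = {t. \<not> bounded_below x [:- complex_of_real t, 1:]}"

lemma ap_spectrumD:
  assumes "t \<notin> ap_spectrum x"
  obtains c where "c > 0" "\<And>b. b \<in> carrier A \<Longrightarrow> c * cnorm A b \<le> cnorm A (act x [:- complex_of_real t, 1:] b)"
  using assms unfolding ap_spectrum_def bounded_below_def by auto

text \<open>Makes the operator norm of \<open>p(x)\<close> finite, as the supremum in
  \<open>cnorm_act_le_nonconst\<close> requires.\<close>

lemma act_bounded:
  assumes "x \<in> carrier A"
  shows "\<exists>C\<ge>0. \<forall>b\<in>carrier A. cnorm A (act x p b) \<le> C * cnorm A b"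
proof (induction p)
  case 0
  then show ?case
    by auto
next
  case (pCons c p)
  then obtain C where C: "C \<ge> 0" "\<And>b. b \<in> carrier A \<Longrightarrow> cnorm A (act x p b) \<le> C * cnorm A b"
    by blast
  have "cnorm A (act x (pCons c p) b) \<le> (cmod c + cnorm A x * C) * cnorm A b" if b: "b \<in> carrier A" for b
  proof -
    have "cnorm A (act x (pCons c p) b) \<le> cmod c * cnorm A b + cnorm A (x \<otimes> act x p b)"
      using cnorm_triangle[of "c \<odot> b" "x \<otimes> act x p b"] assms b by (simp add: cnorm_scale)
    also have "\<dots> \<le> cmod c * cnorm A b + cnorm A x * (C * cnorm A b)"
      using cnorm_mult[of x "act x p b"] mult_left_mono[OF C(2)[OF b], of "cnorm A x"] assms b
      by simp
    finally show ?thesis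
      by (simp add: algebra_simps)
  qed
  moreover have "cmod c + cnorm A x * C \<ge> 0"
    using C assms by simp
  ultimately show ?case
    by blast
qed

text \<open>If \<open>P\<close> is a contraction on which the bound \<open>1\<close> is attained up to a factor \<open>\<theta>\<close>, then
  \<open>(1 - P\<^sup>2) \<Prod>\<^bsub>j<k\<^esub> (1 + P\<^bsup>2^(j+1)\<^esup>) = 1 - P\<^bsup>2^(k+1)\<^esup>\<close> has norm at most \<open>2\<close>, while the product
  grows like \<open>2\<^sup>k\<close>.\<close>

lemma not_bounded_below_one_minus_square:
  assumes x: "x \<in> carrier A" "star A x = x" and P: "cnj_poly P = P"
    and contr: "\<And>b. b \<in> carrier A \<Longrightarrow> cnorm A (act x P b) \<le> cnorm A b"
    and sharp: "\<And>\<theta>. \<theta> < 1 \<Longrightarrow> \<exists>v\<in>carrier A. cnorm A v \<le> 1 \<and> \<theta> \<le> cnorm A (act x P v)"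
  shows "\<not> bounded_below x (1 - P\<^sup>2)"
proof
  assume "bounded_below x (1 - P\<^sup>2)"
  then obtain c where c: "c > 0"
    "\<And>b. b \<in> carrier A \<Longrightarrow> c * cnorm A b \<le> cnorm A (act x (1 - P\<^sup>2) b)"
    unfolding bounded_below_def by blast
  define Q where "Q k = (\<Prod>j<k. 1 + (P ^ 2 ^ j)\<^sup>2)" for k :: nat
  have Q_prod: "(1 - P\<^sup>2) * Q k = 1 - P ^ 2 ^ Suc k" for k
  proof (induction k)
    case (Suc k)
    have "(1 - P\<^sup>2) * Q (Suc k) = (1 - P ^ 2 ^ Suc k) * (1 + (P ^ 2 ^ k)\<^sup>2)"
      unfolding Suc.IH[symmetric] by (simp only: Q_def prod.lessThan_Suc mult.assoc)
    also have "(P ^ 2 ^ k)\<^sup>2 = P ^ 2 ^ Suc k"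
      by (simp add: mult.commute flip: power_mult)
    also have "(1 - P ^ 2 ^ Suc k) * (1 + P ^ 2 ^ Suc k) = 1 - (P ^ 2 ^ Suc k)\<^sup>2"
      by (simp add: algebra_simps power2_eq_square)
    also have "(P ^ 2 ^ Suc k)\<^sup>2 = P ^ 2 ^ Suc (Suc k)"
      by (simp add: mult.commute flip: power_mult)
    finally show ?case .
  qed (simp add: Q_def)
  \<comment> \<open>Each factor \<open>1 + W\<^sup>2\<close> with \<open>W = P ^ 2 ^ j\<close>
    dominates \<open>2 W\<close> in norm, by the second bound of
    \<open>cnorm_act_one_plus_square\<close> at \<open>\<mu> = 1\<close>. The exponents
    \<open>2 ^ j\<close> for \<open>j < k\<close> add up to \<open>2 ^ k - 1\<close>.\<close>
  have Q_ge: "2 ^ k * cnorm A (act x (P ^ (2 ^ k - 1)) d) \<le> cnorm A (act x (Q k) d)"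
    if "d \<in> carrier A" for k d
    using that
  proof (induction k arbitrary: d)
    case (Suc k)
    have "P ^ (2 ^ Suc k - 1) = P ^ (2 ^ k - 1) * P ^ 2 ^ k"
      by (simp add: mult_2 flip: power_add)
    then have "2 ^ Suc k * cnorm A (act x (P ^ (2 ^ Suc k - 1)) d)
        = 2 * (2 ^ k * cnorm A (act x (P ^ (2 ^ k - 1)) (act x (P ^ 2 ^ k) d)))"
      using x Suc.prems by (simp add: act_mult)
    also have "\<dots> \<le> 2 * cnorm A (act x (Q k) (act x (P ^ 2 ^ k) d))"
      using Suc.IH[of "act x (P ^ 2 ^ k) d"] x Suc.prems by simp
    also have "\<dots> = 2 * cnorm A (act x (P ^ 2 ^ k) (act x (Q k) d))"
      using x Suc.prems by (simp add: act_commute)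
    also have "\<dots> \<le> cnorm A (act x (1 + (P ^ 2 ^ k)\<^sup>2) (act x (Q k) d))"
      using cnorm_act_one_plus_square(2)[OF x, of "act x (Q k) d" "P ^ 2 ^ k" 1] x Suc.prems P
      by (simp add: cnj_poly_power one_pCons[symmetric])
    also have "\<dots> = cnorm A (act x (Q (Suc k)) d)"
      using x Suc.prems by (simp add: Q_def mult.commute flip: act_mult)
    finally show ?case .
  qed (use x in \<open>simp add: Q_def\<close>)
  have contr_pow: "cnorm A (act x (P ^ n) b) \<le> cnorm A b" if "b \<in> carrier A" for n b
  proof (induction n)
    case (Suc n)
    then show ?case
      using contr[of "act x (P ^ n) b"] x that by (simp add: act_mult)
  qed (use x that in simp)
  \<comment> \<open>This makes the final lower bound \<open>c * 2 ^ k / 2\<close> exceed the final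
    upper bound \<open>2\<close>.\<close>
  obtain k where k: "4 / c < 2 ^ k"
    using real_arch_pow[of 2 "4 / c"] by auto
  \<comment> \<open>\<open>\<theta>\<close> is chosen after \<open>k\<close>, so close to
    \<open>1\<close> that its power \<open>2 ^ k\<close> still exceeds \<open>1 / 2\<close>.\<close>
  have "((\<lambda>\<theta>::real. \<theta> ^ 2 ^ k) \<longlongrightarrow> 1 ^ 2 ^ k) (at_left 1)"
    by (intro tendsto_intros)
  then have "\<forall>\<^sub>F \<theta>::real in at_left 1. \<theta> ^ 2 ^ k > 1 / 2"
    by (rule order_tendstoD) simp
  moreover have "\<forall>\<^sub>F \<theta>::real in at_left 1. 0 < \<theta> \<and> \<theta> < 1"
    by (auto simp: eventually_at_left_field intro!: exI[of _ 0])
  ultimately have "\<forall>\<^sub>F \<theta>::real in at_left 1. \<theta> ^ 2 ^ k > 1 / 2 \<and> 0 < \<theta> \<and> \<theta> < 1"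
    by (rule eventually_conj)
  then obtain \<theta> :: real where \<theta>: "\<theta> ^ 2 ^ k > 1 / 2" "0 < \<theta>" "\<theta> < 1"
    using eventually_happens'[of "at_left (1::real)"] by auto
  then obtain v where v: "v \<in> carrier A" "cnorm A v \<le> 1" "\<theta> \<le> cnorm A (act x P v)"
    using sharp by blast
  \<comment> \<open>Repeated squaring: for \<open>W = P ^ 2 ^ j\<close> the C*-identity gives
    \<open>||W v||\<^sup>2 = ||v\<^sup>* W\<^sup>2 v|| \<le> ||W\<^sup>2 v||\<close>, as
    \<open>v\<close> has norm at most one.\<close>
  have lower: "\<theta> ^ 2 ^ j \<le> cnorm A (act x (P ^ 2 ^ j) v)" for j
  proof (induction j)
    case (Suc j)
    have "\<theta> ^ 2 ^ Suc j = (\<theta> ^ 2 ^ j)\<^sup>2"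
      by (simp add: mult.commute flip: power_mult)
    also have "\<dots> \<le> (cnorm A (act x (P ^ 2 ^ j) v))\<^sup>2"
      using Suc \<theta> by (intro power_mono) auto
    also have "\<dots> = cnorm A (star A v \<otimes> act x (P ^ 2 ^ j * P ^ 2 ^ j) v)"
      using cstar_identity[of "act x (P ^ 2 ^ j) v"] x v P
      by (simp add: star_act act_mult cnj_poly_power)
    also have "\<dots> \<le> cnorm A v * cnorm A (act x (P ^ 2 ^ j * P ^ 2 ^ j) v)"
      using cnorm_mult[of "star A v" "act x (P ^ 2 ^ j * P ^ 2 ^ j) v"] x v by simp
    also have "\<dots> \<le> 1 * cnorm A (act x (P ^ 2 ^ j * P ^ 2 ^ j) v)"
      using v x by (intro mult_right_mono) auto
    also have "P ^ 2 ^ j * P ^ 2 ^ j = P ^ 2 ^ Suc j"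
      by (simp flip: power_add add: mult_2)
    finally show ?case
      by simp
  qed (use v in simp)
  \<comment> \<open>\<open>P\<close> is a contraction, so the lower bound passes from the exponent
    \<open>2 ^ k\<close> to the exponent \<open>2 ^ k - 1\<close> that occurs in
    \<open>Q_ge\<close>.\<close>
  have "Suc (2 ^ k - 1) = 2 ^ k"
    by simp
  then have "P ^ 2 ^ k = P * P ^ (2 ^ k - 1)"
    by (metis power_Suc)
  then have "cnorm A (act x (P ^ 2 ^ k) v) \<le> cnorm A (act x (P ^ (2 ^ k - 1)) v)"
    using contr[of "act x (P ^ (2 ^ k - 1)) v"] x v by (simp add: act_mult)
  then have "1 / 2 \<le> cnorm A (act x (P ^ (2 ^ k - 1)) v)"
    using lower[of k] \<theta> by linarith
  then have "2 ^ k * (1 / 2) \<le> 2 ^ k * cnorm A (act x (P ^ (2 ^ k - 1)) v)"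
    by (intro mult_left_mono) auto
  also have "\<dots> \<le> cnorm A (act x (Q k) v)"
    using Q_ge v by simp
  finally have "c * (2 ^ k * (1 / 2)) \<le> c * cnorm A (act x (Q k) v)"
    using c by (intro mult_left_mono) auto
  also have "\<dots> \<le> cnorm A (act x ((1 - P\<^sup>2) * Q k) v)"
    using c(2)[of "act x (Q k) v"] x v by (simp add: act_mult)
  also have "\<dots> = cnorm A (v \<ominus> act x (P ^ 2 ^ Suc k) v)"
    unfolding Q_prod using x v by (simp add: act_diff)
  also have "\<dots> \<le> cnorm A v + cnorm A (act x (P ^ 2 ^ Suc k) v)"
    using x v by (intro cnorm_minus_le) auto
  also have "\<dots> \<le> 1 + 1"
    using contr_pow[of v "2 ^ Suc k"] v by simp
  finally show False
    using k c by (simp add: field_simps)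
qed

text \<open>Let \<open>L\<close> be the operator norm of \<open>p(x)\<close>. If
  \<open>L > r\<close>, then \<open>P = p / L\<close> is a contraction of norm one, so
  \<open>1 - P\<^sup>2\<close> is not bounded below. Yet its real roots satisfy
  \<open>|p(t)| = L > r\<close> and lie off \<open>ap_spectrum x\<close>, and nonreal roots do no
  harm. A nonconstant \<open>p\<close> guarantees \<open>1 - P\<^sup>2 \<noteq> 0\<close>.\<close>

lemma cnorm_act_le_nonconst:
  assumes x: "x \<in> carrier A" "star A x = x" and r: "0 \<le> r"
    and le: "\<And>t. t \<in> ap_spectrum x \<Longrightarrow> \<bar>poly p t\<bar> \<le> r"
    and deg: "degree p \<noteq> 0" and b: "b \<in> carrier A"
  shows "cnorm A (act x (cpoly p) b) \<le> r * cnorm A b"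
proof -
  define S where "S = (\<lambda>b. cnorm A (act x (cpoly p) b)) ` {b \<in> carrier A. cnorm A b \<le> 1}"
  define L where "L = Sup S"
  obtain C where C: "C \<ge> 0" "\<And>b. b \<in> carrier A \<Longrightarrow> cnorm A (act x (cpoly p) b) \<le> C * cnorm A b"
    using act_bounded[OF x(1)] by blast
  have S: "bdd_above S" "S \<noteq> {}"
  proof -
    have "s \<le> C" if "s \<in> S" for s
      using that C mult_left_le[of _ C] unfolding S_def by (force intro: order_trans)
    then show "bdd_above S"
      by (auto simp: bdd_above_def)
    show "S \<noteq> {}"
      unfolding S_def using zero_closed cnorm_zero by fastforce
  qed
  have unit: "cnorm A (act x (cpoly p) b) \<le> L" if "b \<in> carrier A" "cnorm A b \<le> 1" for b
    unfolding L_def using that S by (intro cSup_upper) (auto simp: S_def)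
  have L: "cnorm A (act x (cpoly p) b) \<le> L * cnorm A b" if b: "b \<in> carrier A" for b
  proof (cases "cnorm A b = 0")
    case True
    then show ?thesis
      using C(2)[OF b] by simp
  next
    case False
    then have pos: "cnorm A b > 0"
      using cnorm_nonneg[OF b] by linarith
    define u where "u = complex_of_real (inverse (cnorm A b)) \<odot> b"
    have "cnorm A u \<le> 1" "u \<in> carrier A"
      using b pos by (simp_all add: u_def cnorm_scale norm_inverse)
    from unit[OF this(2,1)] show ?thesis
      using x b pos by (simp add: u_def act_linear cnorm_scale norm_divide field_simps)
  qed
  have "L \<le> r"
  proof (rule ccontr)
    assume "\<not> L \<le> r"
    then have Lr: "L > r" "L > 0"
      using r by auto
    define P where "P = smult (complex_of_real (inverse L)) (cpoly p)"
    have act_P: "cnorm A (act x P b) = inverse L * cnorm A (act x (cpoly p) b)" if "b \<in> carrier A" for b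
      using x that Lr by (simp add: P_def act_smult cnorm_scale norm_inverse)
    have "\<not> bounded_below x (1 - P\<^sup>2)"
    proof (rule not_bounded_below_one_minus_square[OF x])
      show "cnj_poly P = P"
        by (simp add: P_def cnj_poly_smult)
      show "cnorm A (act x P b) \<le> cnorm A b" if "b \<in> carrier A" for b
        using L[OF that] Lr by (simp add: act_P[OF that] field_simps)
      fix \<theta> :: real assume "\<theta> < 1"
      then have "\<theta> * L < Sup S"
        using Lr by (simp add: L_def[symmetric])
      then obtain s where "s \<in> S" "\<theta> * L < s"
        using less_cSup_iff[OF S(2,1)] by blast
      then obtain v where "v \<in> carrier A" "cnorm A v \<le> 1" "\<theta> * L < cnorm A (act x (cpoly p) v)"
        unfolding S_def by blast
      then show "\<exists>v\<in>carrier A. cnorm A v \<le> 1 \<and> \<theta> \<le> cnorm A (act x P v)"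
        using Lr by (intro bexI[of _ v]) (auto simp: act_P field_simps)
    qed
    moreover have "bounded_below x (1 - P\<^sup>2)"
    proof (rule bounded_below_if_roots[OF x(1)])
      have "degree (P\<^sup>2) \<noteq> 0"
      proof -
        have "degree (cpoly p) = degree p"
          by (rule degree_map_poly) simp
        then have "degree P \<noteq> 0"
          using deg Lr by (simp add: P_def)
        then show ?thesis
          by (cases "P = 0") (auto simp: power2_eq_square degree_mult_eq)
      qed
      then show "1 - P\<^sup>2 \<noteq> 0"
        by (metis degree_1 eq_iff_diff_eq_0)
    next
      fix z assume z: "poly (1 - P\<^sup>2) z = 0"
      show "bounded_below x [:-z, 1:]"
      proof (cases "Im z = 0")
        case False
        then show ?thesis
          using cnorm_act_nonreal[OF x] by (intro bounded_belowI[of "\<bar>Im z\<bar>"]) auto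
      next
        case True
        then obtain t where t: "z = complex_of_real t"
          by (metis complex_is_Real_iff Reals_cases)
        have "complex_of_real ((inverse L * poly p t)\<^sup>2) = 1"
          using z by (simp add: P_def t)
        then have "(inverse L * poly p t)\<^sup>2 = 1"
          using of_real_eq_1_iff by blast
        then have "\<bar>inverse L * poly p t\<bar> = 1"
          by (simp add: abs_square_eq_1)
        then have "\<bar>poly p t\<bar> = L"
          using Lr by (simp add: abs_mult field_simps)
        then have "t \<notin> ap_spectrum x"
          using le Lr by fastforce
        then show ?thesis
          by (simp add: ap_spectrum_def t)
      qed
    qed
    ultimately show False ..
  qed
  then have "L * cnorm A b \<le> r * cnorm A b"
    using b by (intro mult_right_mono) auto
  then show ?thesis
    using L[OF b] by linarith
qed

theorem cnorm_act_le:
  assumes x: "x \<in> carrier A" "star A x = x" and r: "0 \<le> r"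
    and le: "\<And>t. t \<in> ap_spectrum x \<Longrightarrow> \<bar>poly p t\<bar> \<le> r" and b: "b \<in> carrier A"
  shows "cnorm A (act x (cpoly p) b) \<le> r * cnorm A b"
proof (cases "degree p = 0")
  case False
  then show ?thesis
    using assms by (intro cnorm_act_le_nonconst) auto
next
  case True
  then obtain a where a: "p = [:a:]"
    by (rule degree_eq_zeroE)
  show ?thesis
  proof (cases "ap_spectrum x = {}")
    case False
    then have "\<bar>a\<bar> \<le> r"
      using le by (auto simp: a)
    then show ?thesis
      using x b by (simp add: a cpoly_pCons cnorm_scale mult_right_mono)
  next
    \<comment> \<open>An empty \<open>ap_spectrum x\<close> occurs only in the zero algebra: the
      nonconstant case, for the polynomial \<open>t\<close> and the bound \<open>0\<close>, gives
      \<open>x b = 0\<close>, whereas \<open>x\<close> is bounded below.\<close>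
    case True
    then obtain c where c: "c > 0" "c * cnorm A b \<le> cnorm A (act x [:- complex_of_real 0, 1:] b)"
      using b by (metis ap_spectrumD empty_iff)
    have "cnorm A (act x (cpoly [:0, 1:]) b) \<le> 0 * cnorm A b"
      by (rule cnorm_act_le_nonconst) (use x b True in auto)
    then have "c * cnorm A b \<le> 0"
      using c(2) by (simp add: cpoly_pCons)
    then have "cnorm A b = 0"
      using c(1) cnorm_nonneg[OF b] by (simp add: mult_le_0_iff)
    then have "b = \<zero>"
      using b by (simp add: cnorm_eq_zero)
    then show ?thesis
      using x by (simp add: a cpoly_pCons)
  qed
qed

lemma ap_spectrum_bound:
  assumes "x \<in> carrier A" "t \<in> ap_spectrum x"
  shows "\<bar>t\<bar> \<le> cnorm A x"
proof (rule ccontr)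
  assume "\<not> \<bar>t\<bar> \<le> cnorm A x"
  then have "bounded_below x [:- complex_of_real t, 1:]"
  proof (intro bounded_belowI)
    fix b assume b: "b \<in> carrier A"
    have "\<bar>t\<bar> * cnorm A b \<le> cnorm A (x \<otimes> b) + cnorm A (complex_of_real t \<odot> b \<ominus> x \<otimes> b)"
      using cnorm_le_diff[of "complex_of_real t \<odot> b" "x \<otimes> b"] assms b by (simp add: cnorm_scale)
    also have "cnorm A (complex_of_real t \<odot> b \<ominus> x \<otimes> b) = cnorm A (x \<otimes> b \<ominus> complex_of_real t \<odot> b)"
      using assms b by (intro cnorm_minus_commute) auto
    also have "x \<otimes> b \<ominus> complex_of_real t \<odot> b = act x [:- complex_of_real t, 1:] b"
      using assms b by (simp add: cstar_simps)
    finally show "(\<bar>t\<bar> - cnorm A x) * cnorm A b \<le> cnorm A (act x [:- complex_of_real t, 1:] b)"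
      using cnorm_mult[of x b] assms b by (simp add: algebra_simps)
  qed simp
  then show False
    using assms by (simp add: ap_spectrum_def)
qed

end


section \<open>Continuous functional calculus\<close>

lemma Weierstrass_real_poly:
  fixes f :: "real \<Rightarrow> real"
  assumes "continuous_on {-M..M} f" "f 0 = 0" "0 \<le> M"
  obtains p where "\<And>k. coeff (p k) 0 = 0" "uniform_limit {-M..M} (\<lambda>k. poly (p k)) f sequentially"
proof -
  have "\<exists>p. coeff p 0 = 0 \<and> (\<forall>t\<in>{-M..M}. \<bar>f t - poly p t\<bar> < inverse (Suc k))" for k :: nat
  proof -
    \<comment> \<open>The tolerance is halved because the constant term is removed afterwards; as
      \<open>f 0 = 0\<close>, that term is at most the other half.\<close>
    obtain g where g: "real_polynomial_function g" "\<And>t. t \<in> {-M..M} \<Longrightarrow> \<bar>f t - g t\<bar> < inverse (Suc k) / 2"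
      using Stone_Weierstrass_real_polynomial_function[of "{-M..M}" f "inverse (Suc k) / 2"] assms
      by auto
    obtain a n where a: "g = (\<lambda>t. \<Sum>i\<le>n. a i * t ^ i)"
      using g(1) unfolding real_polynomial_function_iff_sum by blast
    define q where "q = (\<Sum>i\<le>n. monom (a i) i)"
    have q: "poly q t = g t" for t
      by (simp add: q_def a poly_sum poly_monom)
    have g0: "\<bar>g 0\<bar> < inverse (Suc k) / 2"
      using g(2)[of 0] assms by simp
    have r: "poly (q - [:coeff q 0:]) t = g t - g 0" for t
      using q[of t] q[of 0] by (simp add: poly_0_coeff_0)
    have "\<bar>f t - poly (q - [:coeff q 0:]) t\<bar> < inverse (Suc k)" if "t \<in> {-M..M}" for t
      using g(2)[OF that] g0 unfolding r by linarith
    then show ?thesis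
      by (intro exI[of _ "q - [:coeff q 0:]"]) simp
  qed
  then obtain p where p: "\<And>k. coeff (p k) 0 = 0"
    "\<And>k t. t \<in> {-M..M} \<Longrightarrow> \<bar>f t - poly (p k) t\<bar> < inverse (Suc k)"
    by metis
  have "uniform_limit {-M..M} (\<lambda>k. poly (p k)) f sequentially"
  proof (rule uniform_limitI)
    fix e :: real assume "e > 0"
    then have "\<forall>\<^sub>F k in sequentially. inverse (Suc k) < e"
      using LIMSEQ_inverse_real_of_nat by (rule order_tendstoD(2)[rotated])
    then show "\<forall>\<^sub>F k in sequentially. \<forall>t\<in>{-M..M}. dist (poly (p k) t) (f t) < e"
    proof (rule eventually_mono)
      fix k assume k: "inverse (Suc k) < e"
      show "\<forall>t\<in>{-M..M}. dist (poly (p k) t) (f t) < e"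
      proof
        fix t assume "t \<in> {-M..M}"
        from p(2)[OF this, of k] k show "dist (poly (p k) t) (f t) < e"
          unfolding dist_real_def by linarith
      qed
    qed
  qed
  with p(1) show ?thesis
    by (rule that)
qed

lemma poly_fun_simps:
  fixes p q :: "real poly"
  shows "poly (p - q) = (\<lambda>t. poly p t - poly q t)" "poly (p * q) = (\<lambda>t. poly p t * poly q t)"
  "poly (smult c p) = (\<lambda>t. c * poly p t)"
  by (simp_all add: fun_eq_iff)

context pre_cstar_algebra
begin

section \<open>Evaluation of polynomials without constant term\<close>

lemma cstar_power_Suc_closed [simp]: "x \<in> carrier A \<Longrightarrow> cstar_power_Suc A x n \<in> carrier A"
  by (induction n) simp_all

lemma cstar_power_Suc_left: "x \<in> carrier A \<Longrightarrow> cstar_power_Suc A x (Suc n) = x \<otimes> cstar_power_Suc A x n"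
  by (induction n) (simp_all add: mult_assoc)

lemma finsum_lessThan_Suc:
  assumes "\<And>i. f i \<in> carrier A"
  shows "(\<Oplus>i\<in>{..<Suc n}. f i) = (\<Oplus>i\<in>{..<n}. f i) \<oplus> f n"
  using assms by (simp add: lessThan_Suc a_comm)

text \<open>Coefficients beyond the degree vanish, so the upper limit is free. The recursion for
  \<open>pCons\<close> needs this freedom, since \<open>pCons a p\<close> has the degree of
  \<open>p\<close> when \<open>p = 0\<close>.\<close>

lemma cstar_poly_eq_finsum:
  assumes x: "x \<in> carrier A" and "degree p \<le> n"
  shows "cstar_poly A p x = (\<Oplus>i\<in>{..<n}. complex_of_real (coeff p (Suc i)) \<odot> cstar_power_Suc A x i)"
  using assms(2)
proof (induction n rule: dec_induct)
  case (step n)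
  then show ?case
    using x by (subst finsum_lessThan_Suc) (simp_all add: coeff_eq_0)
qed (simp add: cstar_poly_def)

lemma cstar_poly_closed [simp]: "x \<in> carrier A \<Longrightarrow> cstar_poly A p x \<in> carrier A"
  unfolding cstar_poly_def by (intro finsum_closed) auto

text \<open>Horner's rule. \<open>cstar_poly\<close> drops the constant term \<open>a\<close>, while
  the former constant term \<open>coeff p 0\<close> becomes the coefficient of
  \<open>x\<close>.\<close>

lemma cstar_poly_pCons:
  assumes x: "x \<in> carrier A"
  shows "cstar_poly A (pCons a p) x = complex_of_real (coeff p 0) \<odot> x \<oplus> x \<otimes> cstar_poly A p x"
proof -
  let ?f = "\<lambda>i. complex_of_real (coeff p i) \<odot> cstar_power_Suc A x i"
  have "(\<Oplus>i\<in>{..<Suc n}. ?f i)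
      = ?f 0 \<oplus> x \<otimes> (\<Oplus>i\<in>{..<n}. complex_of_real (coeff p (Suc i)) \<odot> cstar_power_Suc A x i)" for n
  proof (induction n)
    case 0
    then show ?case
      using x by (simp add: lessThan_Suc)
  next
    case (Suc n)
    let ?g = "\<lambda>i. complex_of_real (coeff p (Suc i)) \<odot> cstar_power_Suc A x i"
    have "finsum A ?g {..<n} \<in> carrier A"
      using x by (intro finsum_closed) auto
    moreover have "?f (Suc n) = x \<otimes> ?g n"
      using x by (simp add: cstar_power_Suc_left scale_mult_right del: cstar_power_Suc.simps)
    ultimately show ?case
      using x Suc finsum_lessThan_Suc[of ?f "Suc n"] finsum_lessThan_Suc[of ?g n]
      by (simp add: distrib_left a_assoc del: cstar_power_Suc.simps)
  qed
  from this[of "degree p"] show ?thesis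
    using x cstar_poly_eq_finsum[of x "pCons a p" "Suc (degree p)"] cstar_poly_eq_finsum[of x p "degree p"]
    by (simp add: degree_pCons_le)
qed

text \<open>\<open>cstar_poly\<close> ignores the constant term and \<open>act\<close> keeps it;
  across this bridge the norm bounds and the product rule of \<open>act\<close> reach genuine
  elements.\<close>

lemma act_cpoly:
  assumes "x \<in> carrier A" "b \<in> carrier A"
  shows "act x (cpoly p) b = complex_of_real (coeff p 0) \<odot> b \<oplus> cstar_poly A p x \<otimes> b"
proof (induction p)
  case (pCons c p)
  then show ?case
    using assms by (simp add: cpoly_pCons cstar_poly_pCons distrib_left distrib_right scale_mult_left
        scale_mult_right mult_assoc)
qed (use assms in \<open>simp add: cstar_poly_def\<close>)

lemma eq_if_cnorm_diff_le:
  assumes "x \<in> carrier A" "y \<in> carrier A" "cnorm A (x \<ominus> y) \<le> 0"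
  shows "x = y"
proof -
  have "cnorm A (x \<ominus> y) = 0"
    using assms by (intro antisym) auto
  then show ?thesis
    using assms by (simp add: cnorm_eq_zero)
qed

lemma eq_if_mult_eq_left:
  assumes "x \<in> carrier A" "y \<in> carrier A" "\<And>b. b \<in> carrier A \<Longrightarrow> b \<otimes> x = b \<otimes> y"
  shows "x = y"
proof -
  have "star A x = star A y"
  proof (rule eq_if_mult_eq)
    fix b assume "b \<in> carrier A"
    then show "star A x \<otimes> b = star A y \<otimes> b"
      using assms(1,2) assms(3)[of "star A b"] star_mult[of "star A b" x] star_mult[of "star A b" y]
      by simp
  qed (use assms in auto)
  then show ?thesis
    using assms star_star by metis
qed

lemma cstar_poly_mult_eq:
  assumes "x \<in> carrier A" "b \<in> carrier A" "coeff p 0 = 0"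
  shows "cstar_poly A p x \<otimes> b = act x (cpoly p) b"
  using assms by (simp add: act_cpoly)

lemma cstar_poly_mult:
  assumes "x \<in> carrier A" "coeff p 0 = 0" "coeff q 0 = 0"
  shows "cstar_poly A (p * q) x = cstar_poly A p x \<otimes> cstar_poly A q x"
proof (rule eq_if_mult_eq)
  fix b assume "b \<in> carrier A"
  then show "cstar_poly A (p * q) x \<otimes> b = cstar_poly A p x \<otimes> cstar_poly A q x \<otimes> b"
    using assms cstar_poly_mult_eq[of x "act x (cpoly q) b" p]
    by (simp add: cstar_poly_mult_eq[of x b] mult_assoc cpoly_mult act_mult coeff_mult)
qed (use assms in auto)

lemma cstar_poly_diff:
  assumes "x \<in> carrier A" "coeff p 0 = 0" "coeff q 0 = 0"
  shows "cstar_poly A (p - q) x = cstar_poly A p x \<ominus> cstar_poly A q x"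
  by (rule eq_if_mult_eq)
    (use assms in \<open>simp_all add: cstar_poly_mult_eq minus_distribs cpoly_diff act_diff\<close>)

lemma cstar_poly_smult:
  assumes "x \<in> carrier A" "coeff p 0 = 0"
  shows "cstar_poly A (smult c p) x = complex_of_real c \<odot> cstar_poly A p x"
proof (rule eq_if_mult_eq)
  fix b assume "b \<in> carrier A"
  moreover have "cpoly (smult c p) = smult (complex_of_real c) (cpoly p)"
    by (intro poly_eqI) (simp add: coeff_map_poly)
  ultimately show "cstar_poly A (smult c p) x \<otimes> b = (complex_of_real c \<odot> cstar_poly A p x) \<otimes> b"
    using assms by (simp add: cstar_poly_mult_eq scale_mult_left act_smult)
qed (use assms in auto)

text \<open>\<open>star_act\<close> only speaks of products with an element on either side, so the
  equality is tested from the right by \<open>b\<close> and from the left by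
  \<open>d\<close>.\<close>

lemma star_cstar_poly:
  assumes x: "x \<in> carrier A" "star A x = x" and "coeff p 0 = 0"
  shows "star A (cstar_poly A p x) = cstar_poly A p x"
proof (rule eq_if_mult_eq)
  fix b assume b: "b \<in> carrier A"
  show "star A (cstar_poly A p x) \<otimes> b = cstar_poly A p x \<otimes> b"
  proof (rule eq_if_mult_eq_left)
    fix d assume d: "d \<in> carrier A"
    show "d \<otimes> (star A (cstar_poly A p x) \<otimes> b) = d \<otimes> (cstar_poly A p x \<otimes> b)"
      using star_act[OF x _ b, of "star A d" "cpoly p"] assms b d
      by (simp add: star_mult mult_assoc flip: cstar_poly_mult_eq)
  qed (use x b in auto)
qed (use x in auto)

text \<open>For \<open>y = p(x)\<close>, apply the bound for \<open>act\<close> to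
  \<open>y\<^sup>*\<close>: this gives
  \<open>||y||\<^sup>2 = ||p(x) y\<^sup>*|| \<le> r ||y||\<close>.\<close>

lemma cnorm_cstar_poly_le:
  assumes x: "x \<in> carrier A" "star A x = x" and p: "coeff p 0 = 0" and r: "0 \<le> r"
    and le: "\<And>t. t \<in> ap_spectrum x \<Longrightarrow> \<bar>poly p t\<bar> \<le> r"
  shows "cnorm A (cstar_poly A p x) \<le> r"
proof -
  let ?y = "cstar_poly A p x"
  have "cnorm A ?y * cnorm A ?y = cnorm A (act x (cpoly p) (star A ?y))"
    using cstar_identity'[of ?y] x p by (simp add: power2_eq_square cstar_poly_mult_eq)
  also have "\<dots> \<le> r * cnorm A ?y"
    using cnorm_act_le[OF x r le, of "star A ?y"] x by simp
  finally show ?thesis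
    using x r cnorm_nonneg[of ?y] by (cases "cnorm A ?y > 0") auto
qed

text \<open>Uniform convergence is demanded on the interval of radius \<open>cnorm A x\<close>, not
  on the spectrum: a contractive homomorphism shrinks this interval, so the same polynomials serve
  for the image.\<close>

definition has_fun_calc :: "'a \<Rightarrow> (real \<Rightarrow> real) \<Rightarrow> 'a \<Rightarrow> bool" where
  "has_fun_calc x f y \<longleftrightarrow> x \<in> carrier A \<and> star A x = x \<and>
     (\<exists>p. (\<forall>k. coeff (p k) 0 = 0) \<and>
        uniform_limit {- cnorm A x..cnorm A x} (\<lambda>k. poly (p k)) f sequentially \<and>
        tends (\<lambda>k. cstar_poly A (p k) x) y)"

lemma has_fun_calcE:
  assumes "has_fun_calc x f y"
  obtains p where "x \<in> carrier A" "star A x = x" "\<And>k. coeff (p k) 0 = 0"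
    "uniform_limit {- cnorm A x..cnorm A x} (\<lambda>k. poly (p k)) f sequentially"
    "tends (\<lambda>k. cstar_poly A (p k) x) y"
  using assms unfolding has_fun_calc_def by blast

lemma has_fun_calc_closed:
  assumes "has_fun_calc x f y"
  shows "y \<in> carrier A" "x \<in> carrier A"
  using assms unfolding has_fun_calc_def by (auto dest: tends_closed)

text \<open>\<open>S\<close> is kept general: it is the norm interval for
  \<open>has_fun_calc\<close> and the spectrum in the comparison with
  \<open>cstar_fun_calc\<close>.\<close>

lemma cnorm_cstar_poly_limit_le:
  assumes x: "x \<in> carrier A" "star A x = x" and p: "\<And>k. coeff (p k) 0 = 0"
    and lim: "uniform_limit S (\<lambda>k. poly (p k)) f sequentially" and S: "ap_spectrum x \<subseteq> S"
    and y: "tends (\<lambda>k. cstar_poly A (p k) x) y"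
    and le: "\<And>t. t \<in> ap_spectrum x \<Longrightarrow> \<bar>f t\<bar> \<le> r" "0 \<le> r"
  shows "cnorm A y \<le> r"
proof (rule field_le_epsilon)
  fix e :: real assume e: "e > 0"
  have "\<forall>\<^sub>F k in sequentially. \<forall>t\<in>S. dist (poly (p k) t) (f t) < e"
    using lim e by (rule uniform_limitD)
  then have "\<forall>\<^sub>F k in sequentially. cnorm A (cstar_poly A (p k) x) \<le> r + e"
  proof eventually_elim
    case (elim k)
    show ?case
    proof (rule cnorm_cstar_poly_le[OF x p])
      fix t assume "t \<in> ap_spectrum x"
      then show "\<bar>poly (p k) t\<bar> \<le> r + e"
        using elim S le(1)[of t] by (force simp: dist_real_def)
    qed (use le e in simp)
  qed
  then show "cnorm A y \<le> r + e"
    using tends_cnorm[OF y] by (intro tendsto_upperbound[of _ _ sequentially]) auto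
qed

lemma has_fun_calc_cnorm_le:
  assumes "has_fun_calc x f y" "\<And>t. t \<in> ap_spectrum x \<Longrightarrow> \<bar>f t\<bar> \<le> r" "0 \<le> r"
  shows "cnorm A y \<le> r"
proof -
  from assms(1) obtain p where p: "x \<in> carrier A" "star A x = x" "\<And>k. coeff (p k) 0 = 0"
    "uniform_limit {- cnorm A x..cnorm A x} (\<lambda>k. poly (p k)) f sequentially"
    "tends (\<lambda>k. cstar_poly A (p k) x) y"
    by (rule has_fun_calcE) blast
  have "ap_spectrum x \<subseteq> {- cnorm A x..cnorm A x}"
    using ap_spectrum_bound[OF p(1)] by (fastforce simp: abs_le_iff)
  from cnorm_cstar_poly_limit_le[OF p(1-4) this p(5) assms(2,3)] show ?thesis .
qed

lemma has_fun_calc_star: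
  assumes "has_fun_calc x f y"
  shows "star A y = y"
proof -
  from assms obtain p where p: "x \<in> carrier A" "star A x = x" "\<And>k. coeff (p k) 0 = 0"
    "tends (\<lambda>k. cstar_poly A (p k) x) y"
    by (rule has_fun_calcE) blast
  have "tends (\<lambda>k. cstar_poly A (p k) x) (star A y)"
    using tends_star[OF p(4)] p by (simp add: star_cstar_poly)
  then show ?thesis
    using p(4) by (rule tends_unique)
qed

lemma has_fun_calc_diff:
  assumes "has_fun_calc x f y" "has_fun_calc x g z"
  shows "has_fun_calc x (\<lambda>t. f t - g t) (y \<ominus> z)"
proof -
  from assms(1) obtain p where p: "x \<in> carrier A" "star A x = x" "\<And>k. coeff (p k) 0 = 0"
    "uniform_limit {- cnorm A x..cnorm A x} (\<lambda>k. poly (p k)) f sequentially"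
    "tends (\<lambda>k. cstar_poly A (p k) x) y"
    by (rule has_fun_calcE) blast
  from assms(2) obtain q where q: "\<And>k. coeff (q k) 0 = 0"
    "uniform_limit {- cnorm A x..cnorm A x} (\<lambda>k. poly (q k)) g sequentially"
    "tends (\<lambda>k. cstar_poly A (q k) x) z"
    by (rule has_fun_calcE) blast
  show ?thesis
    unfolding has_fun_calc_def
  proof (intro conjI exI[of _ "\<lambda>k. p k - q k"])
    show "uniform_limit {- cnorm A x..cnorm A x} (\<lambda>k. poly (p k - q k)) (\<lambda>t. f t - g t) sequentially"
      using uniform_limit_minus[OF p(4) q(2)] by (simp add: poly_fun_simps)
    show "tends (\<lambda>k. cstar_poly A (p k - q k) x) (y \<ominus> z)"
      using tends_minus[OF p(5) q(3)] p q by (simp add: cstar_poly_diff)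
  qed (use p q in simp_all)
qed

lemma has_fun_calc_scale:
  assumes "has_fun_calc x f y"
  shows "has_fun_calc x (\<lambda>t. c * f t) (complex_of_real c \<odot> y)"
proof -
  from assms(1) obtain p where p: "x \<in> carrier A" "star A x = x" "\<And>k. coeff (p k) 0 = 0"
    "uniform_limit {- cnorm A x..cnorm A x} (\<lambda>k. poly (p k)) f sequentially"
    "tends (\<lambda>k. cstar_poly A (p k) x) y"
    by (rule has_fun_calcE) blast
  show ?thesis
    unfolding has_fun_calc_def
  proof (intro conjI exI[of _ "\<lambda>k. smult c (p k)"])
    show "uniform_limit {- cnorm A x..cnorm A x} (\<lambda>k. poly (smult c (p k))) (\<lambda>t. c * f t) sequentially"
      using bounded_linear.uniform_limit[OF bounded_linear_mult_right p(4), of c]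
      by (simp add: poly_fun_simps)
    show "tends (\<lambda>k. cstar_poly A (smult c (p k)) x) (complex_of_real c \<odot> y)"
      using tends_scale[OF p(5), of "complex_of_real c"] p by (simp add: cstar_poly_smult)
  qed (use p in simp_all)
qed

lemma has_fun_calc_add:
  assumes "has_fun_calc x f y" "has_fun_calc x g z"
  shows "has_fun_calc x (\<lambda>t. f t + g t) (y \<oplus> z)"
proof -
  have "has_fun_calc x (\<lambda>t. f t - (- 1) * g t) (y \<ominus> complex_of_real (- 1) \<odot> z)"
    by (intro has_fun_calc_diff has_fun_calc_scale assms)
  then show ?thesis
    using assms[THEN has_fun_calc_closed(1)] by (simp add: minus_eq_scale scale_scale)
qed

text \<open>As a uniform limit of polynomials, \<open>f\<close> is continuous on a compact interval.
  Boundedness is what uniform convergence of products asks for.\<close>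

lemma has_fun_calc_bounded:
  assumes "has_fun_calc x f y"
  shows "bounded (f ` {- cnorm A x..cnorm A x})"
proof -
  from assms(1) obtain p where p: "x \<in> carrier A" "star A x = x" "\<And>k. coeff (p k) 0 = 0"
    "uniform_limit {- cnorm A x..cnorm A x} (\<lambda>k. poly (p k)) f sequentially"
    by (rule has_fun_calcE) blast
  have "continuous_on {- cnorm A x..cnorm A x} f"
    by (rule uniform_limit_theorem[OF _ p(4)]) (auto intro!: always_eventually continuous_intros)
  then show ?thesis
    by (intro compact_imp_bounded compact_continuous_image) auto
qed

lemma has_fun_calc_mult:
  assumes "has_fun_calc x f y" "has_fun_calc x g z"
  shows "has_fun_calc x (\<lambda>t. f t * g t) (y \<otimes> z)"
proof -
  from assms(1) obtain p where p: "x \<in> carrier A" "star A x = x" "\<And>k. coeff (p k) 0 = 0"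
    "uniform_limit {- cnorm A x..cnorm A x} (\<lambda>k. poly (p k)) f sequentially"
    "tends (\<lambda>k. cstar_poly A (p k) x) y"
    by (rule has_fun_calcE) blast
  from assms(2) obtain q where q: "\<And>k. coeff (q k) 0 = 0"
    "uniform_limit {- cnorm A x..cnorm A x} (\<lambda>k. poly (q k)) g sequentially"
    "tends (\<lambda>k. cstar_poly A (q k) x) z"
    by (rule has_fun_calcE) blast
  show ?thesis
    unfolding has_fun_calc_def
  proof (intro conjI exI[of _ "\<lambda>k. p k * q k"])
    show "uniform_limit {- cnorm A x..cnorm A x} (\<lambda>k. poly (p k * q k)) (\<lambda>t. f t * g t) sequentially"
      using uniform_lim_mult[OF p(4) q(2) assms[THEN has_fun_calc_bounded]] by (simp add: poly_fun_simps)
    show "tends (\<lambda>k. cstar_poly A (p k * q k) x) (y \<otimes> z)"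
      using tends_mult[OF p(5) q(3)] p q by (simp add: cstar_poly_mult)
  qed (use p q in \<open>simp_all add: coeff_mult\<close>)
qed

text \<open>Reduces identities between functions of \<open>x\<close> to pointwise ones on
  \<open>ap_spectrum x\<close>: the difference is a calculus value of norm at most
  \<open>0\<close>.\<close>

lemma has_fun_calc_unique_on:
  assumes "has_fun_calc x f y" "has_fun_calc x g z" "\<And>t. t \<in> ap_spectrum x \<Longrightarrow> f t = g t"
  shows "y = z"
proof -
  have "cnorm A (y \<ominus> z) \<le> 0"
    by (rule has_fun_calc_cnorm_le[OF has_fun_calc_diff[OF assms(1,2)]]) (use assms(3) in auto)
  then show ?thesis
    using has_fun_calc_closed(1)[OF assms(1)] has_fun_calc_closed(1)[OF assms(2)]
    by (simp add: eq_if_cnorm_diff_le)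
qed

lemma has_fun_calc_id:
  assumes "x \<in> carrier A" "star A x = x"
  shows "has_fun_calc x (\<lambda>t. t) x"
proof -
  have "cstar_poly A [:0, 1:] x = x"
    by (rule eq_if_mult_eq) (use assms in \<open>simp_all add: cstar_poly_mult_eq cpoly_pCons\<close>)
  moreover have "poly [:0, 1:] = (\<lambda>t::real. t)"
    by (simp add: fun_eq_iff)
  ultimately show ?thesis
    unfolding has_fun_calc_def using assms
    by (intro conjI exI[of _ "\<lambda>k. [:0, 1:]"]) (simp_all add: tends_const uniform_limit_const)
qed

lemma has_fun_calc_commute:
  assumes "has_fun_calc x f y" "has_fun_calc x g z"
  shows "y \<otimes> z = z \<otimes> y"
  by (rule has_fun_calc_unique_on[OF has_fun_calc_mult[OF assms] has_fun_calc_mult[OF assms(2,1)]])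
    (simp add: mult.commute)

end

section \<open>Existence of the calculus and its agreement with the spectral definition\<close>

context cstar_algebra
begin

lemma has_fun_calc_exists:
  assumes x: "x \<in> carrier A" "star A x = x"
    and f: "continuous_on {- cnorm A x..cnorm A x} f" "f 0 = 0"
  obtains y where "has_fun_calc x f y"
proof -
  obtain p where p: "\<And>k. coeff (p k) 0 = 0"
    "uniform_limit {- cnorm A x..cnorm A x} (\<lambda>k. poly (p k)) f sequentially"
    using Weierstrass_real_poly[OF f] x by auto
  have "\<exists>y. tends (\<lambda>k. cstar_poly A (p k) x) y"
  proof (rule tends_Cauchy)
    fix e :: real assume "e > 0"
    then have "\<forall>\<^sub>F k in sequentially. \<forall>t\<in>{- cnorm A x..cnorm A x}. dist (poly (p k) t) (f t) < e / 4"
      using uniform_limitD[OF p(2), of "e / 4"] by simp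
    then obtain N where "\<forall>k\<ge>N. \<forall>t\<in>{- cnorm A x..cnorm A x}. dist (poly (p k) t) (f t) < e / 4"
      unfolding eventually_sequentially by blast
    then have N: "dist (poly (p k) t) (f t) < e / 4" if "k \<ge> N" "\<bar>t\<bar> \<le> cnorm A x" for k t
      using that by (auto simp: abs_le_iff)
    have "cnorm A (cstar_poly A (p m) x \<ominus> cstar_poly A (p n) x) \<le> e / 2" if "m \<ge> N" "n \<ge> N" for m n
    proof -
      have "cnorm A (cstar_poly A (p m - p n) x) \<le> e / 2"
      proof (rule cnorm_cstar_poly_le[OF x])
        fix t assume "t \<in> ap_spectrum x"
        then have t: "\<bar>t\<bar> \<le> cnorm A x"
          using ap_spectrum_bound x by simp
        show "\<bar>poly (p m - p n) t\<bar> \<le> e / 2"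
          using N[OF that(1) t] N[OF that(2) t] unfolding dist_real_def poly_diff by linarith
      qed (use p \<open>e > 0\<close> in simp_all)
      then show ?thesis
        using p x by (simp add: cstar_poly_diff)
    qed
    then show "\<exists>N. \<forall>m\<ge>N. \<forall>n\<ge>N. cnorm A (cstar_poly A (p m) x \<ominus> cstar_poly A (p n) x) < e"
      using \<open>e > 0\<close> by (intro exI[of _ N]) fastforce
  qed (use x in simp)
  then show ?thesis
    using that x p unfolding has_fun_calc_def by blast
qed

text \<open>Off the spectrum, a quasi-inverse \<open>y\<close> of \<open>X = x / t\<close> gives
  formally \<open>(1 - y) (1 - X) = 1\<close>. Hence \<open>b = u - y u\<close> for
  \<open>u = b - X b\<close>, so \<open>||b|| \<le> (1 + ||y||) ||u||\<close>.\<close>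

lemma ap_spectrum_subset:
  assumes x: "x \<in> carrier A" and t: "t \<in> ap_spectrum x"
  shows "complex_of_real t \<in> cstar_spectrum A x"
proof (rule ccontr)
  assume "complex_of_real t \<notin> cstar_spectrum A x"
  then obtain y where t0: "t \<noteq> 0" and y: "y \<in> carrier A"
    and eq: "(inverse (complex_of_real t) \<odot> x \<oplus> y) \<ominus> y \<otimes> (inverse (complex_of_real t) \<odot> x) = \<zero>"
    unfolding cstar_spectrum_def by auto
  define X where "X = inverse (complex_of_real t) \<odot> x"
  have X: "X \<in> carrier A"
    using x by (simp add: X_def)
  have "bounded_below x [:- complex_of_real t, 1:]"
  proof (rule bounded_belowI[of "\<bar>t\<bar> / (1 + cnorm A y)"])
    show "\<bar>t\<bar> / (1 + cnorm A y) > 0"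
      using t0 cnorm_nonneg[OF y] by simp
    fix b assume b: "b \<in> carrier A"
    define u where "u = b \<ominus> X \<otimes> b"
    have u: "u \<in> carrier A"
      using X b by (simp add: u_def)
    have "u \<ominus> y \<otimes> u = b \<ominus> ((X \<oplus> y) \<ominus> y \<otimes> X) \<otimes> b"
      using X y b by (simp add: u_def cstar_simps)
    also have "\<dots> = b"
      using eq b by (simp add: X_def[symmetric] minus_eq_scale)
    finally have "cnorm A b \<le> cnorm A u + cnorm A (y \<otimes> u)"
      using cnorm_minus_le[of u "y \<otimes> u"] u y by simp
    then have *: "cnorm A b \<le> (1 + cnorm A y) * cnorm A u"
      using cnorm_mult[OF y u] by (simp add: algebra_simps)
    have "act x [:- complex_of_real t, 1:] b = complex_of_real (- t) \<odot> u"
      using x b t0 by (simp add: u_def X_def cstar_simps)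
    then have "cnorm A (act x [:- complex_of_real t, 1:] b) = \<bar>t\<bar> * cnorm A u"
      using u by (simp only: cnorm_scale norm_of_real abs_minus_cancel)
    moreover have "\<bar>t\<bar> * cnorm A b \<le> \<bar>t\<bar> * ((1 + cnorm A y) * cnorm A u)"
      using * by (rule mult_left_mono) simp
    ultimately show "\<bar>t\<bar> / (1 + cnorm A y) * cnorm A b \<le> cnorm A (act x [:- complex_of_real t, 1:] b)"
      using cnorm_nonneg[OF y] by (simp add: field_simps)
  qed
  then show False
    using t by (simp add: ap_spectrum_def)
qed

text \<open>The Neumann series is replaced by the functional calculus for \<open>s \<mapsto> 1 - 1 / (1 - s / t)\<close>.\<close>

lemma cstar_spectrum_bound:
  assumes x: "x \<in> carrier A" "star A x = x" and t: "complex_of_real t \<in> cstar_spectrum A x"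
  shows "\<bar>t\<bar> \<le> cnorm A x"
proof (rule ccontr)
  assume less: "\<not> \<bar>t\<bar> \<le> cnorm A x"
  then have t0: "t \<noteq> 0"
    using x by auto
  have ne: "s \<noteq> t" if "s \<in> {- cnorm A x..cnorm A x}" for s
    using that less by auto
  have "1 - s / t \<noteq> 0" if "s \<in> {- cnorm A x..cnorm A x}" for s
    using ne[OF that] t0 by (simp add: field_simps)
  then have "continuous_on {- cnorm A x..cnorm A x} (\<lambda>s. - (s / t) / (1 - s / t))"
    using t0 by (intro continuous_intros) auto
  then obtain y where y: "has_fun_calc x (\<lambda>s. - (s / t) / (1 - s / t)) y"
    using has_fun_calc_exists[OF x, of "\<lambda>s. - (s / t) / (1 - s / t)"] by fastforce
  define X where "X = inverse (complex_of_real t) \<odot> x"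
  have X: "has_fun_calc x (\<lambda>s. inverse t * s) X"
    unfolding X_def of_real_inverse[symmetric] by (intro has_fun_calc_scale has_fun_calc_id x)
  have "has_fun_calc x (\<lambda>s. (inverse t * s + - (s / t) / (1 - s / t)) - (inverse t * s) * (- (s / t) / (1 - s / t)))
     ((X \<oplus> y) \<ominus> X \<otimes> y)"
    by (intro has_fun_calc_diff has_fun_calc_add has_fun_calc_mult X y)
  then have "cnorm A ((X \<oplus> y) \<ominus> X \<otimes> y) \<le> 0"
  proof (rule has_fun_calc_cnorm_le)
    fix s assume "s \<in> ap_spectrum x"
    then have "s \<noteq> t"
      using ap_spectrum_bound[OF x(1), of s] less by auto
    then have "1 - s / t \<noteq> 0"
      using t0 by (simp add: field_simps)
    then show "\<bar>(inverse t * s + - (s / t) / (1 - s / t)) - (inverse t * s) * (- (s / t) / (1 - s / t))\<bar> \<le> 0"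
      using t0 \<open>s \<noteq> t\<close> by (simp add: divide_simps) (simp add: algebra_simps)
  qed simp
  moreover have closed: "X \<in> carrier A" "y \<in> carrier A"
    using has_fun_calc_closed(1)[OF X] has_fun_calc_closed(1)[OF y] by simp_all
  ultimately have "cnorm A ((X \<oplus> y) \<ominus> X \<otimes> y) = 0"
    by (intro antisym) simp_all
  then have "(X \<oplus> y) \<ominus> X \<otimes> y = \<zero>"
    using closed by (simp only: cnorm_eq_zero a_closed mult_closed minus_closed)
  moreover from this have "(X \<oplus> y) \<ominus> y \<otimes> X = \<zero>"
    by (simp only: has_fun_calc_commute[OF X y])
  ultimately have "\<exists>y\<in>carrier A. (X \<oplus> y) \<ominus> X \<otimes> y = \<zero> \<and> (X \<oplus> y) \<ominus> y \<otimes> X = \<zero>"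
    using closed(2) by blast
  then have "complex_of_real t \<notin> cstar_spectrum A x"
    using t0 unfolding cstar_spectrum_def X_def by simp
  then show False
    using t by simp
qed

text \<open>Both spectral inclusions meet here. By \<open>cstar_spectrum_bound\<close>, convergence
  on the norm interval implies convergence on the spectrum, so \<open>y\<close> qualifies; by
  \<open>ap_spectrum_subset\<close>, convergence on the spectrum controls norms, so nothing else
  does.\<close>

lemma cstar_fun_calc_eq:
  assumes "has_fun_calc x f y"
  shows "cstar_fun_calc A f x = y"
proof -
  from assms obtain p where p: "x \<in> carrier A" "star A x = x" "\<And>k. coeff (p k) 0 = 0"
    "uniform_limit {- cnorm A x..cnorm A x} (\<lambda>k. poly (p k)) f sequentially"
    "tends (\<lambda>k. cstar_poly A (p k) x) y"
    by (rule has_fun_calcE) blast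
  define S where "S = {t. complex_of_real t \<in> cstar_spectrum A x}"
  have "S \<subseteq> {- cnorm A x..cnorm A x}"
    using cstar_spectrum_bound[OF p(1,2)] by (fastforce simp: S_def abs_le_iff)
  then have pS: "uniform_limit S (\<lambda>k. poly (p k)) f sequentially"
    using p(4) by (rule uniform_limit_on_subset[rotated])
  have S: "ap_spectrum x \<subseteq> S"
    using ap_spectrum_subset p by (auto simp: S_def)
  show ?thesis
    unfolding cstar_fun_calc_def S_def[symmetric]
  proof (rule the_equality)
    show "y \<in> carrier A \<and> (\<exists>p. (\<forall>k. coeff (p k) 0 = 0) \<and> uniform_limit S (\<lambda>k. poly (p k)) f sequentially \<and>
       (\<lambda>k. cnorm A (cstar_poly A (p k) x \<ominus> y)) \<longlonglongrightarrow> 0)"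
      using p pS unfolding tends_def by blast
    fix z assume "z \<in> carrier A \<and> (\<exists>p. (\<forall>k. coeff (p k) 0 = 0) \<and> uniform_limit S (\<lambda>k. poly (p k)) f sequentially \<and>
       (\<lambda>k. cnorm A (cstar_poly A (p k) x \<ominus> z)) \<longlonglongrightarrow> 0)"
    then obtain q where q: "\<And>k. coeff (q k) 0 = 0" "uniform_limit S (\<lambda>k. poly (q k)) f sequentially"
      "tends (\<lambda>k. cstar_poly A (q k) x) z"
      using p(1) unfolding tends_def by auto
    have "uniform_limit S (\<lambda>k. poly (q k - p k)) (\<lambda>t. f t - f t) sequentially"
      using uniform_limit_minus[OF q(2) pS] by (simp add: poly_fun_simps)
    moreover have "tends (\<lambda>k. cstar_poly A (q k - p k) x) (z \<ominus> y)"
      using tends_minus[OF q(3) p(5)] p q by (simp add: cstar_poly_diff)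
    ultimately have "cnorm A (z \<ominus> y) \<le> 0"
      using p q S by (intro cnorm_cstar_poly_limit_le[of x "\<lambda>k. q k - p k" S "\<lambda>t. f t - f t"]) auto
    then show "z = y"
      using tends_closed(1)[OF q(3)] tends_closed(1)[OF p(5)]
      by (simp add: eq_if_cnorm_diff_le)
  qed
qed

end


section \<open>Positivity and Cuntz subequivalence\<close>

text \<open>In the application, \<open>u\<close>, \<open>v\<close>, \<open>w\<close>,
  \<open>z\<close> are the norms of \<open>z z\<^sup>* a - t a\<close>, \<open>a\<close>,
  \<open>z\<^sup>* a\<close> and \<open>z\<close>. Eliminating \<open>w\<close> turns a lower bound
  for \<open>z\<^sup>* z - t\<close> into one for \<open>z z\<^sup>* - t\<close>.\<close>

lemma lower_bound_transfer:
  fixes t u v w z :: real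
  assumes "0 < t" "0 \<le> z" "t * w \<le> z * u" "t * v \<le> u + z * w"
  shows "t / (1 + z\<^sup>2 / t) * v \<le> u"
proof -
  have pos: "1 + z\<^sup>2 / t > 0"
    using assms by (intro add_pos_nonneg) auto
  have "t * (z * w) = z * (t * w)"
    by (rule mult.left_commute)
  also have "\<dots> \<le> z * (z * u)"
    using assms by (intro mult_left_mono)
  also have "\<dots> = z\<^sup>2 * u"
    by (simp add: power2_eq_square)
  finally have "z * w \<le> z\<^sup>2 * u / t"
    using assms(1) by (simp only: pos_le_divide_eq mult.commute)
  then have "v * t \<le> u * (1 + z\<^sup>2 / t)"
    using assms(4) by (simp add: distrib_left mult.commute)
  then have "v * t / (1 + z\<^sup>2 / t) \<le> u"
    using pos by (simp only: pos_divide_le_eq)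
  then show ?thesis
    by (simp add: mult.commute)
qed
text \<open>With \<open>h\<close> the negative part of \<open>t\<close>, this is
  \<open>h t h = - h\<^sup>3\<close>, where \<open>h\<^sup>3\<close> is written as the square of
  \<open>h sqrt h\<close>.\<close>

lemma max_neg_cube:
  fixes t :: real
  shows "max (- t) 0 * (t * max (- t) 0)
    = - 1 * (max (- t) 0 * sqrt (max (- t) 0) * (max (- t) 0 * sqrt (max (- t) 0)))"
proof (cases "0 \<le> t")
  case False
  define u where "u = sqrt (- t)"
  have "- t = u * u" "0 \<le> u"
    using False by (simp_all add: u_def)
  then have t: "max (- t) 0 = u * u" "t = - (u * u)" "sqrt (u * u) = u"
    by (auto simp: max_absorb1)
  show ?thesis
    unfolding t(1,3) by (subst t(2)) simp
qed (simp add: max_absorb2)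
context cstar_algebra
begin

text \<open>The norm form of positivity of \<open>w\<^sup>2\<close>: on the spectrum of
  \<open>w\<close>, \<open>||w||\<^sup>2 - t\<^sup>2\<close> lies between \<open>0\<close> and
  \<open>||w||\<^sup>2\<close>.\<close>

lemma square_bound:
  assumes "w \<in> carrier A" "star A w = w" "v \<in> carrier A"
  shows "cnorm A (complex_of_real ((cnorm A w)\<^sup>2) \<odot> v \<ominus> w \<otimes> (w \<otimes> v)) \<le> (cnorm A w)\<^sup>2 * cnorm A v"
proof -
  have "cnorm A (act w (cpoly [:(cnorm A w)\<^sup>2, 0, -1:]) v) \<le> (cnorm A w)\<^sup>2 * cnorm A v"
  proof (rule cnorm_act_le)
    fix t assume "t \<in> ap_spectrum w"
    then have "\<bar>t\<bar> \<le> cnorm A w"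
      using ap_spectrum_bound assms by simp
    then have "t\<^sup>2 \<le> (cnorm A w)\<^sup>2"
      using assms by (simp add: abs_le_square_iff[symmetric])
    then show "\<bar>poly [:(cnorm A w)\<^sup>2, 0, -1:] t\<bar> \<le> (cnorm A w)\<^sup>2"
      by (simp add: power2_eq_square abs_le_iff)
  qed (use assms in auto)
  then show ?thesis
    using assms by (simp add: cpoly_pCons cstar_simps)
qed

text \<open>For \<open>t < 0\<close> the vector \<open>M v - x v\<close> can account for only
  \<open>M ||v||\<close> of the norm of \<open>(M - t) v\<close>; the rest,
  \<open>- t ||v||\<close>, must come from \<open>(x - t) v\<close>. Unlike a condition on the
  spectrum, the hypothesis \<open>bound\<close> is additive in \<open>x\<close> and
  \<open>M\<close>.\<close>

lemma ap_spectrum_nonneg: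
  assumes x: "x \<in> carrier A" and t: "t \<in> ap_spectrum x"
    and bound: "\<And>v. v \<in> carrier A \<Longrightarrow> cnorm A (complex_of_real M \<odot> v \<ominus> x \<otimes> v) \<le> M * cnorm A v"
  shows "0 \<le> t"
proof (rule ccontr)
  assume "\<not> 0 \<le> t"
  then have "bounded_below x [:- complex_of_real t, 1:]"
  proof (intro bounded_belowI)
    fix v assume v: "v \<in> carrier A"
    have "complex_of_real (M - t) \<odot> v = (complex_of_real M \<odot> v \<ominus> x \<otimes> v) \<oplus> act x [:- complex_of_real t, 1:] v"
      using x v by (simp add: cstar_simps)
    then have "\<bar>M - t\<bar> * cnorm A v = cnorm A \<dots>"
      using v by (metis cnorm_scale norm_of_real)
    also have "\<dots> \<le> M * cnorm A v + cnorm A (act x [:- complex_of_real t, 1:] v)"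
      using cnorm_triangle[of "complex_of_real M \<odot> v \<ominus> x \<otimes> v" "act x [:- complex_of_real t, 1:] v"]
        bound[OF v] x v by simp
    finally have "\<bar>M - t\<bar> * cnorm A v \<le> M * cnorm A v + cnorm A (act x [:- complex_of_real t, 1:] v)" .
    moreover have "(M - t) * cnorm A v \<le> \<bar>M - t\<bar> * cnorm A v"
      using v by (intro mult_right_mono) auto
    ultimately show "- t * cnorm A v \<le> cnorm A (act x [:- complex_of_real t, 1:] v)"
      by (simp add: algebra_simps)
  qed simp
  then show False
    using t by (simp add: ap_spectrum_def)
qed

lemma eq_zero_if_star_mult: "x \<in> carrier A \<Longrightarrow> star A x \<otimes> x = \<zero> \<Longrightarrow> x = \<zero>"
  using cstar_identity[of x] cnorm_eq_zero[of x] by simp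

text \<open>Writing \<open>z = a + i b\<close>, the element \<open>z z\<^sup>* = n\<^sup>2 + 2 a\<^sup>2 + 2 b\<^sup>2\<close> has no negative spectrum, and no
  positive spectrum because \<open>z\<^sup>* z\<close> has none.\<close>

lemma eq_zero_if_star_mult_neg:
  assumes z: "z \<in> carrier A" and n: "n \<in> carrier A" "star A n = n"
    and eq: "star A z \<otimes> z = \<ominus> (n \<otimes> n)"
  shows "z = \<zero>"
proof -
  define X where "X = z \<otimes> star A z"
  \<comment> \<open>\<open>a\<close> and \<open>b\<close> are the real and imaginary parts of
    \<open>z\<close>, so that
    \<open>z z\<^sup>* + z\<^sup>* z = 2 a\<^sup>2 + 2 b\<^sup>2\<close>.\<close>
  define a where "a = (1 / 2 :: complex) \<odot> (z \<oplus> star A z)"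
  define b where "b = (- \<i> / 2) \<odot> (z \<ominus> star A z)"
  have ab: "a \<in> carrier A" "star A a = a" "b \<in> carrier A" "star A b = b"
    using z by (simp_all add: a_def b_def cstar_simps)
  have X: "X \<in> carrier A" "star A X = X"
    using z by (simp_all add: X_def star_mult)
  have "2 \<odot> (a \<otimes> a) \<oplus> 2 \<odot> (b \<otimes> b) = X \<oplus> star A z \<otimes> z"
    using z by (simp add: a_def b_def X_def cstar_simps)
  then have X_eq: "X = n \<otimes> n \<oplus> (2 \<odot> (a \<otimes> a) \<oplus> 2 \<odot> (b \<otimes> b))"
    using X n by (simp add: eq cstar_simps)
  define M where "M = (cnorm A n)\<^sup>2 + (2 * (cnorm A a)\<^sup>2 + 2 * (cnorm A b)\<^sup>2)"
  have nonneg: "0 \<le> t" if "t \<in> ap_spectrum X" for t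
  proof (rule ap_spectrum_nonneg[OF X(1) that])
    fix v assume v: "v \<in> carrier A"
    define D where "D w = complex_of_real ((cnorm A w)\<^sup>2) \<odot> v \<ominus> w \<otimes> (w \<otimes> v)" for w
    have D: "D w \<in> carrier A" "cnorm A (D w) \<le> (cnorm A w)\<^sup>2 * cnorm A v"
      if "w \<in> carrier A" "star A w = w" for w
      using that v square_bound[OF that v] by (simp_all add: D_def)
    have "complex_of_real M \<odot> v \<ominus> X \<otimes> v = D n \<oplus> (2 \<odot> D a \<oplus> 2 \<odot> D b)"
      using n ab v by (simp add: D_def M_def X_eq cstar_simps)
    then have "cnorm A (complex_of_real M \<odot> v \<ominus> X \<otimes> v) \<le> cnorm A (D n) + (2 * cnorm A (D a) + 2 * cnorm A (D b))"
      using cnorm_triangle[of "D n" "2 \<odot> D a \<oplus> 2 \<odot> D b"] cnorm_triangle[of "2 \<odot> D a" "2 \<odot> D b"]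
        D(1)[OF n] D(1)[OF ab(1,2)] D(1)[OF ab(3,4)] by (simp add: cnorm_scale)
    also have "\<dots> \<le> M * cnorm A v"
      using D(2)[OF n] D(2)[OF ab(1,2)] D(2)[OF ab(3,4)] by (simp add: M_def algebra_simps)
    finally show "cnorm A (complex_of_real M \<odot> v \<ominus> X \<otimes> v) \<le> M * cnorm A v" .
  qed
  have nonpos: "t \<le> 0" if "t \<in> ap_spectrum X" for t
  proof (rule ccontr)
    assume "\<not> t \<le> 0"
    then have t: "t > 0"
      by simp
    have "bounded_below X [:- complex_of_real t, 1:]"
    proof (rule bounded_belowI[of "t / (1 + (cnorm A z)\<^sup>2 / t)"])
      show "t / (1 + (cnorm A z)\<^sup>2 / t) > 0"
        using t by (simp add: add_pos_nonneg)
      fix v assume v: "v \<in> carrier A"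
      define u where "u = act X [:- complex_of_real t, 1:] v"
      define w where "w = star A z \<otimes> v"
      have closed: "u \<in> carrier A" "w \<in> carrier A"
        using X v z by (simp_all add: u_def w_def)
      have u_eq: "u = X \<otimes> v \<ominus> complex_of_real t \<odot> v"
        using X v by (simp add: u_def cstar_simps)
      \<comment> \<open>In total
        \<open>z\<^sup>* u = (z\<^sup>* z - t) w = - (t + n\<^sup>2) w\<close>, and
        \<open>t + n\<^sup>2\<close> is bounded below by \<open>t\<close>.\<close>
      have "star A z \<otimes> u = (star A z \<otimes> z) \<otimes> w \<ominus> complex_of_real t \<odot> w"
        using z v by (simp add: u_eq X_def w_def cstar_simps)
      also have "\<dots> = (-1) \<odot> (complex_of_real t \<odot> w \<oplus> n \<otimes> (n \<otimes> w))"
        unfolding eq using n closed by (simp add: cstar_simps)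
      also have "complex_of_real t \<odot> w \<oplus> n \<otimes> (n \<otimes> w) = act n ([:complex_of_real (sqrt t):]\<^sup>2 + [:0, 1:]\<^sup>2) w"
      proof -
        have "[:complex_of_real (sqrt t):]\<^sup>2 + [:0, 1:]\<^sup>2 = [:complex_of_real t, 0, 1:]"
          using t by (simp add: power2_eq_square flip: of_real_mult)
        then show ?thesis
          using n closed by simp
      qed
      finally have "cnorm A (star A z \<otimes> u) = cnorm A (act n ([:complex_of_real (sqrt t):]\<^sup>2 + [:0, 1:]\<^sup>2) w)"
        using n closed by (simp add: cnorm_scale)
      then have "t * cnorm A w \<le> cnorm A (star A z \<otimes> u)"
        using cnorm_act_one_plus_square(1)[OF n closed(2), of "[:0, 1:]" "sqrt t"] t
        by (simp add: cnj_poly_pCons)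
      then have w: "t * cnorm A w \<le> cnorm A z * cnorm A u"
        using cnorm_mult[of "star A z" u] z closed by simp
      have "X \<otimes> v = z \<otimes> w"
        using z v by (simp add: X_def w_def mult_assoc)
      then have "t * cnorm A v \<le> cnorm A u + cnorm A z * cnorm A w"
        using cnorm_le_diff[of "complex_of_real t \<odot> v" "X \<otimes> v"] cnorm_mult[of z w] t X v z closed
          cnorm_minus_commute[of "complex_of_real t \<odot> v" "X \<otimes> v"]
        by (simp add: u_eq cnorm_scale)
      then have "t / (1 + (cnorm A z)\<^sup>2 / t) * cnorm A v \<le> cnorm A u"
        using lower_bound_transfer[OF t _ w] z by simp
      then show "t / (1 + (cnorm A z)\<^sup>2 / t) * cnorm A v \<le> cnorm A (act X [:- complex_of_real t, 1:] v)"
        by (simp only: u_def)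
    qed
    then show False
      using that by (simp add: ap_spectrum_def)
  qed
  have "cnorm A X \<le> 0"
    using nonneg nonpos by (intro has_fun_calc_cnorm_le[OF has_fun_calc_id[OF X]]) force+
  then show ?thesis
    using cstar_identity'[OF z] cnorm_eq_zero[OF z] by (simp add: X_def)
qed

text \<open>If \<open>h\<close> is the negative part of \<open>j = g\<^sup>* g\<close>, then \<open>(g h)\<^sup>* (g h) = - h\<^sup>3\<close>.\<close>

lemma positive_elem_square:
  assumes "positive_elem A j"
  obtains q where "q \<in> carrier A" "star A q = q" "j = q \<otimes> q"
proof -
  obtain g where g: "g \<in> carrier A" and j_def: "j = star A g \<otimes> g"
    using assms unfolding positive_elem_def by blast
  have j: "j \<in> carrier A" "star A j = j"
    using g by (simp_all add: j_def star_mult)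
  note id = has_fun_calc_id[OF j]
  have "continuous_on {- cnorm A j..cnorm A j} (\<lambda>t. max (- t) 0)"
    by (intro continuous_intros)
  then obtain h where h: "has_fun_calc j (\<lambda>t. max (- t) 0) h"
    by (rule has_fun_calc_exists[OF j]) simp
  have "continuous_on {- cnorm A j..cnorm A j} (\<lambda>t. max (- t) 0 * sqrt (max (- t) 0))"
    by (intro continuous_intros)
  then obtain n where n: "has_fun_calc j (\<lambda>t. max (- t) 0 * sqrt (max (- t) 0)) n"
    by (rule has_fun_calc_exists[OF j]) simp
  \<comment> \<open>The root is taken of \<open>|t|\<close> because nonnegativity of the spectrum of
    \<open>j\<close> is not yet known. It squares to \<open>j + 2 h\<close>, and \<open>h\<close>
    turns out to be zero.\<close>
  have "continuous_on {- cnorm A j..cnorm A j} (\<lambda>t. sqrt \<bar>t\<bar>)"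
    by (intro continuous_intros)
  then obtain q where q: "has_fun_calc j (\<lambda>t. sqrt \<bar>t\<bar>) q"
    by (rule has_fun_calc_exists[OF j]) simp
  note closed = h[THEN has_fun_calc_closed(1)] n[THEN has_fun_calc_closed(1)] q[THEN has_fun_calc_closed(1)]
  note star = h[THEN has_fun_calc_star] n[THEN has_fun_calc_star] q[THEN has_fun_calc_star]
  have "h \<otimes> (j \<otimes> h) = complex_of_real (-1) \<odot> (n \<otimes> n)"
    by (rule has_fun_calc_unique_on[OF has_fun_calc_mult[OF h has_fun_calc_mult[OF id h]]
          has_fun_calc_scale[OF has_fun_calc_mult[OF n n]]]) (rule max_neg_cube)
  then have "star A (g \<otimes> h) \<otimes> (g \<otimes> h) = \<ominus> (n \<otimes> n)"
    using closed star g by (simp add: j_def star_mult mult_assoc uminus_eq_scale)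
  then have "g \<otimes> h = \<zero>"
    by (rule eq_zero_if_star_mult_neg[OF mult_closed[OF g closed(1)] closed(2) star(2)])
  then have "j \<otimes> h = \<zero>"
    using closed g by (simp add: j_def mult_assoc)
  \<comment> \<open>Where the negative part lives, \<open>j\<close> is \<open>- h\<close>; so
    \<open>j h = 0\<close> forces \<open>h\<^sup>2 = 0\<close>.\<close>
  have "h \<otimes> h = complex_of_real (-1) \<odot> (j \<otimes> h)"
    by (rule has_fun_calc_unique_on[OF has_fun_calc_mult[OF h h]
          has_fun_calc_scale[OF has_fun_calc_mult[OF id h]]]) (auto simp: max_def)
  then have "star A h \<otimes> h = \<zero>"
    using \<open>j \<otimes> h = \<zero>\<close> star by simp
  then have "h = \<zero>"
    by (rule eq_zero_if_star_mult[OF closed(1)])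
  have "j \<oplus> complex_of_real 2 \<odot> h = q \<otimes> q"
    by (rule has_fun_calc_unique_on[OF has_fun_calc_add[OF id has_fun_calc_scale[OF h]]
          has_fun_calc_mult[OF q q]]) (auto simp: max_def)
  then show ?thesis
    using that[of q] closed star j \<open>h = \<zero>\<close> by simp
qed

lemma positive_elem_closed: "positive_elem A a \<Longrightarrow> a \<in> carrier A"
  and star_positive_elem: "positive_elem A a \<Longrightarrow> star A a = a"
  by (auto simp: positive_elem_def star_mult)

lemma positive_elem_ap_spectrum:
  assumes "positive_elem A a" "t \<in> ap_spectrum a"
  shows "0 \<le> t"
proof -
  obtain q where q: "q \<in> carrier A" "star A q = q" "a = q \<otimes> q"
    using assms(1) by (rule positive_elem_square)
  show ?thesis
    by (rule ap_spectrum_nonneg[OF _ assms(2), of "(cnorm A q)\<^sup>2"])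
      (use q square_bound[OF q(1,2)] in \<open>auto simp: mult_assoc\<close>)
qed

section \<open>Cut-downs of self-adjoint elements\<close>

lemma has_fun_calc_cut_down:
  assumes "c \<in> carrier A" "star A c = c" "0 \<le> \<epsilon>"
  shows "has_fun_calc c (\<lambda>t. max (t - \<epsilon>) 0) (cut_down A c \<epsilon>)"
proof -
  have "continuous_on {- cnorm A c..cnorm A c} (\<lambda>t. max (t - \<epsilon>) 0)"
    by (intro continuous_intros)
  then obtain y where "has_fun_calc c (\<lambda>t. max (t - \<epsilon>) 0) y"
    by (rule has_fun_calc_exists[OF assms(1,2)]) (use assms(3) in simp)
  then show ?thesis
    using cstar_fun_calc_eq by (simp add: cut_down_def)
qed

lemma cut_down_closed: "c \<in> carrier A \<Longrightarrow> star A c = c \<Longrightarrow> 0 \<le> \<epsilon> \<Longrightarrow> cut_down A c \<epsilon> \<in> carrier A"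
  by (rule has_fun_calc_closed[OF has_fun_calc_cut_down])

lemma cut_down_sqrt:
  assumes "c \<in> carrier A" "star A c = c" "0 \<le> \<epsilon>"
  obtains k where "has_fun_calc c (\<lambda>t. sqrt (max (t - \<epsilon>) 0)) k" "cut_down A c \<epsilon> = k \<otimes> k"
proof -
  have "continuous_on {- cnorm A c..cnorm A c} (\<lambda>t. sqrt (max (t - \<epsilon>) 0))"
    by (intro continuous_intros)
  then obtain k where k: "has_fun_calc c (\<lambda>t. sqrt (max (t - \<epsilon>) 0)) k"
    by (rule has_fun_calc_exists[OF assms(1,2)]) (use assms(3) in simp)
  moreover have "cut_down A c \<epsilon> = k \<otimes> k"
    by (rule has_fun_calc_unique_on[OF has_fun_calc_cut_down[OF assms] has_fun_calc_mult[OF k k]]) simp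
  ultimately show ?thesis
    by (rule that)
qed

lemma positive_elem_cut_down:
  assumes "c \<in> carrier A" "star A c = c" "0 \<le> \<epsilon>"
  shows "positive_elem A (cut_down A c \<epsilon>)"
proof -
  obtain k where "has_fun_calc c (\<lambda>t. sqrt (max (t - \<epsilon>) 0)) k" "cut_down A c \<epsilon> = k \<otimes> k"
    using cut_down_sqrt[OF assms] .
  then show ?thesis
    unfolding positive_elem_def using has_fun_calc_closed has_fun_calc_star by metis
qed

text \<open>For \<open>t \<ge> 0\<close> the difference \<open>t - max (t - \<epsilon>) 0\<close> is
  \<open>min t \<epsilon>\<close>; positivity of \<open>c\<close> confines
  \<open>ap_spectrum c\<close> to such \<open>t\<close>.\<close>

lemma cnorm_minus_cut_down:
  assumes "positive_elem A c" "0 \<le> \<epsilon>"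
  shows "cnorm A (c \<ominus> cut_down A c \<epsilon>) \<le> \<epsilon>"
proof -
  note c = positive_elem_closed[OF assms(1)] star_positive_elem[OF assms(1)]
  show ?thesis
    using positive_elem_ap_spectrum[OF assms(1)] assms(2)
    by (intro has_fun_calc_cnorm_le[OF has_fun_calc_diff[OF has_fun_calc_id[OF c] has_fun_calc_cut_down[OF c]]])
      (force simp: max_def)+
qed

section \<open>Cuntz subequivalence\<close>

lemma cuntz_subequiv_iff:
  assumes "a \<in> carrier A" "b \<in> carrier A"
  shows "cuntz_subequiv A a b \<longleftrightarrow>
    (\<forall>e>0. \<exists>v\<in>carrier A. cnorm A (a \<ominus> (v \<otimes> b) \<otimes> star A v) < e)"
proof
  assume "cuntz_subequiv A a b"
  then obtain v where v: "\<And>n. v n \<in> carrier A"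
    "(\<lambda>n. cnorm A (a \<ominus> (v n \<otimes> b) \<otimes> star A (v n))) \<longlonglongrightarrow> 0"
    unfolding cuntz_subequiv_def by blast
  show "\<forall>e>0. \<exists>v\<in>carrier A. cnorm A (a \<ominus> (v \<otimes> b) \<otimes> star A v) < e"
  proof (intro allI impI)
    fix e :: real assume "e > 0"
    then obtain n where "cnorm A (a \<ominus> (v n \<otimes> b) \<otimes> star A (v n)) < e"
      using order_tendstoD(2)[OF v(2)] by (auto simp: eventually_sequentially)
    then show "\<exists>v\<in>carrier A. cnorm A (a \<ominus> (v \<otimes> b) \<otimes> star A v) < e"
      using v(1) by blast
  qed
next
  assume "\<forall>e>0. \<exists>v\<in>carrier A. cnorm A (a \<ominus> (v \<otimes> b) \<otimes> star A v) < e"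
  then have "\<exists>v\<in>carrier A. cnorm A (a \<ominus> (v \<otimes> b) \<otimes> star A v) < inverse (Suc n)" for n
    by simp
  then obtain v where v: "\<And>n. v n \<in> carrier A"
    "\<And>n. cnorm A (a \<ominus> (v n \<otimes> b) \<otimes> star A (v n)) < inverse (Suc n)"
    by metis
  have "(\<lambda>n. cnorm A (a \<ominus> (v n \<otimes> b) \<otimes> star A (v n))) \<longlonglongrightarrow> 0"
  proof (rule tendsto_sandwich[OF _ _ tendsto_const LIMSEQ_inverse_real_of_nat])
    show "\<forall>\<^sub>F n in sequentially. cnorm A (a \<ominus> (v n \<otimes> b) \<otimes> star A (v n)) \<le> inverse (Suc n)"
      by (intro always_eventually allI less_imp_le v(2))
  qed (use v(1) assms in simp)
  then show "cuntz_subequiv A a b"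
    unfolding cuntz_subequiv_def using v(1) by blast
qed

lemma cuntz_subequiv_trans:
  assumes closed: "a \<in> carrier A" "b \<in> carrier A" "c \<in> carrier A"
    and "cuntz_subequiv A a b" "cuntz_subequiv A b c"
  shows "cuntz_subequiv A a c"
  unfolding cuntz_subequiv_iff[OF closed(1,3)]
proof (intro allI impI)
  fix e :: real assume "e > 0"
  then obtain w where w: "w \<in> carrier A" "cnorm A (a \<ominus> (w \<otimes> b) \<otimes> star A w) < e / 2"
    using assms(4) unfolding cuntz_subequiv_iff[OF closed(1,2)] by (meson half_gt_zero)
  \<comment> \<open>The error made by \<open>u\<close> ends up between \<open>w\<close> and its
    adjoint, so it is divided in advance by the squared norm of \<open>w\<close>; the
    \<open>1\<close> avoids division by zero.\<close>
  have pos: "(cnorm A w)\<^sup>2 + 1 > 0"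
    by (simp add: add_nonneg_pos)
  then obtain u where u: "u \<in> carrier A"
    "cnorm A (b \<ominus> (u \<otimes> c) \<otimes> star A u) < e / 2 / ((cnorm A w)\<^sup>2 + 1)"
    using assms(5) \<open>e > 0\<close> unfolding cuntz_subequiv_iff[OF closed(2,3)]
    by (meson half_gt_zero divide_pos_pos)
  let ?d = "b \<ominus> (u \<otimes> c) \<otimes> star A u"
  have "(w \<otimes> b) \<otimes> star A w \<ominus> ((w \<otimes> u) \<otimes> c) \<otimes> star A (w \<otimes> u) = w \<otimes> (?d \<otimes> star A w)"
    using w u closed by (simp add: cstar_simps)
  also have "cnorm A \<dots> \<le> cnorm A w * (cnorm A ?d * cnorm A w)"
    using cnorm_mult[of w "?d \<otimes> star A w"] cnorm_mult[of ?d "star A w"] w u closed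
      mult_left_mono[of "cnorm A (?d \<otimes> star A w)" "cnorm A ?d * cnorm A w" "cnorm A w"] by simp
  also have "\<dots> \<le> ((cnorm A w)\<^sup>2 + 1) * cnorm A ?d"
    using u closed by (simp add: power2_eq_square algebra_simps)
  also have "\<dots> < e / 2"
    using u(2) pos by (simp add: field_simps)
  finally have "cnorm A (a \<ominus> ((w \<otimes> u) \<otimes> c) \<otimes> star A (w \<otimes> u)) < e"
    using cnorm_diff_triangle[of a "(w \<otimes> b) \<otimes> star A w" "((w \<otimes> u) \<otimes> c) \<otimes> star A (w \<otimes> u)"] w u closed
    by simp
  then show "\<exists>v\<in>carrier A. cnorm A (a \<ominus> (v \<otimes> c) \<otimes> star A v) < e"
    using w u by (intro bexI[of _ "w \<otimes> u"]) auto
qed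

text \<open>The norm of \<open>g y\<close> depends only on \<open>g\<^sup>* g\<close>. With
  \<open>q\<close> in the role of the absolute value of \<open>g\<close>, this substitutes for the
  polar decomposition.\<close>

lemma cnorm_mult_eq_if_star_mult_eq:
  assumes "g \<in> carrier A" "q \<in> carrier A" "y \<in> carrier A" "star A g \<otimes> g = star A q \<otimes> q"
  shows "cnorm A (g \<otimes> y) = cnorm A (q \<otimes> y)"
proof -
  have "(cnorm A (g \<otimes> y))\<^sup>2 = cnorm A (star A y \<otimes> ((star A g \<otimes> g) \<otimes> y))" if "g \<in> carrier A" for g
    using cstar_identity[of "g \<otimes> y"] that assms(3) by (simp add: star_mult mult_assoc)
  then have "(cnorm A (g \<otimes> y))\<^sup>2 = (cnorm A (q \<otimes> y))\<^sup>2"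
    using assms by simp
  then show ?thesis
    using assms by simp
qed

text \<open>On the range of \<open>k = ((c - \<epsilon>)\<^sub>+)\<^bsup>1/2\<^esup>\<close> the element \<open>c\<close> is bounded below by \<open>\<epsilon>\<close>, so \<open>e\<^sup>* e\<close> is
  bounded below by \<open>\<epsilon> - \<eta>\<close> there.\<close>

lemma cut_down_dominated:
  assumes c: "c \<in> carrier A" "star A c = c" and e: "e \<in> carrier A"
    and close: "cnorm A (c \<ominus> star A e \<otimes> e) \<le> \<eta>" and \<epsilon>: "0 < \<epsilon>"
    and k: "has_fun_calc c (\<lambda>t. sqrt (max (t - \<epsilon>) 0)) k" and y: "y \<in> carrier A"
  shows "(\<epsilon> - \<eta>) * (cnorm A (k \<otimes> y))\<^sup>2 \<le> (cnorm A (e \<otimes> (k \<otimes> y)))\<^sup>2"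
proof -
  have "continuous_on {- cnorm A c..cnorm A c} (\<lambda>t. sqrt (max t 0))"
    by (intro continuous_intros)
  then obtain h where h: "has_fun_calc c (\<lambda>t. sqrt (max t 0)) h"
    by (rule has_fun_calc_exists[OF c]) simp
  \<comment> \<open>\<open>l\<close> inverts \<open>h\<close> on the range of \<open>k\<close>: it
    is \<open>1 / sqrt t\<close> for \<open>t \<ge> \<epsilon>\<close>, and the denominator
    \<open>max t \<epsilon>\<close> keeps it continuous with norm at most
    \<open>1 / sqrt \<epsilon>\<close>. Hence \<open>\<epsilon> ||v||\<^sup>2 \<le> ||h v||\<^sup>2
    = ||v\<^sup>* c v||\<close>.\<close>
  have "continuous_on {- cnorm A c..cnorm A c} (\<lambda>t. sqrt (max t 0) / max t \<epsilon>)"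
    using \<epsilon> by (intro continuous_intros) auto
  then obtain l where l: "has_fun_calc c (\<lambda>t. sqrt (max t 0) / max t \<epsilon>) l"
    by (rule has_fun_calc_exists[OF c]) simp
  note closed = h[THEN has_fun_calc_closed(1)] k[THEN has_fun_calc_closed(1)] l[THEN has_fun_calc_closed(1)]
  define v where "v = k \<otimes> y"
  have v: "v \<in> carrier A"
    using closed y by (simp add: v_def)
  have sqrt_eq: "sqrt t * (sqrt t * u) = t * u" if "0 \<le> t" for t u
    using that by (simp flip: mult.assoc)
  have "c \<otimes> k = h \<otimes> (h \<otimes> k)"
    by (rule has_fun_calc_unique_on[OF has_fun_calc_mult[OF has_fun_calc_id[OF c] k]
          has_fun_calc_mult[OF h has_fun_calc_mult[OF h k]]]) (use \<epsilon> in \<open>auto simp: max_def sqrt_eq\<close>)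
  then have "c \<otimes> v = h \<otimes> (h \<otimes> v)"
    using closed c y by (simp add: v_def flip: mult_assoc)
  then have hv: "cnorm A (star A v \<otimes> (c \<otimes> v)) = (cnorm A (h \<otimes> v))\<^sup>2"
    using cstar_identity[of "h \<otimes> v"] closed v has_fun_calc_star[OF h] by (simp add: star_mult mult_assoc)
  have "k = l \<otimes> (h \<otimes> k)"
    by (rule has_fun_calc_unique_on[OF k has_fun_calc_mult[OF l has_fun_calc_mult[OF h k]]])
      (use \<epsilon> in \<open>auto simp: max_def sqrt_eq\<close>)
  then have "v = l \<otimes> (h \<otimes> v)"
    using closed c y by (metis v_def mult_assoc mult_closed)
  moreover have "cnorm A l \<le> 1 / sqrt \<epsilon>"
  proof (rule has_fun_calc_cnorm_le[OF l])
    fix t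
    show "\<bar>sqrt (max t 0) / max t \<epsilon>\<bar> \<le> 1 / sqrt \<epsilon>"
    proof (cases "t \<le> \<epsilon>")
      case True
      have "sqrt (max t 0) / \<epsilon> \<le> sqrt \<epsilon> / \<epsilon>"
        using True \<epsilon> by (intro divide_right_mono) auto
      also have "sqrt \<epsilon> / \<epsilon> = 1 / sqrt \<epsilon>"
        using \<epsilon> by (simp add: field_simps)
      finally show ?thesis
        using True \<epsilon> by (simp add: max_absorb2 abs_divide)
    next
      case False
      then have "sqrt t / t = 1 / sqrt t"
        using \<epsilon> by (simp add: field_simps)
      also have "\<dots> \<le> 1 / sqrt \<epsilon>"
        using False \<epsilon> by (simp add: frac_le)
      finally show ?thesis
        using False \<epsilon> by (simp add: max_absorb1 abs_divide)
    qed
  qed (use \<epsilon> in simp)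
  ultimately have "cnorm A v \<le> 1 / sqrt \<epsilon> * cnorm A (h \<otimes> v)"
    using cnorm_mult[of l "h \<otimes> v"] mult_right_mono[of "cnorm A l" "1 / sqrt \<epsilon>" "cnorm A (h \<otimes> v)"] closed v
    by simp
  then have "(sqrt \<epsilon> * cnorm A v)\<^sup>2 \<le> (cnorm A (h \<otimes> v))\<^sup>2"
    using \<epsilon> v by (intro power_mono) (auto simp: field_simps)
  then have lower: "\<epsilon> * (cnorm A v)\<^sup>2 \<le> (cnorm A (h \<otimes> v))\<^sup>2"
    using \<epsilon> by (simp add: power_mult_distrib)
  let ?d = "star A e \<otimes> e"
  have "cnorm A (star A v \<otimes> ((c \<ominus> ?d) \<otimes> v)) \<le> cnorm A v * (cnorm A (c \<ominus> ?d) * cnorm A v)"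
    using cnorm_mult[of "star A v" "(c \<ominus> ?d) \<otimes> v"] cnorm_mult[of "c \<ominus> ?d" v] v c e
      mult_left_mono[of "cnorm A ((c \<ominus> ?d) \<otimes> v)" "cnorm A (c \<ominus> ?d) * cnorm A v" "cnorm A v"] by simp
  also have "\<dots> = cnorm A (c \<ominus> ?d) * (cnorm A v)\<^sup>2"
    by (simp add: power2_eq_square)
  also have "\<dots> \<le> \<eta> * (cnorm A v)\<^sup>2"
    using close by (intro mult_right_mono) auto
  finally have "cnorm A (star A v \<otimes> ((c \<ominus> ?d) \<otimes> v)) \<le> \<eta> * (cnorm A v)\<^sup>2" .
  moreover have "star A v \<otimes> (c \<otimes> v) \<ominus> star A (e \<otimes> v) \<otimes> (e \<otimes> v) = star A v \<otimes> ((c \<ominus> ?d) \<otimes> v)"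
    using v c e by (simp add: cstar_simps)
  moreover have "cnorm A (star A (e \<otimes> v) \<otimes> (e \<otimes> v)) = (cnorm A (e \<otimes> v))\<^sup>2"
    using e v by (intro cstar_identity) auto
  ultimately show ?thesis
    using cnorm_le_diff[of "star A v \<otimes> (c \<otimes> v)" "star A (e \<otimes> v) \<otimes> (e \<otimes> v)"] v c e hv lower
    by (simp add: v_def[symmetric] algebra_simps)
qed

text \<open>With \<open>s = t\<^sup>2 / (t\<^sup>2 + \<delta>)\<close> the left side is
  \<open>|t| (1 - s\<^sup>2)\<close>, at most
  \<open>2 |t| \<delta> / (t\<^sup>2 + \<delta>)\<close>; the inequality of arithmetic and geometric
  means bounds this by \<open>sqrt \<delta>\<close>.\<close>

lemma abs_regularized_le:
  fixes t :: real
  assumes "0 < \<delta>"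
  defines "\<rho> \<equiv> t / (t\<^sup>2 + \<delta>)"
  shows "\<bar>t - t * (\<rho> * (t * t * \<rho>))\<bar> \<le> sqrt \<delta>"
proof -
  have pos: "t\<^sup>2 + \<delta> > 0"
    using assms by (simp add: add_nonneg_pos)
  define s where "s = t\<^sup>2 / (t\<^sup>2 + \<delta>)"
  have s: "0 \<le> s" "s \<le> 1" "1 - s = \<delta> / (t\<^sup>2 + \<delta>)"
    using pos assms by (simp_all add: s_def field_simps)
  have eq: "t - t * (\<rho> * (t * t * \<rho>)) = t * ((1 - s) * (1 + s))"
    by (simp add: s_def \<rho>_def power2_eq_square algebra_simps)
  have "2 * (\<bar>t\<bar> * sqrt \<delta>) \<le> t\<^sup>2 + \<delta>"
    using sum_squares_bound[of "\<bar>t\<bar>" "sqrt \<delta>"] assms by (simp add: mult.assoc)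
  then have "sqrt \<delta> * (2 * (\<bar>t\<bar> * sqrt \<delta>)) \<le> sqrt \<delta> * (t\<^sup>2 + \<delta>)"
    using assms by (intro mult_left_mono) auto
  moreover have "sqrt \<delta> * (2 * (\<bar>t\<bar> * sqrt \<delta>)) = 2 * \<bar>t\<bar> * (sqrt \<delta> * sqrt \<delta>)"
    by (simp only: mult_ac)
  ultimately have "2 * \<bar>t\<bar> * \<delta> \<le> sqrt \<delta> * (t\<^sup>2 + \<delta>)"
    using assms by simp
  then have "2 * \<bar>t\<bar> * \<delta> / (t\<^sup>2 + \<delta>) \<le> sqrt \<delta>"
    using pos by (simp only: pos_divide_le_eq)
  then have *: "\<bar>t\<bar> * (1 - s) * 2 \<le> sqrt \<delta>"
    unfolding s(3) by (simp add: mult_ac)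
  have "\<bar>t - t * (\<rho> * (t * t * \<rho>))\<bar> = \<bar>t\<bar> * (\<bar>1 - s\<bar> * \<bar>1 + s\<bar>)"
    by (simp only: eq abs_mult)
  also have "\<dots> = \<bar>t\<bar> * (1 - s) * (1 + s)"
    using s(1,2) by simp
  also have "\<dots> \<le> \<bar>t\<bar> * (1 - s) * 2"
    using s(1,2) by (intro mult_left_mono mult_nonneg_nonneg) auto
  finally show ?thesis
    using * by (rule order_trans)
qed

text \<open>Write \<open>d = e\<^sup>2\<close>, the cut-down as \<open>k\<^sup>2\<close>, and
  \<open>g = e k\<close>. Then \<open>g\<^sup>* g = k d k = q\<^sup>2\<close> dominates
  \<open>(\<epsilon> - \<eta>) k\<^sup>2\<close>, so whatever is almost a unit for \<open>q\<close>
  is almost a unit for \<open>k\<close>. Such an \<open>m\<close> can be taken of the form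
  \<open>r (k d k) r\<close>; then \<open>k m k\<close> is close to \<open>k\<^sup>2\<close> and
  equals \<open>w d w\<^sup>*\<close>.\<close>

lemma cuntz_subequiv_cut_down:
  assumes c: "c \<in> carrier A" "star A c = c" and d: "positive_elem A d"
    and close: "cnorm A (c \<ominus> d) \<le> \<eta>" and \<eta>: "\<eta> < \<epsilon>"
  shows "cuntz_subequiv A (cut_down A c \<epsilon>) d"
proof -
  obtain e where e: "e \<in> carrier A" "star A e = e" "d = e \<otimes> e"
    using d by (rule positive_elem_square)
  have "0 \<le> \<eta>"
    using close cnorm_nonneg[OF minus_closed[OF c(1) positive_elem_closed[OF d]]] by linarith
  then have \<epsilon>: "0 < \<epsilon>"
    using \<eta> by simp
  obtain k where k: "has_fun_calc c (\<lambda>t. sqrt (max (t - \<epsilon>) 0)) k" "cut_down A c \<epsilon> = k \<otimes> k"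
    by (rule cut_down_sqrt[OF c less_imp_le[OF \<epsilon>]])
  have kc: "k \<in> carrier A" "star A k = k"
    using has_fun_calc_closed(1)[OF k(1)] has_fun_calc_star[OF k(1)] by simp_all
  define g where "g = e \<otimes> k"
  have g: "g \<in> carrier A"
    using e kc by (simp add: g_def)
  then have "positive_elem A (star A g \<otimes> g)"
    unfolding positive_elem_def by blast
  then obtain q where q: "q \<in> carrier A" "star A q = q" "star A g \<otimes> g = q \<otimes> q"
    by (rule positive_elem_square)
  have dominated: "sqrt (\<epsilon> - \<eta>) * cnorm A (k \<otimes> y) \<le> cnorm A (q \<otimes> y)" if y: "y \<in> carrier A" for y
  proof -
    have "(sqrt (\<epsilon> - \<eta>) * cnorm A (k \<otimes> y))\<^sup>2 \<le> (cnorm A (g \<otimes> y))\<^sup>2"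
      using cut_down_dominated[OF c e(1) _ \<epsilon> k(1) y, of \<eta>] close e kc y \<eta>
      by (simp add: power_mult_distrib g_def mult_assoc)
    also have "cnorm A (g \<otimes> y) = cnorm A (q \<otimes> y)"
      using g q y by (intro cnorm_mult_eq_if_star_mult_eq) auto
    finally show ?thesis
      by (rule power2_le_imp_le) (use q y in simp)
  qed
  have approx: "\<exists>w\<in>carrier A. cnorm A (cut_down A c \<epsilon> \<ominus> (w \<otimes> d) \<otimes> star A w) \<le> sqrt \<delta> / sqrt (\<epsilon> - \<eta>) * cnorm A k"
    if \<delta>: "\<delta> > 0" for \<delta>
  proof -
    have "t\<^sup>2 + \<delta> \<noteq> 0" for t
      using add_nonneg_pos[OF zero_le_power2[of t] \<delta>] by simp
    then have "continuous_on {- cnorm A q..cnorm A q} (\<lambda>t. t / (t\<^sup>2 + \<delta>))"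
      by (intro continuous_intros) auto
    then obtain r where r: "has_fun_calc q (\<lambda>t. t / (t\<^sup>2 + \<delta>)) r"
      by (rule has_fun_calc_exists[OF q(1,2)]) simp
    have rc: "r \<in> carrier A" "star A r = r"
      using has_fun_calc_closed(1)[OF r] has_fun_calc_star[OF r] by simp_all
    note id = has_fun_calc_id[OF q(1,2)]
    \<comment> \<open>\<open>m\<close> is the square of
      \<open>q\<^sup>2 / (q\<^sup>2 + \<delta>)\<close>, arranged so that
      \<open>q\<^sup>2 = k d k\<close> stands in the middle.\<close>
    define m where "m = r \<otimes> ((q \<otimes> q) \<otimes> r)"
    have m_fc: "has_fun_calc q (\<lambda>t. t / (t\<^sup>2 + \<delta>) * (t * t * (t / (t\<^sup>2 + \<delta>)))) m"
      unfolding m_def by (intro has_fun_calc_mult r id)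
    have m: "m \<in> carrier A" "star A m = m"
      using has_fun_calc_closed(1)[OF m_fc] has_fun_calc_star[OF m_fc] by simp_all
    have qm: "cnorm A (q \<ominus> q \<otimes> m) \<le> sqrt \<delta>"
    proof (rule has_fun_calc_cnorm_le[OF has_fun_calc_diff[OF id has_fun_calc_mult[OF id m_fc]]])
      show "\<bar>t - t * (t / (t\<^sup>2 + \<delta>) * (t * t * (t / (t\<^sup>2 + \<delta>))))\<bar> \<le> sqrt \<delta>" for t
        using \<delta> by (rule abs_regularized_le)
    qed (use \<delta> in simp)
    \<comment> \<open>The error, formally \<open>k (1 - m)\<close>. Since
      \<open>Z Z\<^sup>* = k y\<close> and \<open>q y = (q - q m) Z\<^sup>*\<close>, domination by
      \<open>q\<close> gives \<open>sqrt (\<epsilon> - \<eta>) ||Z||\<^sup>2 \<le> sqrt \<delta>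
      ||Z||\<close>.\<close>
    define Z where "Z = k \<ominus> k \<otimes> m"
    define y where "y = star A Z \<ominus> m \<otimes> star A Z"
    have Z: "Z \<in> carrier A" "y \<in> carrier A"
      using kc m by (simp_all add: Z_def y_def)
    have "Z \<otimes> star A Z = k \<otimes> y"
      using kc m by (simp add: Z_def y_def cstar_simps)
    then have "(cnorm A Z)\<^sup>2 = cnorm A (k \<otimes> y)"
      using cstar_identity'[OF Z(1)] by simp
    moreover have "q \<otimes> y = (q \<ominus> q \<otimes> m) \<otimes> star A Z"
      using q m Z by (simp add: y_def cstar_simps)
    moreover have "cnorm A \<dots> \<le> sqrt \<delta> * cnorm A Z"
      using cnorm_mult[of "q \<ominus> q \<otimes> m" "star A Z"] q m Z mult_right_mono[OF qm, of "cnorm A Z"] by simp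
    ultimately have "sqrt (\<epsilon> - \<eta>) * (cnorm A Z)\<^sup>2 \<le> sqrt \<delta> * cnorm A Z"
      using dominated[OF Z(2)] by simp
    then have "(cnorm A Z * sqrt (\<epsilon> - \<eta>)) * cnorm A Z \<le> sqrt \<delta> * cnorm A Z"
      by (simp add: power2_eq_square mult_ac)
    then have "cnorm A Z * sqrt (\<epsilon> - \<eta>) \<le> sqrt \<delta>"
      using cnorm_nonneg[OF Z(1)] \<delta> by (cases "cnorm A Z > 0") (auto simp: mult.commute)
    then have Z_le: "cnorm A Z \<le> sqrt \<delta> / sqrt (\<epsilon> - \<eta>)"
      using \<eta> by (simp only: pos_le_divide_eq real_sqrt_gt_0_iff diff_gt_0_iff_gt)
    define w where "w = k \<otimes> (r \<otimes> k)"
    have "(w \<otimes> d) \<otimes> star A w = k \<otimes> (r \<otimes> ((star A g \<otimes> g) \<otimes> (r \<otimes> k)))"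
      using kc rc e by (simp add: w_def g_def star_mult mult_assoc)
    also have "\<dots> = (k \<otimes> m) \<otimes> k"
      using kc rc q(1,2) by (simp add: q(3) m_def mult_assoc)
    finally have "cut_down A c \<epsilon> \<ominus> (w \<otimes> d) \<otimes> star A w = Z \<otimes> k"
      using kc m by (simp add: k(2) Z_def cstar_simps)
    then have "cnorm A (cut_down A c \<epsilon> \<ominus> (w \<otimes> d) \<otimes> star A w) \<le> sqrt \<delta> / sqrt (\<epsilon> - \<eta>) * cnorm A k"
      using cnorm_mult[of Z k] Z kc mult_right_mono[OF Z_le, of "cnorm A k"] by simp
    then show ?thesis
      using kc rc by (intro bexI[of _ w]) (auto simp: w_def)
  qed
  have closed: "cut_down A c \<epsilon> \<in> carrier A" "d \<in> carrier A"
    using kc e by (simp_all add: k(2))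
  show ?thesis
    unfolding cuntz_subequiv_iff[OF closed]
  proof (intro allI impI)
    fix \<theta> :: real assume \<theta>: "\<theta> > 0"
    \<comment> \<open>Used with \<open>\<delta> = s\<^sup>2\<close>. The bound becomes
      \<open>\<theta>\<close> times \<open>||k|| / (||k|| + 1)\<close>, which is below
      \<open>\<theta>\<close> also for \<open>k = 0\<close>.\<close>
    define s where "s = \<theta> * sqrt (\<epsilon> - \<eta>) / (cnorm A k + 1)"
    have s: "s > 0"
      using \<theta> \<eta> cnorm_nonneg[OF kc(1)] by (simp add: s_def)
    then obtain w where w: "w \<in> carrier A"
      "cnorm A (cut_down A c \<epsilon> \<ominus> (w \<otimes> d) \<otimes> star A w) \<le> s / sqrt (\<epsilon> - \<eta>) * cnorm A k"
      using approx[of "s\<^sup>2"] by auto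
    have "s / sqrt (\<epsilon> - \<eta>) * cnorm A k = \<theta> * (cnorm A k / (cnorm A k + 1))"
      using \<eta> by (simp add: s_def)
    also have "\<dots> < \<theta> * 1"
      using \<theta> cnorm_nonneg[OF kc(1)] by (intro mult_strict_left_mono) (simp_all add: pos_divide_less_eq)
    finally have "s / sqrt (\<epsilon> - \<eta>) * cnorm A k < \<theta>"
      by simp
    then show "\<exists>v\<in>carrier A. cnorm A (cut_down A c \<epsilon> \<ominus> (v \<otimes> d) \<otimes> star A v) < \<theta>"
      using w by (meson le_less_trans)
  qed
qed

end


section \<open>Ideals and contractive *-homomorphisms\<close>

context cstar_algebra
begin

text \<open>Formally the element is \<open>x (1 - h) x\<close>, but the root of \<open>1 - h\<close>
  need not lie in the algebra. Its complement \<open>v = 1 - sqrt (1 - h)\<close> does, because the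
  function vanishes at \<open>0\<close>; then \<open>h = 2 v - v\<^sup>2\<close>, and
  \<open>x - v x\<close> is the required factor.\<close>

lemma positive_elem_compress:
  assumes x: "x \<in> carrier A" "star A x = x" and h: "positive_elem A h" "cnorm A h \<le> 1"
  shows "positive_elem A (x \<otimes> x \<ominus> (x \<otimes> h) \<otimes> x)"
proof -
  obtain q where q: "q \<in> carrier A" "star A q = q" "h = q \<otimes> q"
    using h(1) by (rule positive_elem_square)
  have "(cnorm A q)\<^sup>2 \<le> 1"
    using cstar_identity[OF q(1)] h(2) q by simp
  then have q1: "cnorm A q \<le> 1"
    using power2_le_imp_le[of "cnorm A q" 1] by simp
  have "continuous_on {- cnorm A q..cnorm A q} (\<lambda>t. 1 - sqrt (1 - t\<^sup>2))"
    by (intro continuous_intros)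
  then obtain v where v: "has_fun_calc q (\<lambda>t. 1 - sqrt (1 - t\<^sup>2)) v"
    by (rule has_fun_calc_exists[OF q(1,2)]) simp
  have vc: "v \<in> carrier A" "star A v = v"
    using has_fun_calc_closed(1)[OF v] has_fun_calc_star[OF v] by simp_all
  have "h = (v \<oplus> v) \<ominus> v \<otimes> v"
    unfolding q(3)
  proof (rule has_fun_calc_unique_on[OF has_fun_calc_mult[OF has_fun_calc_id[OF q(1,2)] has_fun_calc_id[OF q(1,2)]]
        has_fun_calc_diff[OF has_fun_calc_add[OF v v] has_fun_calc_mult[OF v v]]])
    fix t assume "t \<in> ap_spectrum q"
    then have "\<bar>t\<bar> \<le> 1"
      using ap_spectrum_bound[OF q(1), of t] q1 by linarith
    then have "0 \<le> 1 - t\<^sup>2"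
      by (simp add: abs_square_le_1)
    then have "sqrt (1 - t\<^sup>2) * sqrt (1 - t\<^sup>2) = 1 - t\<^sup>2"
      by simp
    then show "t * t = 1 - sqrt (1 - t\<^sup>2) + (1 - sqrt (1 - t\<^sup>2)) - (1 - sqrt (1 - t\<^sup>2)) * (1 - sqrt (1 - t\<^sup>2))"
      by (simp add: power2_eq_square algebra_simps)
  qed
  then have "x \<otimes> x \<ominus> (x \<otimes> h) \<otimes> x = star A (x \<ominus> v \<otimes> x) \<otimes> (x \<ominus> v \<otimes> x)"
    using x vc by (simp add: cstar_simps)
  then show ?thesis
    unfolding positive_elem_def using x vc by (intro bexI[of _ "x \<ominus> v \<otimes> x"]) auto
qed

text \<open>Continuity of \<open>y \<mapsto> y\<^sup>* y\<close> at \<open>b\<close>. Approximating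
  the factor keeps the approximant of \<open>b\<^sup>* b\<close> positive.\<close>

lemma cnorm_star_mult_diff:
  assumes b: "b \<in> carrier A" and "\<delta> > 0"
  obtains \<delta>' where "\<delta>' > 0"
    "\<And>y. y \<in> carrier A \<Longrightarrow> cnorm A (b \<ominus> y) < \<delta>' \<Longrightarrow> cnorm A (star A b \<otimes> b \<ominus> star A y \<otimes> y) \<le> \<delta>"
proof
  have pos: "2 * cnorm A b + 1 > 0"
    using cnorm_nonneg[OF b] by linarith
  \<comment> \<open>The cap \<open>1\<close> bounds the norm of \<open>y\<close> by
    \<open>||b|| + 1\<close>, whence the factor \<open>2 ||b|| + 1\<close>.\<close>
  then show "min 1 (\<delta> / (2 * cnorm A b + 1)) > 0"
    using \<open>\<delta> > 0\<close> by simp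
  fix y assume y: "y \<in> carrier A" and less: "cnorm A (b \<ominus> y) < min 1 (\<delta> / (2 * cnorm A b + 1))"
  have "cnorm A y \<le> cnorm A b + 1"
    using cnorm_le_diff[OF y b] cnorm_minus_commute[OF b y] less by simp
  then have "cnorm A (b \<ominus> y) * cnorm A y \<le> cnorm A (b \<ominus> y) * (cnorm A b + 1)"
    using b y by (intro mult_left_mono) auto
  then have "cnorm A (star A b \<otimes> b \<ominus> star A y \<otimes> y) \<le> cnorm A (b \<ominus> y) * (2 * cnorm A b + 1)"
    using cnorm_diff_mult[of "star A b" b "star A y" y] b y by (simp add: cnorm_diff_star algebra_simps)
  also have "\<dots> \<le> \<delta>"
    using less pos by (simp add: pos_less_divide_eq less_imp_le)
  finally show "cnorm A (star A b \<otimes> b \<ominus> star A y \<otimes> y) \<le> \<delta>" .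
qed

text \<open>A vanishing cut-down forces \<open>||c|| \<le> \<epsilon>\<close>, and then
  \<open>||d|| \<le> \<eta> + \<epsilon>\<close>.\<close>

lemma cut_down_nonzero:
  assumes "positive_elem A c" "d \<in> carrier A" "cnorm A (d \<ominus> c) \<le> \<eta>" "0 \<le> \<epsilon>" "\<eta> + \<epsilon> < cnorm A d"
  shows "cut_down A c \<epsilon> \<noteq> \<zero>"
proof
  note c = positive_elem_closed[OF assms(1)]
  assume "cut_down A c \<epsilon> = \<zero>"
  then have "cnorm A c \<le> \<epsilon>"
    using cnorm_minus_cut_down[OF assms(1,4)] c by (simp add: minus_eq_scale)
  then show False
    using cnorm_le_diff[OF assms(2) c] assms(3,5) by simp
qed

lemma closed_ideal_limit:
  assumes "closed_ideal A J" "tends s y" "\<And>n. s n \<in> J"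
  shows "y \<in> J"
proof -
  have "limitin mtopology s y sequentially"
    unfolding limit_metric_sequentially
    using assms(2) order_tendstoD(2)[of "\<lambda>n. cnorm A (s n \<ominus> y)" 0 sequentially]
    by (auto simp: tends_def cdist_def eventually_sequentially)
  moreover have "closedin mtopology J"
    using assms(1) by (simp add: closed_ideal_def)
  ultimately show ?thesis
    using assms(3) unfolding metric_closedin_iff_sequentially_closed by blast
qed

lemma closed_ideal_cuntz:
  assumes J: "closed_ideal A J" and "b \<in> J" "a \<in> carrier A" "cuntz_subequiv A a b"
  shows "a \<in> J"
proof -
  obtain v where v: "\<And>n. v n \<in> carrier A" "(\<lambda>n. cnorm A (a \<ominus> (v n \<otimes> b) \<otimes> star A (v n))) \<longlonglongrightarrow> 0"
    using assms(4) unfolding cuntz_subequiv_def by blast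
  have b: "b \<in> carrier A"
    using J assms(2) unfolding closed_ideal_def by blast
  then have "tends (\<lambda>n. (v n \<otimes> b) \<otimes> star A (v n)) a"
    unfolding tends_def using v assms(3)
    by (simp add: cnorm_minus_commute[of "(v _ \<otimes> b) \<otimes> star A (v _)" a])
  moreover have "(v n \<otimes> b) \<otimes> star A (v n) \<in> J" for n
    using J assms(2) v star_closed[OF v(1)] unfolding closed_ideal_def by blast
  ultimately show ?thesis
    by (rule closed_ideal_limit[OF J])
qed

lemma closed_ideal_zero: "closed_ideal A {\<zero>}"
proof -
  have "closedin mtopology {\<zero>}"
    by (rule closedin_Hausdorff_singleton[OF Hausdorff_space_mtopology]) simp
  then show ?thesis
    by (auto simp: closed_ideal_def)
qed

end

section \<open>Contractive homomorphisms and what they preserve\<close>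

lemma linear_mapD:
  assumes "linear_map A B f"
  shows "x \<in> carrier A \<Longrightarrow> f x \<in> carrier B"
    and "x \<in> carrier A \<Longrightarrow> y \<in> carrier A \<Longrightarrow> f (x \<oplus>\<^bsub>A\<^esub> y) = f x \<oplus>\<^bsub>B\<^esub> f y"
    and "x \<in> carrier A \<Longrightarrow> f (c \<odot>\<^bsub>A\<^esub> x) = c \<odot>\<^bsub>B\<^esub> f x"
  using assms by (auto simp: linear_map_def)

lemma star_homD:
  assumes "star_hom A B f"
  shows "linear_map A B f"
    and "x \<in> carrier A \<Longrightarrow> y \<in> carrier A \<Longrightarrow> f (x \<otimes>\<^bsub>A\<^esub> y) = f x \<otimes>\<^bsub>B\<^esub> f y"
    and "x \<in> carrier A \<Longrightarrow> f (star A x) = star B (f x)"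
  using assms by (auto simp: star_hom_def)

text \<open>Contractivity is part of the locale because, for the maps into a direct limit, it can be
  read off from the prescribed norm.\<close>

locale contractive_star_hom = A: cstar_algebra A + B: cstar_algebra B
  for A :: "'a cstar_alg" and B :: "'b cstar_alg" +
  fixes h :: "'a \<Rightarrow> 'b"
  assumes star_hom: "star_hom A B h"
    and contractive: "x \<in> carrier A \<Longrightarrow> cnorm B (h x) \<le> cnorm A x"
begin

lemmas hom_closed [simp] = linear_mapD(1)[OF star_homD(1)[OF star_hom]]
  and hom_add [simp] = linear_mapD(2)[OF star_homD(1)[OF star_hom]]
  and hom_scale [simp] = linear_mapD(3)[OF star_homD(1)[OF star_hom]]
  and hom_mult [simp] = star_homD(2)[OF star_hom]
  and hom_star [simp] = star_homD(3)[OF star_hom]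

lemma hom_zero [simp]: "h \<zero>\<^bsub>A\<^esub> = \<zero>\<^bsub>B\<^esub>"
  using hom_scale[of "\<zero>\<^bsub>A\<^esub>" 0] by simp

lemma hom_minus [simp]:
  assumes "x \<in> carrier A" "y \<in> carrier A"
  shows "h (x \<ominus>\<^bsub>A\<^esub> y) = h x \<ominus>\<^bsub>B\<^esub> h y"
  using assms by (simp add: A.minus_eq_scale B.minus_eq_scale)

lemma hom_tends:
  assumes "A.tends s y"
  shows "B.tends (\<lambda>n. h (s n)) (h y)"
proof (rule B.tendsI_bound)
  have closed: "y \<in> carrier A" "s n \<in> carrier A" for n
    using assms by (auto simp: A.tends_def)
  show "h y \<in> carrier B" "h (s n) \<in> carrier B" for n
    using closed by auto
  show "cnorm B (h (s n) \<ominus>\<^bsub>B\<^esub> h y) \<le> cnorm A (s n \<ominus>\<^bsub>A\<^esub> y)" for n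
    using contractive[of "s n \<ominus>\<^bsub>A\<^esub> y"] closed by simp
  show "(\<lambda>n. cnorm A (s n \<ominus>\<^bsub>A\<^esub> y)) \<longlonglongrightarrow> 0"
    using assms by (simp add: A.tends_def)
qed

lemma hom_cstar_poly: "x \<in> carrier A \<Longrightarrow> h (cstar_poly A p x) = cstar_poly B p (h x)"
proof (induction p)
  case (pCons a p)
  then show ?case
    by (simp add: A.cstar_poly_pCons B.cstar_poly_pCons)
qed (simp add: cstar_poly_def)

text \<open>The norm interval of \<open>h x\<close> lies in that of \<open>x\<close>, and
  \<open>h\<close> commutes with polynomials, so the approximating sequence is kept
  unchanged.\<close>

lemma hom_has_fun_calc:
  assumes "A.has_fun_calc x f y"
  shows "B.has_fun_calc (h x) f (h y)"
proof -
  from assms obtain p where p: "x \<in> carrier A" "star A x = x" "\<And>k. coeff (p k) 0 = 0"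
    "uniform_limit {- cnorm A x..cnorm A x} (\<lambda>k. poly (p k)) f sequentially"
    "A.tends (\<lambda>k. cstar_poly A (p k) x) y"
    by (rule A.has_fun_calcE) blast
  have "uniform_limit {- cnorm B (h x)..cnorm B (h x)} (\<lambda>k. poly (p k)) f sequentially"
    by (rule uniform_limit_on_subset[OF p(4)]) (use contractive[OF p(1)] in auto)
  moreover have "B.tends (\<lambda>k. cstar_poly B (p k) (h x)) (h y)"
    using hom_tends[OF p(5)] p(1) by (simp add: hom_cstar_poly)
  moreover have "star B (h x) = h x"
    using hom_star[OF p(1)] p(2) by simp
  ultimately show ?thesis
    unfolding B.has_fun_calc_def using p(3) hom_closed[OF p(1)]
    by (intro conjI exI[of _ p]) simp_all
qed

lemma hom_cut_down:
  assumes "c \<in> carrier A" "star A c = c" "0 \<le> \<epsilon>"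
  shows "h (cut_down A c \<epsilon>) = cut_down B (h c) \<epsilon>"
  using B.cstar_fun_calc_eq[OF hom_has_fun_calc[OF A.has_fun_calc_cut_down[OF assms]]]
  by (simp add: cut_down_def)

lemma hom_cuntz_subequiv:
  assumes closed: "a \<in> carrier A" "b \<in> carrier A" and "cuntz_subequiv A a b"
  shows "cuntz_subequiv B (h a) (h b)"
  unfolding B.cuntz_subequiv_iff[OF hom_closed[OF closed(1)] hom_closed[OF closed(2)]]
proof (intro allI impI)
  fix e :: real assume "e > 0"
  then obtain v where v: "v \<in> carrier A" "cnorm A (a \<ominus>\<^bsub>A\<^esub> (v \<otimes>\<^bsub>A\<^esub> b) \<otimes>\<^bsub>A\<^esub> star A v) < e"
    using assms(3) unfolding A.cuntz_subequiv_iff[OF closed] by blast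
  then have "cnorm B (h a \<ominus>\<^bsub>B\<^esub> (h v \<otimes>\<^bsub>B\<^esub> h b) \<otimes>\<^bsub>B\<^esub> star B (h v)) < e"
    using contractive[of "a \<ominus>\<^bsub>A\<^esub> (v \<otimes>\<^bsub>A\<^esub> b) \<otimes>\<^bsub>A\<^esub> star A v"] closed by simp
  then show "\<exists>v\<in>carrier B. cnorm B (h a \<ominus>\<^bsub>B\<^esub> (v \<otimes>\<^bsub>B\<^esub> h b) \<otimes>\<^bsub>B\<^esub> star B v) < e"
    by (rule bexI) (use v in simp)
qed

lemma hom_positive_elem:
  assumes "positive_elem A a"
  shows "positive_elem B (h a)"
proof -
  obtain b where b: "b \<in> carrier A" "a = star A b \<otimes>\<^bsub>A\<^esub> b"
    using assms unfolding positive_elem_def by blast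
  then have "h a = star B (h b) \<otimes>\<^bsub>B\<^esub> h b"
    by simp
  then show ?thesis
    unfolding positive_elem_def using hom_closed[OF b(1)] by blast
qed

lemma hom_finsum:
  fixes k :: nat
  assumes "\<And>l. l < k \<Longrightarrow> f l \<in> carrier A"
  shows "h (finsum A f {..<k}) = finsum B (\<lambda>l. h (f l)) {..<k}"
  using assms
proof (induction k)
  case (Suc k)
  then have "finsum A f {..<k} \<in> carrier A" "f \<in> {..<k} \<rightarrow> carrier A" "f k \<in> carrier A"
    by (auto intro!: A.finsum_closed)
  with Suc show ?case
    by (simp add: lessThan_Suc Pi_def)
qed simp

lemma hom_positive_matrix:
  assumes "positive_matrix A k X"
  shows "positive_matrix B k (\<lambda>i j. h (X i j))"
proof -
  obtain Y where Y: "\<forall>i<k. \<forall>j<k. Y i j \<in> carrier A"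
    "\<forall>i<k. \<forall>j<k. X i j = finsum A (\<lambda>l. star A (Y l i) \<otimes>\<^bsub>A\<^esub> Y l j) {..<k}"
    using assms unfolding positive_matrix_def by blast
  have "h (X i j) = finsum B (\<lambda>l. star B (h (Y l i)) \<otimes>\<^bsub>B\<^esub> h (Y l j)) {..<k}" if "i < k" "j < k" for i j
  proof -
    have "h (X i j) = finsum B (\<lambda>l. h (star A (Y l i) \<otimes>\<^bsub>A\<^esub> Y l j)) {..<k}"
      using Y that by (simp add: hom_finsum)
    also have "\<dots> = finsum B (\<lambda>l. star B (h (Y l i)) \<otimes>\<^bsub>B\<^esub> h (Y l j)) {..<k}"
      by (rule B.finsum_cong') (use Y that in auto)
    finally show ?thesis .
  qed
  then show ?thesis
    unfolding positive_matrix_def using Y(1) by (intro exI[of _ "\<lambda>i j. h (Y i j)"]) auto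
qed

lemma hom_cpc_map:
  assumes "cpc_map M A f"
  shows "cpc_map M B (\<lambda>x. h (f x))"
proof -
  have lin: "linear_map M A f"
    using assms by (simp add: cpc_map_def completely_positive_def)
  have "linear_map M B (\<lambda>x. h (f x))"
    using linear_mapD[OF lin] by (simp add: linear_map_def)
  moreover have "cnorm B (h (f x)) \<le> cnorm M x" if "x \<in> carrier M" for x
  proof -
    have "cnorm A (f x) \<le> cnorm M x"
      using assms that by (simp add: cpc_map_def)
    then show ?thesis
      using contractive[OF linear_mapD(1)[OF lin that]] by linarith
  qed
  ultimately show ?thesis
    using assms hom_positive_matrix by (simp add: cpc_map_def completely_positive_def)
qed

lemma hom_order_zero:
  assumes "order_zero M A f" "linear_map M A f" "\<And>y. positive_elem M y \<Longrightarrow> y \<in> carrier M"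
  shows "order_zero M B (\<lambda>x. h (f x))"
  unfolding order_zero_def
proof (intro allI impI)
  fix y z assume yz: "positive_elem M y" "positive_elem M z" "y \<otimes>\<^bsub>M\<^esub> z = \<zero>\<^bsub>M\<^esub>"
  then have "f y \<otimes>\<^bsub>A\<^esub> f z = \<zero>\<^bsub>A\<^esub>"
    using assms(1) by (simp add: order_zero_def)
  then have "h (f y \<otimes>\<^bsub>A\<^esub> f z) = \<zero>\<^bsub>B\<^esub>"
    by simp
  then show "h (f y) \<otimes>\<^bsub>B\<^esub> h (f z) = \<zero>\<^bsub>B\<^esub>"
    using linear_mapD(1)[OF assms(2) assms(3)] yz by simp
qed

text \<open>Turns simplicity of \<open>A\<close> into a dichotomy for \<open>J\<close>: its preimage
  is zero, or \<open>J\<close> contains the whole image of \<open>A\<close>.\<close>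

lemma closed_ideal_vimage:
  assumes J: "closed_ideal B J"
  shows "closed_ideal A {x \<in> carrier A. h x \<in> J}"
proof -
  have "closedin A.mtopology {x \<in> carrier A. h x \<in> J}"
    unfolding A.metric_closedin_iff_sequentially_closed
  proof (intro conjI allI impI)
    fix s l assume "range s \<subseteq> {x \<in> carrier A. h x \<in> J} \<and> limitin A.mtopology s l sequentially"
    then have s: "\<And>n. s n \<in> carrier A" "\<And>n. h (s n) \<in> J" and l: "l \<in> carrier A"
      and lim: "\<forall>\<epsilon>>0. \<exists>N. \<forall>n\<ge>N. cdist A (s n) l < \<epsilon>"
      unfolding A.limit_metric_sequentially by blast+
    have "A.tends s l"
      unfolding A.tends_def LIMSEQ_def using s l lim by (simp add: cdist_def)
    then have "h l \<in> J"
      using B.closed_ideal_limit[OF J hom_tends] s by blast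
    then show "l \<in> {x \<in> carrier A. h x \<in> J}"
      using l by simp
  qed auto
  then show ?thesis
    using J unfolding closed_ideal_def by auto
qed

end

section \<open>The unit of the matrix algebra and its image\<close>

lemma abelian_monoid_mat_cstar: "abelian_monoid (mat_cstar n)"
  by (rule abelian_monoidI)
    (auto simp: mat_cstar_def comm_add_mat[of _ n n] intro: assoc_add_mat[of _ n n])

lemma mat_adjoint_one: "mat_adjoint (1\<^sub>m n :: complex mat) = 1\<^sub>m n"
  unfolding mat_adjoint_def by (rule eq_matI) (auto simp: mat_of_rows_index)

text \<open>The instance of complete positivity, at matrix size one, that makes the image of the
  unit positive.\<close>

lemma positive_matrix_mat_one: "positive_matrix (mat_cstar n) 1 (\<lambda>i j. 1\<^sub>m n)"
proof -
  interpret abelian_monoid "mat_cstar n"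
    by (rule abelian_monoid_mat_cstar)
  have "finsum (mat_cstar n) (\<lambda>l. star (mat_cstar n) (1\<^sub>m n) \<otimes>\<^bsub>mat_cstar n\<^esub> 1\<^sub>m n) {..<1::nat} = 1\<^sub>m n"
  proof -
    have "{..<1::nat} = {0}"
      by auto
    moreover have "star (mat_cstar n) (1\<^sub>m n) \<otimes>\<^bsub>mat_cstar n\<^esub> 1\<^sub>m n = 1\<^sub>m n" "1\<^sub>m n \<in> carrier (mat_cstar n)"
      by (simp_all add: mat_cstar_def mat_adjoint_one)
    ultimately show ?thesis
      by simp
  qed
  then show ?thesis
    unfolding positive_matrix_def by (intro exI[of _ "\<lambda>i j. 1\<^sub>m n"]) (simp add: mat_cstar_def)
qed

text \<open>Only an inequality, since the norm is \<open>0\<close> for \<open>n = 0\<close>.\<close>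

lemma mat_op_norm_one: "mat_op_norm n (1\<^sub>m n) \<le> 1"
  unfolding mat_op_norm_def
proof (rule cSUP_least)
  have "vec_l2 (0\<^sub>v n) \<le> 1"
    by (simp add: vec_l2_def L2_set_def)
  then show "{v \<in> carrier_vec n. vec_l2 v \<le> 1} \<noteq> {}"
    using zero_carrier_vec by blast
qed simp

lemma positive_elem_mat_closed: "positive_elem (mat_cstar n) y \<Longrightarrow> y \<in> carrier (mat_cstar n)"
  by (auto simp: positive_elem_def mat_cstar_def mat_adjoint_def)

lemma (in cstar_algebra) cpc_map_mat_one:
  assumes "cpc_map (mat_cstar n) A f"
  shows "positive_elem A (f (1\<^sub>m n))" "cnorm A (f (1\<^sub>m n)) \<le> 1"
proof -
  have "positive_matrix A 1 (\<lambda>i j. f (1\<^sub>m n))"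
    using assms positive_matrix_mat_one unfolding cpc_map_def completely_positive_def by blast
  then obtain Y where "\<forall>i<1::nat. \<forall>j<1::nat. Y i j \<in> carrier A"
    "\<forall>i<1::nat. \<forall>j<1::nat. f (1\<^sub>m n) = finsum A (\<lambda>l. star A (Y l i) \<otimes> Y l j) {..<1}"
    unfolding positive_matrix_def by blast
  then have Y: "Y 0 0 \<in> carrier A"
    "f (1\<^sub>m n) = finsum A (\<lambda>l. star A (Y l 0) \<otimes> Y l 0) {..<1::nat}"
    by blast+
  have "finsum A (\<lambda>l. star A (Y l 0) \<otimes> Y l 0) {..<1::nat} = star A (Y 0 0) \<otimes> Y 0 0"
    using Y(1) by (simp add: lessThan_Suc)
  with Y(2) have "f (1\<^sub>m n) = star A (Y 0 0) \<otimes> Y 0 0"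
    by (rule trans)
  with Y(1) show "positive_elem A (f (1\<^sub>m n))"
    unfolding positive_elem_def by blast
  have "cnorm A (f (1\<^sub>m n)) \<le> cnorm (mat_cstar n) (1\<^sub>m n)"
    using assms unfolding cpc_map_def by (simp add: mat_cstar_def)
  then show "cnorm A (f (1\<^sub>m n)) \<le> 1"
    using mat_op_norm_one[of n] by (simp add: mat_cstar_def)
qed


section \<open>Direct limits\<close>

locale cstar_limit =
  fixes I :: "'i set" and leq :: "'i \<Rightarrow> 'i \<Rightarrow> bool"
    and A :: "'i \<Rightarrow> 'a cstar_alg" and \<phi> :: "'i \<Rightarrow> 'i \<Rightarrow> 'a \<Rightarrow> 'a"
    and B :: "'b cstar_alg" and \<psi> :: "'i \<Rightarrow> 'a \<Rightarrow> 'b"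
  assumes direct_limit: "cstar_direct_limit I leq A \<phi> B \<psi>"
begin

lemma system: "cstar_directed_system I leq A \<phi>"
  using direct_limit by (simp add: cstar_direct_limit_def)

sublocale B: cstar_algebra B
  using direct_limit by (simp add: cstar_direct_limit_def)

lemma index_nonempty: "I \<noteq> {}"
  and index_directed: "i \<in> I \<Longrightarrow> j \<in> I \<Longrightarrow> \<exists>k\<in>I. leq i k \<and> leq j k"
  and index_refl: "i \<in> I \<Longrightarrow> leq i i"
  and cstar_algebra_system: "i \<in> I \<Longrightarrow> cstar_algebra (A i)"
  and connecting_star_hom: "i \<in> I \<Longrightarrow> j \<in> I \<Longrightarrow> leq i j \<Longrightarrow> star_hom (A i) (A j) (\<phi> i j)"
  and connecting_id: "i \<in> I \<Longrightarrow> x \<in> carrier (A i) \<Longrightarrow> \<phi> i i x = x"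
  using system unfolding cstar_directed_system_def by blast+

lemma connecting_closed:
  "i \<in> I \<Longrightarrow> j \<in> I \<Longrightarrow> leq i j \<Longrightarrow> x \<in> carrier (A i) \<Longrightarrow> \<phi> i j x \<in> carrier (A j)"
  using linear_mapD(1)[OF star_homD(1)[OF connecting_star_hom]] .

lemma limit_connecting:
  "i \<in> I \<Longrightarrow> j \<in> I \<Longrightarrow> leq i j \<Longrightarrow> x \<in> carrier (A i) \<Longrightarrow> \<psi> j (\<phi> i j x) = \<psi> i x"
  using direct_limit by (simp add: cstar_direct_limit_def)

text \<open>The infimum giving the limit norm is at most its term at \<open>j = i\<close>, where the
  connecting map is the identity.\<close>

lemma contractive_star_hom_limit:
  assumes i: "i \<in> I"
  shows "contractive_star_hom (A i) B (\<psi> i)"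
proof -
  interpret Ai: cstar_algebra "A i"
    using i by (rule cstar_algebra_system)
  show ?thesis
  proof (unfold_locales)
    show "star_hom (A i) B (\<psi> i)"
      using direct_limit i by (simp add: cstar_direct_limit_def)
    fix x assume x: "x \<in> carrier (A i)"
    have "bdd_below ((\<lambda>j. cnorm (A j) (\<phi> i j x)) ` {j \<in> I. leq i j})"
    proof (rule bdd_belowI2)
      fix j assume "j \<in> {j \<in> I. leq i j}"
      then show "0 \<le> cnorm (A j) (\<phi> i j x)"
        using connecting_closed[OF i _ _ x] cstar_algebra_system[of j]
        by (auto intro: pre_cstar_algebra.cnorm_nonneg cstar_algebra.axioms(1))
    qed
    then have "(INF j\<in>{j \<in> I. leq i j}. cnorm (A j) (\<phi> i j x)) \<le> cnorm (A i) (\<phi> i i x)"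
      by (rule cINF_lower) (use i index_refl in auto)
    then show "cnorm B (\<psi> i x) \<le> cnorm (A i) x"
      using direct_limit i x connecting_id by (simp add: cstar_direct_limit_def)
  qed
qed

lemma limit_dense:
  assumes "y \<in> carrier B" "\<delta> > 0"
  obtains i x where "i \<in> I" "x \<in> carrier (A i)" "cnorm B (y \<ominus>\<^bsub>B\<^esub> \<psi> i x) < \<delta>"
proof -
  have "y \<in> B.mtopology closure_of (\<Union>i\<in>I. \<psi> i ` carrier (A i))"
    using direct_limit assms(1) by (simp add: cstar_direct_limit_def)
  then obtain z where "z \<in> (\<Union>i\<in>I. \<psi> i ` carrier (A i))" "z \<in> B.mball y \<delta>"
    unfolding B.metric_closure_of using assms(2) by blast
  then show ?thesis
    using that by (auto simp: B.in_mball cdist_def)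
qed

text \<open>Directedness moves finitely many approximants into one algebra. As
  \<open>\<psi> k\<close> after \<open>\<phi> i k\<close> is \<open>\<psi> i\<close>, their images
  in the limit, and so the errors, do not change.\<close>

lemma limit_dense_finite:
  assumes "finite F" "F \<subseteq> carrier B" "\<delta> > 0"
  obtains i where "i \<in> I" "\<And>y. y \<in> F \<Longrightarrow> \<exists>x\<in>carrier (A i). cnorm B (y \<ominus>\<^bsub>B\<^esub> \<psi> i x) < \<delta>"
proof -
  have "\<exists>i\<in>I. \<forall>y\<in>F. \<exists>x\<in>carrier (A i). cnorm B (y \<ominus>\<^bsub>B\<^esub> \<psi> i x) < \<delta>"
    using assms(1,2)
  proof (induction F)
    case empty
    then show ?case
      using index_nonempty by auto
  next
    case (insert z F)
    then obtain i where i: "i \<in> I" "\<forall>y\<in>F. \<exists>x\<in>carrier (A i). cnorm B (y \<ominus>\<^bsub>B\<^esub> \<psi> i x) < \<delta>"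
      by auto
    obtain j x where j: "j \<in> I" "x \<in> carrier (A j)" "cnorm B (z \<ominus>\<^bsub>B\<^esub> \<psi> j x) < \<delta>"
      using limit_dense[of z \<delta>] insert.prems assms(3) by auto
    obtain k where k: "k \<in> I" "leq i k" "leq j k"
      using index_directed[OF i(1) j(1)] by blast
    have "\<exists>x\<in>carrier (A k). cnorm B (y \<ominus>\<^bsub>B\<^esub> \<psi> k x) < \<delta>" if y: "y \<in> insert z F" for y
    proof (cases "y = z")
      case True
      then show ?thesis
        using j k connecting_closed[of j k x] limit_connecting[of j k x]
        by (intro bexI[of _ "\<phi> j k x"]) auto
    next
      case False
      then obtain x' where "x' \<in> carrier (A i)" "cnorm B (y \<ominus>\<^bsub>B\<^esub> \<psi> i x') < \<delta>"
        using i(2) y by blast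
      then show ?thesis
        using i(1) k connecting_closed[of i k x'] limit_connecting[of i k x']
        by (intro bexI[of _ "\<phi> i k x'"]) auto
    qed
    then show ?case
      using k(1) by blast
  qed
  then show ?thesis
    using that by blast
qed

lemma closed_ideal_limit_nonzero:
  assumes J: "closed_ideal B J" "J \<noteq> {\<zero>\<^bsub>B\<^esub>}"
  obtains i m where "i \<in> I" "m \<in> carrier (A i)" "\<psi> i m \<in> J" "\<psi> i m \<noteq> \<zero>\<^bsub>B\<^esub>"
proof -
  have sub: "J \<subseteq> carrier B" "\<zero>\<^bsub>B\<^esub> \<in> J"
    using J(1) by (auto simp: closed_ideal_def)
  then obtain b where b: "b \<in> J" "b \<noteq> \<zero>\<^bsub>B\<^esub>" "b \<in> carrier B"
    using J(2) by auto
  define d where "d = star B b \<otimes>\<^bsub>B\<^esub> b"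
  have d: "d \<in> carrier B" "d \<in> J"
    using b J(1) B.star_closed[OF b(3)] by (auto simp: d_def closed_ideal_def)
  have pos: "cnorm B d > 0"
    using b B.cstar_identity[OF b(3)] B.cnorm_eq_zero[OF b(3)] by (simp add: d_def)
  then obtain \<delta> where \<delta>: "\<delta> > 0" "\<And>y. y \<in> carrier B \<Longrightarrow> cnorm B (b \<ominus>\<^bsub>B\<^esub> y) < \<delta> \<Longrightarrow>
      cnorm B (d \<ominus>\<^bsub>B\<^esub> star B y \<otimes>\<^bsub>B\<^esub> y) \<le> cnorm B d / 8"
    unfolding d_def using B.cnorm_star_mult_diff[OF b(3), of "cnorm B (star B b \<otimes>\<^bsub>B\<^esub> b) / 8"] by auto
  obtain i b' where i: "i \<in> I" "b' \<in> carrier (A i)" "cnorm B (b \<ominus>\<^bsub>B\<^esub> \<psi> i b') < \<delta>"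
    using limit_dense[OF b(3) \<delta>(1)] .
  interpret contractive_star_hom "A i" B "\<psi> i"
    using i(1) by (rule contractive_star_hom_limit)
  define c where "c = star (A i) b' \<otimes>\<^bsub>A i\<^esub> b'"
  have c: "positive_elem (A i) c"
    using i(2) by (auto simp: c_def positive_elem_def)
  note cc = A.positive_elem_closed[OF c] A.star_positive_elem[OF c]
  have close: "cnorm B (d \<ominus>\<^bsub>B\<^esub> \<psi> i c) \<le> cnorm B d / 8"
    using \<delta>(2)[of "\<psi> i b'"] i by (simp add: c_def)
  \<comment> \<open>A quarter of the norm of \<open>d\<close> exceeds the error of an eighth, which
    puts the image below \<open>d\<close> and hence into \<open>J\<close>; and
    \<open>1 / 8 + 1 / 4 < 1\<close> keeps the image nonzero.\<close>
  let ?m = "cut_down (A i) c (cnorm B d / 4)"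
  have m: "\<psi> i ?m = cut_down B (\<psi> i c) (cnorm B d / 4)"
    using hom_cut_down[OF cc] pos by simp
  have closed: "?m \<in> carrier (A i)"
    using A.cut_down_closed[OF cc] pos by simp
  have "cuntz_subequiv B (\<psi> i ?m) d"
    unfolding m
  proof (rule B.cuntz_subequiv_cut_down)
    show "positive_elem B d"
      using b(3) by (auto simp: d_def positive_elem_def)
    show "star B (\<psi> i c) = \<psi> i c"
      using cc by (simp flip: hom_star)
    show "cnorm B (\<psi> i c \<ominus>\<^bsub>B\<^esub> d) \<le> cnorm B d / 8"
      using close B.cnorm_minus_commute[OF d(1), of "\<psi> i c"] cc by simp
  qed (use cc pos in auto)
  then have "\<psi> i ?m \<in> J"
    using B.closed_ideal_cuntz[OF J(1) d(2)] closed by simp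
  moreover have "\<psi> i ?m \<noteq> \<zero>\<^bsub>B\<^esub>"
    unfolding m using B.cut_down_nonzero[OF hom_positive_elem[OF c] d(1) close] pos by simp
  ultimately show ?thesis
    using that[OF i(1) closed] by blast
qed

lemma simple_limit:
  assumes simple: "\<And>i. i \<in> I \<Longrightarrow> simple_cstar (A i)"
  shows "simple_cstar B"
  unfolding simple_cstar_def
proof (intro allI impI disjCI)
  fix J assume J: "closed_ideal B J" "J \<noteq> carrier B"
  show "J = {\<zero>\<^bsub>B\<^esub>}"
  proof (rule ccontr)
    assume "J \<noteq> {\<zero>\<^bsub>B\<^esub>}"
    then obtain i m where i: "i \<in> I" "m \<in> carrier (A i)" "\<psi> i m \<in> J" "\<psi> i m \<noteq> \<zero>\<^bsub>B\<^esub>"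
      using closed_ideal_limit_nonzero[OF J(1)] by blast
    have *: "\<psi> j x \<in> J" if j: "j \<in> I" "leq i j" "x \<in> carrier (A j)" for j x
    proof -
      interpret contractive_star_hom "A j" B "\<psi> j"
        using j(1) by (rule contractive_star_hom_limit)
      let ?K = "{x \<in> carrier (A j). \<psi> j x \<in> J}"
      \<comment> \<open>Here it matters that \<open>\<psi> i m\<close>, not merely \<open>m\<close>,
        is nonzero: \<open>\<psi> j\<close> sends \<open>\<phi> i j m\<close> to it, so the preimage
        of \<open>J\<close> is not zero.\<close>
      have "\<phi> i j m \<in> ?K" "\<psi> j (\<phi> i j m) \<noteq> \<zero>\<^bsub>B\<^esub>"
        using i j connecting_closed limit_connecting by auto
      then have "?K \<noteq> {\<zero>\<^bsub>A j\<^esub>}"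
        using hom_zero by (metis singletonD)
      then have "?K = carrier (A j)"
        using closed_ideal_vimage[OF J(1)] simple[OF j(1)] unfolding simple_cstar_def by blast
      then show ?thesis
        using j(3) by blast
    qed
    have "\<psi> l x \<in> J" if l: "l \<in> I" "x \<in> carrier (A l)" for l x
    proof -
      \<comment> \<open>The index \<open>l\<close> need not lie above \<open>i\<close>, but a common
        upper bound does.\<close>
      obtain j where j: "j \<in> I" "leq i j" "leq l j"
        using index_directed[OF i(1) l(1)] by blast
      then show ?thesis
        using *[OF j(1,2) connecting_closed[OF l(1) j(1,3) l(2)]] limit_connecting[OF l(1) j(1,3) l(2)]
        by simp
    qed
    then have "(\<Union>i\<in>I. \<psi> i ` carrier (A i)) \<subseteq> J"
      by blast
    moreover have "closedin B.mtopology J"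
      using J(1) by (simp add: closed_ideal_def)
    ultimately have "B.mtopology closure_of (\<Union>i\<in>I. \<psi> i ` carrier (A i)) \<subseteq> J"
      by (rule closure_of_minimal)
    moreover have "J \<subseteq> carrier B"
      using J(1) by (simp add: closed_ideal_def)
    ultimately show False
      using J(2) direct_limit by (simp add: cstar_direct_limit_def)
  qed
qed

text \<open>A limit isomorphic to \<open>\<complex>\<close> would contain some \<open>A i\<close>, which would then be isomorphic to \<open>\<complex>\<close>.\<close>

lemma not_complex_limit:
  assumes simple: "\<And>i. i \<in> I \<Longrightarrow> simple_cstar (A i)"
    and not_complex: "\<And>i. i \<in> I \<Longrightarrow> \<not> star_isomorphic (A i) complex_cstar"
  shows "\<not> star_isomorphic B complex_cstar"
proof
  assume "star_isomorphic B complex_cstar"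
  then obtain f where f: "star_hom B complex_cstar f" "bij_betw f (carrier B) UNIV"
    by (auto simp: star_isomorphic_def complex_cstar_def)
  obtain b where b: "b \<in> carrier B" "b \<noteq> \<zero>\<^bsub>B\<^esub>"
  proof -
    obtain b where b: "b \<in> carrier B" "f b \<noteq> f \<zero>\<^bsub>B\<^esub>"
      using f(2) by (metis UNIV_I bij_betw_imp_surj_on imageE zero_neq_one)
    then show ?thesis
      using that by blast
  qed
  then have "cnorm B b > 0"
    using B.cnorm_eq_zero[of b] B.cnorm_nonneg[of b] by linarith
  \<comment> \<open>An error below the norm of \<open>b\<close> prevents \<open>\<psi> i x\<close>
    from vanishing.\<close>
  then obtain i x where i: "i \<in> I" "x \<in> carrier (A i)" "cnorm B (b \<ominus>\<^bsub>B\<^esub> \<psi> i x) < cnorm B b"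
    using limit_dense[OF b(1)] by blast
  interpret contractive_star_hom "A i" B "\<psi> i"
    using i(1) by (rule contractive_star_hom_limit)
  have x: "\<psi> i x \<noteq> \<zero>\<^bsub>B\<^esub>"
    using i(3) b by (auto simp: B.minus_eq_scale)
  \<comment> \<open>The kernel of \<open>\<psi> i\<close>, a closed ideal that misses
    \<open>x\<close>; simplicity makes it trivial and \<open>\<psi> i\<close> injective.\<close>
  let ?K = "{x \<in> carrier (A i). \<psi> i x \<in> {\<zero>\<^bsub>B\<^esub>}}"
  have "?K \<noteq> carrier (A i)"
    using x i(2) by blast
  then have K: "?K = {\<zero>\<^bsub>A i\<^esub>}"
    using simple[OF i(1)] closed_ideal_vimage[OF B.closed_ideal_zero] unfolding simple_cstar_def by blast
  have inj: "inj_on (\<psi> i) (carrier (A i))"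
  proof (rule inj_onI)
    fix u v assume uv: "u \<in> carrier (A i)" "v \<in> carrier (A i)" "\<psi> i u = \<psi> i v"
    then have "u \<ominus>\<^bsub>A i\<^esub> v \<in> ?K"
      by simp
    then have "u \<ominus>\<^bsub>A i\<^esub> v = \<zero>\<^bsub>A i\<^esub>"
      unfolding K by simp
    then show "u = v"
      using uv by simp
  qed
  define F where "F = f \<circ> \<psi> i"
  have F: "star_hom (A i) complex_cstar F"
    using f(1) by (auto simp: star_hom_def linear_map_def F_def complex_cstar_def)
  have "inj_on F (carrier (A i))"
    unfolding F_def
    by (rule comp_inj_on[OF inj]) (use f(2) in \<open>auto simp: bij_betw_def intro: inj_on_subset\<close>)
  moreover have "F ` carrier (A i) = UNIV"
  proof -
    \<comment> \<open>The target is one-dimensional, so scaling a single nonzero value gives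
      surjectivity.\<close>
    have "F x \<noteq> F \<zero>\<^bsub>A i\<^esub>"
      using \<open>inj_on F (carrier (A i))\<close> i(2) x by (metis A.zero_closed hom_zero inj_onD)
    moreover have F_scale: "F (c \<odot>\<^bsub>A i\<^esub> y) = c * F y" if "y \<in> carrier (A i)" for c y
      using linear_mapD(3)[OF star_homD(1)[OF F] that] by (simp add: complex_cstar_def)
    moreover have "F \<zero>\<^bsub>A i\<^esub> = 0"
      using F_scale[of "\<zero>\<^bsub>A i\<^esub>" 0] by simp
    ultimately have "F ((w / F x) \<odot>\<^bsub>A i\<^esub> x) = w" for w
      using i(2) by simp
    then show ?thesis
      using i(2) by (metis A.scale_closed UNIV_eq_I image_eqI)
  qed
  ultimately have "star_isomorphic (A i) complex_cstar"
    using F by (auto simp: star_isomorphic_def bij_betw_def complex_cstar_def)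
  then show False
    using not_complex[OF i(1)] by blast
qed

end

section \<open>Perturbation of the defect and of commutators\<close>

lemma (in cstar_algebra) cnorm_defect_diff:
  assumes x: "x \<in> carrier A" and y: "y \<in> carrier A" and h: "h \<in> carrier A" "cnorm A h \<le> 1"
    and \<delta>: "cnorm A (x \<ominus> y) \<le> \<delta>" "\<delta> \<le> 1"
  shows "cnorm A ((x \<otimes> x \<ominus> (x \<otimes> h) \<otimes> x) \<ominus> (y \<otimes> y \<ominus> (y \<otimes> h) \<otimes> y)) \<le> 2 * (2 * cnorm A x + 1) * \<delta>"
proof -
  have y_le: "cnorm A y \<le> cnorm A x + 1"
    using cnorm_le_diff[OF y x] cnorm_minus_commute[OF x y] \<delta> by linarith
  have \<delta>0: "0 \<le> \<delta>"
    using \<delta>(1) cnorm_nonneg[OF minus_closed[OF x y]] by linarith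
  \<comment> \<open>One estimate for both products \<open>x x\<close> and \<open>x h x\<close>:
    since \<open>h\<close> is a contraction, the left factors \<open>x\<close> and
    \<open>x h\<close> have norm at most \<open>||x||\<close> and move by at most
    \<open>\<delta>\<close>.\<close>
  have sum_le: "p * cnorm A (x \<ominus> y) + q * cnorm A y \<le> (2 * cnorm A x + 1) * \<delta>"
    if "p \<le> cnorm A x" "q \<le> \<delta>" "0 \<le> q" for p q
  proof -
    have "p * cnorm A (x \<ominus> y) \<le> cnorm A x * \<delta>"
      using that \<delta>(1) x y by (intro mult_mono) auto
    moreover have "q * cnorm A y \<le> \<delta> * (cnorm A x + 1)"
      using that y_le y \<delta>0 by (intro mult_mono) auto
    ultimately show ?thesis
      by (simp add: algebra_simps)
  qed
  have 1: "cnorm A (x \<otimes> x \<ominus> y \<otimes> y) \<le> (2 * cnorm A x + 1) * \<delta>"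
    using cnorm_diff_mult[OF x x y y] sum_le[of "cnorm A x" "cnorm A (x \<ominus> y)"] \<delta>(1) x y by simp
  have xh: "cnorm A (z \<otimes> h) \<le> cnorm A z" if "z \<in> carrier A" for z
    using cnorm_mult[OF that h(1)] mult_left_mono[OF h(2), of "cnorm A z"] that by simp
  have "x \<otimes> h \<ominus> y \<otimes> h = (x \<ominus> y) \<otimes> h"
    using x y h by (simp add: cstar_simps)
  then have "cnorm A (x \<otimes> h \<ominus> y \<otimes> h) \<le> \<delta>"
    using xh[of "x \<ominus> y"] x y \<delta>(1) by simp
  then have 2: "cnorm A ((x \<otimes> h) \<otimes> x \<ominus> (y \<otimes> h) \<otimes> y) \<le> (2 * cnorm A x + 1) * \<delta>"
    using cnorm_diff_mult[of "x \<otimes> h" x "y \<otimes> h" y] x y h(1) xh[OF x]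
      sum_le[of "cnorm A (x \<otimes> h)" "cnorm A (x \<otimes> h \<ominus> y \<otimes> h)"] by simp
  have "(x \<otimes> x \<ominus> (x \<otimes> h) \<otimes> x) \<ominus> (y \<otimes> y \<ominus> (y \<otimes> h) \<otimes> y)
      = (x \<otimes> x \<ominus> y \<otimes> y) \<ominus> ((x \<otimes> h) \<otimes> x \<ominus> (y \<otimes> h) \<otimes> y)"
    using x y h by (simp add: cstar_simps)
  then have "cnorm A ((x \<otimes> x \<ominus> (x \<otimes> h) \<otimes> x) \<ominus> (y \<otimes> y \<ominus> (y \<otimes> h) \<otimes> y))
      \<le> cnorm A (x \<otimes> x \<ominus> y \<otimes> y) + cnorm A ((x \<otimes> h) \<otimes> x \<ominus> (y \<otimes> h) \<otimes> y)"
    using cnorm_minus_le[of "x \<otimes> x \<ominus> y \<otimes> y" "(x \<otimes> h) \<otimes> x \<ominus> (y \<otimes> h) \<otimes> y"] x y h(1) by simp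
  also have "\<dots> \<le> (2 * cnorm A x + 1) * \<delta> + (2 * cnorm A x + 1) * \<delta>"
    using 1 2 by (rule add_mono)
  also have "\<dots> = 2 * (2 * cnorm A x + 1) * \<delta>"
    by simp
  finally show ?thesis .
qed

text \<open>Replacing \<open>b\<close> by \<open>b'\<close> on either side of the contraction
  \<open>p\<close> costs their distance once each.\<close>

lemma (in cstar_algebra) cnorm_commutator_diff:
  assumes p: "p \<in> carrier A" "cnorm A p \<le> 1" and b: "b \<in> carrier A" "b' \<in> carrier A"
  shows "cnorm A (p \<otimes> b \<ominus> b \<otimes> p) \<le> cnorm A (p \<otimes> b' \<ominus> b' \<otimes> p) + 2 * cnorm A (b \<ominus> b')"
proof -
  have "p \<otimes> b \<ominus> p \<otimes> b' = p \<otimes> (b \<ominus> b')" "b' \<otimes> p \<ominus> b \<otimes> p = (b' \<ominus> b) \<otimes> p"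
    using p(1) b by (simp_all add: minus_distribs)
  moreover have "cnorm A (p \<otimes> (b \<ominus> b')) \<le> cnorm A (b \<ominus> b')" "cnorm A ((b' \<ominus> b) \<otimes> p) \<le> cnorm A (b \<ominus> b')"
    using cnorm_mult[of p "b \<ominus> b'"] cnorm_mult[of "b' \<ominus> b" p] p b cnorm_minus_commute[OF b]
      mult_right_mono[OF p(2), of "cnorm A (b \<ominus> b')"] mult_left_mono[OF p(2), of "cnorm A (b \<ominus> b')"]
    by simp_all
  moreover have "cnorm A (p \<otimes> b \<ominus> b \<otimes> p) \<le> cnorm A (p \<otimes> b \<ominus> p \<otimes> b')
      + (cnorm A (p \<otimes> b' \<ominus> b' \<otimes> p) + cnorm A (b' \<otimes> p \<ominus> b \<otimes> p))"
    using cnorm_diff_triangle[of "p \<otimes> b" "p \<otimes> b'" "b \<otimes> p"]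
      cnorm_diff_triangle[of "p \<otimes> b'" "b' \<otimes> p" "b \<otimes> p"] p(1) b by simp
  ultimately show ?thesis
    by simp
qed

context cstar_limit
begin

text \<open>With \<open>y\<close> the defect of \<open>x\<close> in the limit and \<open>d\<close>
  that of \<open>x'\<close> in \<open>A i\<close>, the comparison runs from the
  \<open>\<epsilon>\<close>-cut-down of \<open>y\<close> through the images of the
  \<open>\<epsilon> / 4\<close>-cut-down of \<open>d\<close> and of \<open>a'\<close> to
  \<open>a\<close>. The middle relation comes from \<open>A i\<close>, the outer two from
  \<open>cuntz_subequiv_cut_down\<close>.\<close>

lemma tracially_Z_absorbing_limit:
  assumes simple: "\<And>i. i \<in> I \<Longrightarrow> simple_cstar (A i)"
    and absorbing: "\<And>i. i \<in> I \<Longrightarrow> tracially_Z_absorbing (A i)"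
  shows "tracially_Z_absorbing B"
  unfolding tracially_Z_absorbing_def
proof (intro conjI allI impI)
  show "\<not> star_isomorphic B complex_cstar"
    using absorbing simple by (intro not_complex_limit) (auto simp: tracially_Z_absorbing_def)
next
  fix x a F and \<epsilon> :: real and n :: nat
  assume x: "positive_elem B x" and a: "positive_elem B a" "a \<noteq> \<zero>\<^bsub>B\<^esub>"
    and F: "finite F" "F \<subseteq> carrier B" and \<epsilon>: "\<epsilon> > 0" and n: "n \<ge> 1"
  note xc = B.positive_elem_closed[OF x] B.star_positive_elem[OF x]
  note ac = B.positive_elem_closed[OF a(1)]
  have a_pos: "cnorm B a > 0"
    using a(2) B.cnorm_eq_zero[OF ac] B.cnorm_nonneg[OF ac] by linarith
  have pos: "2 * cnorm B x + 1 > 0"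
    using B.cnorm_nonneg[OF xc(1)] by linarith
  obtain bx where bx: "bx \<in> carrier B" "x = star B bx \<otimes>\<^bsub>B\<^esub> bx"
    using x by (auto simp: positive_elem_def)
  obtain ba where ba: "ba \<in> carrier B" "a = star B ba \<otimes>\<^bsub>B\<^esub> ba"
    using a(1) by (auto simp: positive_elem_def)
  \<comment> \<open>Chosen so that \<open>cnorm_defect_diff\<close> moves the defect by at most
    \<open>\<epsilon> / 4\<close>; that estimate also requires a distance of at most
    \<open>1\<close>.\<close>
  define \<delta>x where "\<delta>x = min 1 (\<epsilon> / (8 * (2 * cnorm B x + 1)))"
  have \<delta>x: "\<delta>x > 0" "\<delta>x \<le> 1" "2 * (2 * cnorm B x + 1) * \<delta>x \<le> \<epsilon> / 4"
  proof -
    have "2 * (2 * cnorm B x + 1) * \<delta>x \<le> 2 * (2 * cnorm B x + 1) * (\<epsilon> / (8 * (2 * cnorm B x + 1)))"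
      using pos by (intro mult_left_mono) (auto simp: \<delta>x_def)
    also have "\<dots> = \<epsilon> / 4"
      using pos by (simp add: field_simps)
    finally show "2 * (2 * cnorm B x + 1) * \<delta>x \<le> \<epsilon> / 4" .
  qed (use \<epsilon> pos in \<open>auto simp: \<delta>x_def\<close>)
  obtain \<delta>1 where \<delta>1: "\<delta>1 > 0" "\<And>y. y \<in> carrier B \<Longrightarrow> cnorm B (bx \<ominus>\<^bsub>B\<^esub> y) < \<delta>1 \<Longrightarrow>
      cnorm B (x \<ominus>\<^bsub>B\<^esub> star B y \<otimes>\<^bsub>B\<^esub> y) \<le> \<delta>x"
    using B.cnorm_star_mult_diff[OF bx(1) \<delta>x(1)] bx(2) by blast
  obtain \<delta>2 where \<delta>2: "\<delta>2 > 0" "\<And>y. y \<in> carrier B \<Longrightarrow> cnorm B (ba \<ominus>\<^bsub>B\<^esub> y) < \<delta>2 \<Longrightarrow>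
      cnorm B (a \<ominus>\<^bsub>B\<^esub> star B y \<otimes>\<^bsub>B\<^esub> y) \<le> cnorm B a / 8"
    using B.cnorm_star_mult_diff[OF ba(1), of "cnorm B a / 8"] ba(2) a_pos by auto
  \<comment> \<open>The share \<open>\<epsilon> / 4\<close> serves the commutators:
    \<open>\<epsilon> / 4\<close> inside \<open>A i\<close> plus twice the approximation error stays
    below \<open>\<epsilon>\<close>. The other two control the factors \<open>bx\<close> and
    \<open>ba\<close>.\<close>
  define \<delta> where "\<delta> = min (\<epsilon> / 4) (min \<delta>1 \<delta>2)"
  have \<delta>: "\<delta> > 0" "\<delta> \<le> \<epsilon> / 4" "\<delta> \<le> \<delta>1" "\<delta> \<le> \<delta>2"
    using \<delta>1(1) \<delta>2(1) \<epsilon> by (auto simp: \<delta>_def)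
  obtain i where i: "i \<in> I" and
    dense: "\<And>y. y \<in> {bx, ba} \<union> F \<Longrightarrow> \<exists>x\<in>carrier (A i). cnorm B (y \<ominus>\<^bsub>B\<^esub> \<psi> i x) < \<delta>"
    using limit_dense_finite[of "{bx, ba} \<union> F" \<delta>] F bx(1) ba(1) \<delta>(1) by auto
  then obtain g where g: "\<And>y. y \<in> {bx, ba} \<union> F \<Longrightarrow> g y \<in> carrier (A i)"
    "\<And>y. y \<in> {bx, ba} \<union> F \<Longrightarrow> cnorm B (y \<ominus>\<^bsub>B\<^esub> \<psi> i (g y)) < \<delta>"
    by metis
  interpret contractive_star_hom "A i" B "\<psi> i"
    using i by (rule contractive_star_hom_limit)
  define x' where "x' = star (A i) (g bx) \<otimes>\<^bsub>A i\<^esub> g bx"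
  define c where "c = star (A i) (g ba) \<otimes>\<^bsub>A i\<^esub> g ba"
  have x': "positive_elem (A i) x'" and c: "positive_elem (A i) c"
    using g(1) by (auto simp: x'_def c_def positive_elem_def)
  note x'c = A.positive_elem_closed[OF x'] A.star_positive_elem[OF x']
  note cc = A.positive_elem_closed[OF c] A.star_positive_elem[OF c]
  have x'_close: "cnorm B (x \<ominus>\<^bsub>B\<^esub> \<psi> i x') \<le> \<delta>x"
    using \<delta>1(2)[of "\<psi> i (g bx)"] g[of bx] \<delta>(3) by (simp add: x'_def)
  have c_close: "cnorm B (a \<ominus>\<^bsub>B\<^esub> \<psi> i c) \<le> cnorm B a / 8"
    using \<delta>2(2)[of "\<psi> i (g ba)"] g[of ba] \<delta>(4) by (simp add: c_def)
  \<comment> \<open>As for ideals, the cut at a quarter of the norm exceeds the error of an eighth,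
    so the image lies below \<open>a\<close>, and it leaves the nonzero element that the hypothesis
    on \<open>A i\<close> demands.\<close>
  define a' where "a' = cut_down (A i) c (cnorm B a / 4)"
  have a': "positive_elem (A i) a'" "\<psi> i a' = cut_down B (\<psi> i c) (cnorm B a / 4)"
    unfolding a'_def using A.positive_elem_cut_down[OF cc] hom_cut_down[OF cc] a_pos by simp_all
  note a'c = A.positive_elem_closed[OF a'(1)]
  have "\<psi> i a' \<noteq> \<zero>\<^bsub>B\<^esub>"
    unfolding a'(2) using B.cut_down_nonzero[OF hom_positive_elem[OF c] ac c_close] a_pos by simp
  then have "a' \<noteq> \<zero>\<^bsub>A i\<^esub>"
    using hom_zero by metis
  moreover have "g ` F \<subseteq> carrier (A i)" "finite (g ` F)" "\<epsilon> / 4 > 0"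
    using g(1) F(1) \<epsilon> by auto
  ultimately obtain f where f: "cpc_map (mat_cstar n) (A i) f" "order_zero (mat_cstar n) (A i) f"
    "cuntz_subequiv (A i) (cut_down (A i)
       (x' \<otimes>\<^bsub>A i\<^esub> x' \<ominus>\<^bsub>A i\<^esub> (x' \<otimes>\<^bsub>A i\<^esub> f (1\<^sub>m n)) \<otimes>\<^bsub>A i\<^esub> x') (\<epsilon> / 4)) a'"
    "\<forall>z\<in>carrier_mat n n. mat_op_norm n z \<le> 1 \<longrightarrow>
       (\<forall>b\<in>g ` F. cnorm (A i) (f z \<otimes>\<^bsub>A i\<^esub> b \<ominus>\<^bsub>A i\<^esub> b \<otimes>\<^bsub>A i\<^esub> f z) < \<epsilon> / 4)"
    using absorbing[OF i, unfolded tracially_Z_absorbing_def, THEN conjunct2, rule_format,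
        OF x' a'(1) _ _ _ _ n, of "g ` F" "\<epsilon> / 4"] by metis
  have lin: "linear_map (mat_cstar n) (A i) f"
    using f(1) by (simp add: cpc_map_def completely_positive_def)
  define h where "h = f (1\<^sub>m n)"
  have h: "positive_elem (A i) h" "cnorm (A i) h \<le> 1"
    unfolding h_def using A.cpc_map_mat_one[OF f(1)] by auto
  note hc = A.positive_elem_closed[OF h(1)] A.star_positive_elem[OF h(1)]
  define d where "d = x' \<otimes>\<^bsub>A i\<^esub> x' \<ominus>\<^bsub>A i\<^esub> (x' \<otimes>\<^bsub>A i\<^esub> h) \<otimes>\<^bsub>A i\<^esub> x'"
  define y where "y = x \<otimes>\<^bsub>B\<^esub> x \<ominus>\<^bsub>B\<^esub> (x \<otimes>\<^bsub>B\<^esub> \<psi> i h) \<otimes>\<^bsub>B\<^esub> x"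
  \<comment> \<open>Positivity ensures that the cut-down moves the image of \<open>d\<close> by at
    most \<open>\<epsilon> / 4\<close>.\<close>
  have d: "positive_elem (A i) d"
    unfolding d_def using x'c h by (rule A.positive_elem_compress)
  note dc = A.positive_elem_closed[OF d] A.star_positive_elem[OF d]
  define e where "e = cut_down (A i) d (\<epsilon> / 4)"
  have e: "\<psi> i e = cut_down B (\<psi> i d) (\<epsilon> / 4)" "positive_elem (A i) e"
    unfolding e_def using hom_cut_down[OF dc] A.positive_elem_cut_down[OF dc] \<epsilon> by simp_all
  note ec = A.positive_elem_closed[OF e(2)]
  have "star B (\<psi> i h) = \<psi> i h"
    using hom_star[OF hc(1)] hc(2) by simp
  then have yc: "y \<in> carrier B" "star B y = y"
    using xc hc(1) by (simp_all add: y_def B.minus_distribs(3) B.star_mult B.mult_assoc)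
  have "cuntz_subequiv B (cut_down B y \<epsilon>) (\<psi> i e)"
  proof (rule B.cuntz_subequiv_cut_down[OF yc hom_positive_elem[OF e(2)]])
    have "\<psi> i d = \<psi> i x' \<otimes>\<^bsub>B\<^esub> \<psi> i x' \<ominus>\<^bsub>B\<^esub> (\<psi> i x' \<otimes>\<^bsub>B\<^esub> \<psi> i h) \<otimes>\<^bsub>B\<^esub> \<psi> i x'"
      using x'c hc by (simp add: d_def)
    then have "cnorm B (y \<ominus>\<^bsub>B\<^esub> \<psi> i d) \<le> 2 * (2 * cnorm B x + 1) * \<delta>x"
      unfolding y_def using B.cnorm_defect_diff[OF xc(1) _ _ _ x'_close \<delta>x(2), of "\<psi> i h"]
        x'c hc h(2) contractive[OF hc(1)] by simp
    then have "cnorm B (y \<ominus>\<^bsub>B\<^esub> \<psi> i d) \<le> \<epsilon> / 4"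
      using \<delta>x(3) by linarith
    moreover have "cnorm B (\<psi> i d \<ominus>\<^bsub>B\<^esub> \<psi> i e) \<le> \<epsilon> / 4"
      unfolding e(1) using hom_positive_elem[OF d] \<epsilon> by (intro B.cnorm_minus_cut_down) auto
    \<comment> \<open>Perturbing \<open>x\<close> and cutting down \<open>d\<close> each cost
      \<open>\<epsilon> / 4\<close>; the sum is strictly below the cut
      \<open>\<epsilon>\<close>.\<close>
    ultimately show "cnorm B (y \<ominus>\<^bsub>B\<^esub> \<psi> i e) \<le> \<epsilon> / 2"
      using B.cnorm_diff_triangle[OF yc(1) hom_closed[OF dc(1)] hom_closed[OF ec]] by linarith
  qed (use \<epsilon> in simp)
  moreover have "cuntz_subequiv B (\<psi> i e) (\<psi> i a')"
    using hom_cuntz_subequiv[OF ec a'c] f(3) by (simp add: e_def d_def h_def)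
  moreover have "cuntz_subequiv B (\<psi> i a') a"
    unfolding a'(2)
  proof (rule B.cuntz_subequiv_cut_down[OF _ _ a(1)])
    show "star B (\<psi> i c) = \<psi> i c"
      using cc by (simp flip: hom_star)
    show "cnorm B (\<psi> i c \<ominus>\<^bsub>B\<^esub> a) \<le> cnorm B a / 8"
      using c_close B.cnorm_minus_commute[OF ac, of "\<psi> i c"] cc by simp
  qed (use cc a_pos in auto)
  moreover have "cut_down B y \<epsilon> \<in> carrier B"
    using B.cut_down_closed[OF yc] \<epsilon> by simp
  ultimately have "cuntz_subequiv B (cut_down B y \<epsilon>) a"
    using B.cuntz_subequiv_trans ec a'c ac by (meson hom_closed)
  moreover have "cnorm B (\<psi> i (f z) \<otimes>\<^bsub>B\<^esub> b \<ominus>\<^bsub>B\<^esub> b \<otimes>\<^bsub>B\<^esub> \<psi> i (f z)) < \<epsilon>"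
    if z: "z \<in> carrier_mat n n" "mat_op_norm n z \<le> 1" and b: "b \<in> F" for z b
  proof -
    have fz: "f z \<in> carrier (A i)"
      using linear_mapD(1)[OF lin, of z] z(1) by (simp add: mat_cstar_def)
    have "cnorm (A i) (f z) \<le> 1"
      using f(1) z by (force simp: cpc_map_def mat_cstar_def)
    then have norm: "cnorm B (\<psi> i (f z)) \<le> 1"
      using contractive[OF fz] by linarith
    have gb: "g b \<in> carrier (A i)" "cnorm B (b \<ominus>\<^bsub>B\<^esub> \<psi> i (g b)) < \<epsilon> / 4"
      using g[of b] b \<delta>(2) by auto
    have "\<psi> i (f z) \<otimes>\<^bsub>B\<^esub> \<psi> i (g b) \<ominus>\<^bsub>B\<^esub> \<psi> i (g b) \<otimes>\<^bsub>B\<^esub> \<psi> i (f z)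
        = \<psi> i (f z \<otimes>\<^bsub>A i\<^esub> g b \<ominus>\<^bsub>A i\<^esub> g b \<otimes>\<^bsub>A i\<^esub> f z)"
      using fz gb by simp
    also have "cnorm B \<dots> \<le> cnorm (A i) (f z \<otimes>\<^bsub>A i\<^esub> g b \<ominus>\<^bsub>A i\<^esub> g b \<otimes>\<^bsub>A i\<^esub> f z)"
      using fz gb by (intro contractive) auto
    also have "\<dots> < \<epsilon> / 4"
      using f(4) z b by blast
    finally show ?thesis
      using B.cnorm_commutator_diff[OF hom_closed[OF fz] norm subsetD[OF F(2) b] hom_closed[OF gb(1)]]
        gb(2) \<epsilon> by linarith
  qed
  moreover have "order_zero (mat_cstar n) B (\<lambda>z. \<psi> i (f z))"
    using f(2) lin positive_elem_mat_closed by (rule hom_order_zero)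
  ultimately show "\<exists>\<phi>. cpc_map (mat_cstar n) B \<phi> \<and> order_zero (mat_cstar n) B \<phi> \<and>
      cuntz_subequiv B (cut_down B (x \<otimes>\<^bsub>B\<^esub> x \<ominus>\<^bsub>B\<^esub> (x \<otimes>\<^bsub>B\<^esub> \<phi> (1\<^sub>m n)) \<otimes>\<^bsub>B\<^esub> x) \<epsilon>) a \<and>
      (\<forall>z\<in>carrier_mat n n. mat_op_norm n z \<le> 1 \<longrightarrow>
         (\<forall>b\<in>F. cnorm B (\<phi> z \<otimes>\<^bsub>B\<^esub> b \<ominus>\<^bsub>B\<^esub> b \<otimes>\<^bsub>B\<^esub> \<phi> z) < \<epsilon>))"
    using hom_cpc_map[OF f(1)] by (intro exI[of _ "\<lambda>z. \<psi> i (f z)"]) (simp add: y_def h_def)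
qed

end

theorem corollary4p8:
  fixes I :: "'i set" and leq :: "'i \<Rightarrow> 'i \<Rightarrow> bool"
    and A :: "'i \<Rightarrow> 'a cstar_alg" and \<phi> :: "'i \<Rightarrow> 'i \<Rightarrow> 'a \<Rightarrow> 'a"
    and B :: "'b cstar_alg" and \<psi> :: "'i \<Rightarrow> 'a \<Rightarrow> 'b"
  assumes "cstar_directed_system I leq A \<phi>"
    and "\<And>i. i \<in> I \<Longrightarrow> simple_cstar (A i) \<and> tracially_Z_absorbing (A i)"
    and "cstar_algebra B"
    and "cstar_direct_limit I leq A \<phi> B \<psi>"
  shows "simple_cstar B \<and> tracially_Z_absorbing B"
proof -
  interpret cstar_limit I leq A \<phi> B \<psi>
    using assms(4) by unfold_locales
  show ?thesis
    using simple_limit tracially_Z_absorbing_limit assms(2) by blast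
qed

end
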